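(* There exist an absolute constant $\alpha\ge 1$ and a polynomial-time algorithm which, given a finite metric space $(V,d)$ and a nonempty set of depots $D\subseteq V$, outputs a tree cover with depots $\{T_o\}_{o\in D}$ such that for every $p\in[1,\infty)$, $$\Big(\sum_{o\in D} w(T_o)^p\Big)^{1/p}\le \alpha\cdot \mathrm{OPT}_p ,$$ where $\mathrm{OPT}_p$ is the minimum of $\big(\sum_{o\in D} w(\hat T_o)^p\big)^{1/p}$ over all tree covers with depots $\{\hat T_o\}_{o\in D}$. (That is, the All-Norm Tree Cover with Depots problem admits a polynomial-time $O(1)$-approximation.)
   Context: A finite metric space $(V,d)$ is identified with the complete graph on $V$ with edge weights $d$. A tree is a tree in this complete graph on some subset of $V$ (a single vertex is allowed); its weight is $w(T)=\sum_{uv\in E(T)} d(u,v)$. For $D\subseteq V$, a tree cover with depots is a family of trees $\{T_o\}_{o\in D}$, one for each depot, such that $o\in V(T_o)$ for every $o\in D$ and $\bigcup_{o\in D}V(T_o)=V$; the trees need not be disjoint. *)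

theory Defs
  imports
    "HOL-Analysis.Analysis"
    "HOL-Library.Log_Nat"
    "HOL-Computational_Algebra.Polynomial"
begin

section \<open>Polynomial-time programs\<close>

text \<open>
  The machine model is a deterministic while-language over binary trees with integer leaves
  (lists are nested pairs ending in the leaf 0).  Every evaluation of an operator is charged
  at least the bit sizes of its operands and of its result, and reading a variable is charged
  the full size of its contents.  Hence a multi-tape Turing machine that keeps every program
  variable on a tape of its own simulates a program with polynomial overhead, and conversely
  tapes are lists of atoms; so polynomial cost in this model is polynomial time in the usual
  (bit complexity) sense.
\<close>

datatype val = Atom int | Node val val

text \<open>An atom occupies one unit plus the binary length of its absolute value.\<close>

primrec vsize :: "val \<Rightarrow> nat" where
  "vsize (Atom z) = Suc (nat (bitlen \<bar>z\<bar>))"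
| "vsize (Node a b) = Suc (vsize a + vsize b)"

primrec to_int :: "val \<Rightarrow> int" where
  "to_int (Atom z) = z"
| "to_int (Node a b) = 0"

primrec left :: "val \<Rightarrow> val" where
  "left (Atom z) = Atom 0"
| "left (Node a b) = a"

primrec right :: "val \<Rightarrow> val" where
  "right (Atom z) = Atom 0"
| "right (Node a b) = b"

primrec is_node :: "val \<Rightarrow> bool" where
  "is_node (Atom z) = False"
| "is_node (Node a b) = True"

datatype expr =
    Var nat
  | Lit int
  | Left expr
  | Right expr
  | IsNode expr
  | Cons expr expr
  | Add expr expr
  | Sub expr expr
  | Mul expr expr
  | Leq expr expr

type_synonym state = "nat \<Rightarrow> val"

primrec eval_expr :: "expr \<Rightarrow> state \<Rightarrow> val" where
  "eval_expr (Var x) s = s x"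
| "eval_expr (Lit k) s = Atom k"
| "eval_expr (Left e) s = left (eval_expr e s)"
| "eval_expr (Right e) s = right (eval_expr e s)"
| "eval_expr (IsNode e) s = Atom (of_bool (is_node (eval_expr e s)))"
| "eval_expr (Cons e f) s = Node (eval_expr e s) (eval_expr f s)"
| "eval_expr (Add e f) s = Atom (to_int (eval_expr e s) + to_int (eval_expr f s))"
| "eval_expr (Sub e f) s = Atom (to_int (eval_expr e s) - to_int (eval_expr f s))"
| "eval_expr (Mul e f) s = Atom (to_int (eval_expr e s) * to_int (eval_expr f s))"
| "eval_expr (Leq e f) s = Atom (of_bool (to_int (eval_expr e s) \<le> to_int (eval_expr f s)))"

text \<open>The cost of an expression is the total size of the values of all its subexpressions.\<close>

primrec ecost :: "expr \<Rightarrow> state \<Rightarrow> nat" where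
  "ecost (Var x) s = vsize (eval_expr (Var x) s)"
| "ecost (Lit k) s = vsize (eval_expr (Lit k) s)"
| "ecost (Left e) s = ecost e s + vsize (eval_expr (Left e) s)"
| "ecost (Right e) s = ecost e s + vsize (eval_expr (Right e) s)"
| "ecost (IsNode e) s = ecost e s + vsize (eval_expr (IsNode e) s)"
| "ecost (Cons e f) s = ecost e s + ecost f s + vsize (eval_expr (Cons e f) s)"
| "ecost (Add e f) s = ecost e s + ecost f s + vsize (eval_expr (Add e f) s)"
| "ecost (Sub e f) s = ecost e s + ecost f s + vsize (eval_expr (Sub e f) s)"
| "ecost (Mul e f) s = ecost e s + ecost f s + vsize (eval_expr (Mul e f) s)"
| "ecost (Leq e f) s = ecost e s + ecost f s + vsize (eval_expr (Leq e f) s)"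

datatype com =
    Skip
  | Assign nat expr
  | Seq com com
  | Cond expr com com
  | While expr com

text \<open>\<open>exec c s t s'\<close>: started in \<open>s\<close>, the program \<open>c\<close> halts in \<open>s'\<close> with total cost \<open>t\<close>.
  A guard is false iff its value is \<open>Atom 0\<close>.\<close>

inductive exec :: "com \<Rightarrow> state \<Rightarrow> nat \<Rightarrow> state \<Rightarrow> bool" where
  exec_Skip: "exec Skip s 1 s"
| exec_Assign: "exec (Assign x e) s (Suc (ecost e s)) (s(x := eval_expr e s))"
| exec_Seq: "exec c1 s t1 s1 \<Longrightarrow> exec c2 s1 t2 s2 \<Longrightarrow> exec (Seq c1 c2) s (Suc (t1 + t2)) s2"
| exec_CondT: "eval_expr g s \<noteq> Atom 0 \<Longrightarrow> exec c1 s t s' \<Longrightarrow>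
    exec (Cond g c1 c2) s (Suc (ecost g s + t)) s'"
| exec_CondF: "eval_expr g s = Atom 0 \<Longrightarrow> exec c2 s t s' \<Longrightarrow>
    exec (Cond g c1 c2) s (Suc (ecost g s + t)) s'"
| exec_WhileF: "eval_expr g s = Atom 0 \<Longrightarrow> exec (While g c) s (Suc (ecost g s)) s"
| exec_WhileT: "eval_expr g s \<noteq> Atom 0 \<Longrightarrow> exec c s t1 s1 \<Longrightarrow> exec (While g c) s1 t2 s2 \<Longrightarrow>
    exec (While g c) s (Suc (ecost g s + t1 + t2)) s2"

inductive_cases exec_SkipE: "exec Skip s t s'"
inductive_cases exec_AssignE: "exec (Assign x e) s t s'"
inductive_cases exec_SeqE: "exec (Seq c1 c2) s t s'"
inductive_cases exec_CondE: "exec (Cond g c1 c2) s t s'"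
inductive_cases exec_WhileE: "exec (While g c) s t s'"

lemma exec_deterministic:
  "exec c s t s' \<Longrightarrow> exec c s u s'' \<Longrightarrow> u = t \<and> s'' = s'"
proof (induction arbitrary: u s'' rule: exec.induct)
  case (exec_Skip s)
  then show ?case by (auto elim: exec_SkipE)
next
  case (exec_Assign x e s)
  then show ?case by (auto elim: exec_AssignE)
next
  case (exec_Seq c1 s t1 s1 c2 t2 s2)
  from exec_Seq.prems obtain u1 u2 r where "exec c1 s u1 r" "exec c2 r u2 s''" "u = Suc (u1 + u2)"
    by (rule exec_SeqE)
  with exec_Seq.IH show ?case by metis
next
  case (exec_CondT g s c1 t s' c2)
  from exec_CondT.prems exec_CondT.hyps obtain u1
    where "exec c1 s u1 s''" "u = Suc (ecost g s + u1)"
    by (auto elim: exec_CondE)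
  with exec_CondT.IH show ?case by metis
next
  case (exec_CondF g s c2 t s' c1)
  from exec_CondF.prems exec_CondF.hyps obtain u1
    where "exec c2 s u1 s''" "u = Suc (ecost g s + u1)"
    by (auto elim: exec_CondE)
  with exec_CondF.IH show ?case by metis
next
  case (exec_WhileF g s c)
  from exec_WhileF.prems exec_WhileF.hyps show ?case by (auto elim: exec_WhileE)
next
  case (exec_WhileT g s c t1 s1 t2 s2)
  from exec_WhileT.prems obtain u1 u2 r
    where "exec c s u1 r" "exec (While g c) r u2 s''" "u = Suc (ecost g s + u1 + u2)"
    by (rule exec_WhileE) (use exec_WhileT.hyps in auto)
  with exec_WhileT.IH show ?case by metis
qed

text \<open>The input is placed in variable 0, where the output is also found; all other variables
  start as \<open>Atom 0\<close>.\<close>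

definition computes_in :: "com \<Rightarrow> val \<Rightarrow> nat \<Rightarrow> val \<Rightarrow> bool" where
  "computes_in c x t y \<longleftrightarrow> (\<exists>s. exec c ((\<lambda>_. Atom 0)(0 := x)) t s \<and> s 0 = y)"

definition polynomial_time_on :: "val set \<Rightarrow> com \<Rightarrow> bool" where
  "polynomial_time_on X c \<longleftrightarrow>
     (\<exists>q :: nat poly. \<forall>x\<in>X. \<exists>t y. computes_in c x t y \<and> t \<le> poly q (vsize x))"

definition outputs :: "com \<Rightarrow> val \<Rightarrow> val \<Rightarrow> bool" where
  "outputs c x y \<longleftrightarrow> (\<exists>t. computes_in c x t y)"


section \<open>Tree covers with depots\<close>

text \<open>A subgraph of the complete graph is a pair of a vertex set and a set of 2-element edges.\<close>

type_synonym 'a ugraph = "'a set \<times> 'a set set"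

definition is_cycle :: "'a set set \<Rightarrow> 'a list \<Rightarrow> bool" where
  "is_cycle E xs \<longleftrightarrow> length xs \<ge> 3 \<and> distinct xs \<and>
     (\<forall>i<length xs. {xs ! i, xs ! (Suc i mod length xs)} \<in> E)"

definition is_tree_in :: "'a set \<Rightarrow> 'a ugraph \<Rightarrow> bool" where
  "is_tree_in V T \<longleftrightarrow>
     fst T \<noteq> {} \<and> fst T \<subseteq> V \<and>
     snd T \<subseteq> {{u, v} |u v. u \<in> fst T \<and> v \<in> fst T \<and> u \<noteq> v} \<and>
     (\<forall>u\<in>fst T. \<forall>v\<in>fst T. (u, v) \<in> {(x, y). {x, y} \<in> snd T}\<^sup>*) \<and>
     (\<nexists>xs. is_cycle (snd T) xs)"

text \<open>Each edge is counted once, in the orientation \<open>u < v\<close>.\<close>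

definition weight :: "('a::linorder \<Rightarrow> 'a \<Rightarrow> real) \<Rightarrow> 'a ugraph \<Rightarrow> real" where
  "weight d T = (\<Sum>(u, v) | u < v \<and> {u, v} \<in> snd T. d u v)"

definition tree_cover :: "'a set \<Rightarrow> 'a set \<Rightarrow> ('a \<Rightarrow> 'a ugraph) \<Rightarrow> bool" where
  "tree_cover V D T \<longleftrightarrow>
     (\<forall>r\<in>D. is_tree_in V (T r) \<and> r \<in> fst (T r)) \<and> (\<Union>r\<in>D. fst (T r)) = V"

definition cover_norm ::
    "real \<Rightarrow> ('a::linorder \<Rightarrow> 'a \<Rightarrow> real) \<Rightarrow> 'a set \<Rightarrow> ('a \<Rightarrow> 'a ugraph) \<Rightarrow> real" where
  "cover_norm p d D T = (\<Sum>r\<in>D. weight d (T r) powr p) powr (1 / p)"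

definition opt_norm ::
    "real \<Rightarrow> ('a::linorder \<Rightarrow> 'a \<Rightarrow> real) \<Rightarrow> 'a set \<Rightarrow> 'a set \<Rightarrow> real" where
  "opt_norm p d V D = Min {cover_norm p d D T |T. tree_cover V D T}"

text \<open>The minimum in \<open>opt_norm\<close> is taken over a finite nonempty set.\<close>

lemma finite_cover_norms:
  assumes "finite V" "D \<subseteq> V"
  shows "finite {cover_norm p d D T |T. tree_cover V D T}"
proof -
  have fD: "finite D" using assms finite_subset by blast
  have sub: "{cover_norm p d D T |T. tree_cover V D T}
      \<subseteq> cover_norm p d D ` (D \<rightarrow>\<^sub>E (Pow V \<times> Pow (Pow V)))"
  proof clarify
    fix T assume T: "tree_cover V D T"
    have "T r \<in> Pow V \<times> Pow (Pow V)" if "r \<in> D" for r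
    proof -
      have t: "is_tree_in V (T r)" using T that by (simp add: tree_cover_def)
      then have a: "fst (T r) \<subseteq> V" by (simp add: is_tree_in_def)
      have "snd (T r) \<subseteq> {{u, v} |u v. u \<in> fst (T r) \<and> v \<in> fst (T r) \<and> u \<noteq> v}"
        using t by (simp add: is_tree_in_def)
      then have "snd (T r) \<subseteq> Pow V" using a by blast
      with a show ?thesis by (simp add: mem_Times_iff)
    qed
    then have "restrict T D \<in> D \<rightarrow>\<^sub>E (Pow V \<times> Pow (Pow V))" by auto
    moreover have "cover_norm p d D T = cover_norm p d D (restrict T D)"
      by (simp add: cover_norm_def)
    ultimately show "cover_norm p d D T \<in> cover_norm p d D ` (D \<rightarrow>\<^sub>E (Pow V \<times> Pow (Pow V)))"
      by blast
  qed
  show ?thesis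
    by (rule finite_subset[OF sub], intro finite_imageI finite_PiE) (use assms fD in auto)
qed

lemma star_is_tree:
  assumes "r \<in> V"
  shows "is_tree_in V (V, {{r, v} |v. v \<in> V \<and> v \<noteq> r})"
proof -
  let ?E = "{{r, v} |v. v \<in> V \<and> v \<noteq> r}"
  have conn: "(u, v) \<in> {(x, y). {x, y} \<in> ?E}\<^sup>*" if "u \<in> V" "v \<in> V" for u v
  proof -
    have "(u, r) \<in> {(x, y). {x, y} \<in> ?E}\<^sup>*"
      using that by (cases "u = r") (auto simp: insert_commute intro!: r_into_rtrancl)
    moreover have "(r, v) \<in> {(x, y). {x, y} \<in> ?E}\<^sup>*"
      using that by (cases "v = r") (auto intro!: r_into_rtrancl)
    ultimately show ?thesis by (rule rtrancl_trans)
  qed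
  have acyc: "\<not> is_cycle ?E xs" for xs
  proof
    assume c: "is_cycle ?E xs"
    let ?n = "length xs"
    have n: "?n \<ge> 3" and dist: "distinct xs"
      and e: "\<And>i. i < ?n \<Longrightarrow> {xs ! i, xs ! (Suc i mod ?n)} \<in> ?E"
      using c by (auto simp: is_cycle_def)
    have has: "r = xs ! i \<or> r = xs ! (Suc i mod ?n)" if "i < ?n" for i
      using e[OF that] by (auto simp: doubleton_eq_iff)
    have h0: "r = xs ! 0 \<or> r = xs ! 1" using has[of 0] n by (cases xs) auto
    have h1: "r = xs ! 1 \<or> r = xs ! 2" using has[of 1] n by (simp add: numeral_2_eq_2)
    have h2: "r = xs ! 2 \<or> r = xs ! (3 mod ?n)" using has[of 2] n by (simp add: numeral_3_eq_3)
    have neq: "xs ! i \<noteq> xs ! j" if "i < ?n" "j < ?n" "i \<noteq> j" for i j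
      using that dist by (simp add: nth_eq_iff_index_eq)
    have d01: "xs ! 0 \<noteq> xs ! 2" "xs ! 1 \<noteq> xs ! 2"
      using n by (intro neq; linarith)+
    have "3 mod ?n \<noteq> 1" "3 mod ?n < ?n"
      using n by (cases "?n = 3"; simp)+
    then have d3: "xs ! 1 \<noteq> xs ! (3 mod ?n)"
      using n by (intro neq) auto
    from h0 h1 h2 d01 d3 show False by auto
  qed
  have "?E \<subseteq> {{u, v} |u v. u \<in> V \<and> v \<in> V \<and> u \<noteq> v}"
  proof
    fix e assume "e \<in> ?E"
    then obtain v where "e = {r, v}" "v \<in> V" "v \<noteq> r" by blast
    then show "e \<in> {{u, v} |u v. u \<in> V \<and> v \<in> V \<and> u \<noteq> v}"
      using assms by blast
  qed
  moreover have "V \<noteq> {}" using assms by blast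
  ultimately show ?thesis
    using conn acyc by (simp add: is_tree_in_def)
qed

lemma tree_cover_exists:
  assumes "D \<subseteq> V" "D \<noteq> {}"
  shows "\<exists>T. tree_cover V D T"
proof -
  have "tree_cover V D (\<lambda>r. (V, {{r, v} |v. v \<in> V \<and> v \<noteq> r}))"
    using assms star_is_tree[of _ V] unfolding tree_cover_def by auto
  then show ?thesis by blast
qed


section \<open>Instances and their encodings\<close>

text \<open>
  The points of an instance are \<open>0, \<dots>, n - 1\<close>, and distances are rational so that they can be
  written down in binary.  The library locale \<^locale>\<open>Metric_space\<close> also asks for
  nonnegativity and symmetry of \<open>d\<close> outside the carrier; this is no restriction, since values
  there are never used and may be set to 0.
\<close>

definition is_instance :: "nat \<Rightarrow> (nat \<Rightarrow> nat \<Rightarrow> rat) \<Rightarrow> nat set \<Rightarrow> bool" where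
  "is_instance n d D \<longleftrightarrow>
     Metric_space {..<n} (\<lambda>u v. real_of_rat (d u v)) \<and> D \<noteq> {} \<and> D \<subseteq> {..<n}"

primrec enc_list :: "val list \<Rightarrow> val" where
  "enc_list [] = Atom 0"
| "enc_list (x # xs) = Node x (enc_list xs)"

definition enc_nat :: "nat \<Rightarrow> val" where
  "enc_nat k = Atom (int k)"

text \<open>Numerator and denominator in lowest terms, with positive denominator.\<close>

definition enc_rat :: "rat \<Rightarrow> val" where
  "enc_rat x = (case quotient_of x of (a, b) \<Rightarrow> Node (Atom a) (Atom b))"

text \<open>The number of points, the sorted list of depots, and the distance matrix by rows.\<close>

definition enc_instance :: "nat \<Rightarrow> (nat \<Rightarrow> nat \<Rightarrow> rat) \<Rightarrow> nat set \<Rightarrow> val" where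
  "enc_instance n d D =
     Node (enc_nat n)
       (Node (enc_list (map enc_nat (sorted_list_of_set D)))
         (enc_list (map (\<lambda>u. enc_list (map (\<lambda>v. enc_rat (d u v)) [0..<n])) [0..<n])))"

text \<open>A solution is written as a list of trees, each given by a list of its vertices and a list
  of its edges; the \<open>i\<close>-th tree belongs to the \<open>i\<close>-th depot in increasing order.\<close>

type_synonym solution = "(nat list \<times> (nat \<times> nat) list) list"

definition enc_solution :: "solution \<Rightarrow> val" where
  "enc_solution ts =
     enc_list (map (\<lambda>(vs, es).
       Node (enc_list (map enc_nat vs))
         (enc_list (map (\<lambda>(u, v). Node (enc_nat u) (enc_nat v)) es))) ts)"

definition represents :: "nat set \<Rightarrow> solution \<Rightarrow> (nat \<Rightarrow> nat ugraph) \<Rightarrow> bool" where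
  "represents D ts T \<longleftrightarrow>
     map (\<lambda>(vs, es). (set vs, (\<lambda>(u, v). {u, v}) ` set es)) ts = map T (sorted_list_of_set D)"

end

theory Submission
  imports Defs
begin

text \<open>Grow a tree from every depot at once by repeatedly adding the cheapest edge leaving the part
  reached so far, and turn each tree into a closed tour.  By an exchange argument, the greedy edges
  that added the vertices of any set \<open>S\<close> are together at most as long as any tree that connects
  \<open>S\<close> to a depot.

  For each power of two \<open>L\<close>, cut the tours into intervals of length \<open>L\<close> and assign the intervals,
  by an auction, to depots at distance at most about \<open>L\<close>, each depot taking boundedly many.  If this
  fails for some intervals, the auction prices exhibit a set of intervals with too few nearby
  depots; by the exchange argument a constant fraction of the length of these intervals must then
  lie, in every cover, on trees of weight more than \<open>L / 2\<close>, and these intervals keep the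
  assignment made at level \<open>2 L\<close>.  Hence for every \<open>L\<close> at once the load assigned in pieces
  longer than \<open>L\<close> is bounded by the weight of the heavy trees of any cover, and a layer cake
  summation over the levels bounds all norms simultaneously.

  That the algorithm runs in polynomial time is derived from closure properties of the functions
  computed by polynomial-time programs.\<close>

section \<open>Polynomial-time functions on encodable types\<close>

text \<open>One cover must be good for every norm, so there is no optimal value to guess; the output
  is compared with an arbitrary cover at every scale. The obstacle is that sets of intervals failing
  at different levels could all be blamed on the same few light trees. Hence a depot close to a
  failed interval is blocked on all finer levels: the sets of newly blocked depots are then
  disjoint, and the deficiencies add up to \<open>2 * L * |B| \<le> total failed length\<close>,
  where \<open>B\<close> contains every depot within \<open>L\<close> of a failed interval. The
  light trees meeting these intervals then weigh at most a quarter of that length. An auction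
  replaces a maximum matching because a price that no slot has cuts off a deficient set of jobs at
  once.

  The factor 1224 is \<open>17 * 18 * 4\<close>. Points of an interval of length \<open>K\<close>
  are within \<open>8 K\<close> of their depot, so serving it costs \<open>8 K + 8 K + K\<close>. A
  depot has at most 9 intervals of each length, and lengths are powers of two, so they sum to at
  most 18 times the longest. The 4 bounds the loss in the layer cake, whose factor
  \<open>4 * 2 powr (p - 1)\<close> is at most \<open>4 powr p\<close>.\<close>

class encodable =
  fixes encode :: "'a \<Rightarrow> val"

instantiation int :: encodable begin
definition "encode (i::int) = Atom i"
instance ..
end

instantiation nat :: encodable begin
definition "encode (n::nat) = Atom (int n)"
instance ..
end

instantiation bool :: encodable begin
definition "encode (b::bool) = Atom (of_bool b)"
instance ..
end

instantiation prod :: (encodable, encodable) encodable begin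
definition "encode (p :: 'a \<times> 'b) = Node (encode (fst p)) (encode (snd p))"
instance ..
end

instantiation list :: (encodable) encodable begin
definition "encode (xs :: 'a list) = enc_list (map encode xs)"
instance ..
end

abbreviation sz :: "'a::encodable \<Rightarrow> nat" where "sz x \<equiv> vsize (encode x)"

lemma encode_Nil [simp]: "encode [] = Atom 0" and encode_Cons [simp]: "encode (x # xs) = Node (encode x) (encode xs)"
  by (simp_all add: encode_list_def)

lemma encode_Pair [simp]: "encode (x, y) = Node (encode x) (encode y)"
  by (simp add: encode_prod_def)

lemma vsize_pos [simp]: "0 < vsize v" by (cases v) auto

lemma poly_mono_nat: "x \<le> y \<Longrightarrow> poly (q::nat poly) x \<le> poly q y"
  by (induction q) (auto intro!: add_mono mult_mono)

text \<open>The program is parametric in the register \<open>k\<close> holding argument and result; it may destroy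
  the registers above \<open>k\<close> but not those below.\<close>

definition runs :: "(nat \<Rightarrow> com) \<Rightarrow> ('a::encodable \<Rightarrow> 'b::encodable) \<Rightarrow> nat poly \<Rightarrow> bool" where
  "runs c f q \<longleftrightarrow> (\<forall>k s x. s k = encode x \<longrightarrow>
     (\<exists>t s'. exec (c k) s t s' \<and> s' k = encode (f x) \<and> (\<forall>i<k. s' i = s i) \<and>
       t + sz (f x) \<le> poly q (sz x)))"

definition PT :: "('a::encodable \<Rightarrow> 'b::encodable) \<Rightarrow> bool" where
  "PT f \<longleftrightarrow> (\<exists>c q. runs c f q)"

lemma PTI: "(\<And>k s x. s k = encode x \<Longrightarrow> \<exists>t s'. exec (c k) s t s' \<and> s' k = encode (f x) \<and>
    (\<forall>i<k. s' i = s i) \<and> t + sz (f x) \<le> poly q (sz x)) \<Longrightarrow> PT f"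
  unfolding PT_def runs_def by blast

lemma runsD:
  assumes "runs c f q" "s k = encode x"
  obtains t s' where "exec (c k) s t s'" "s' k = encode (f x)" "\<And>i. i < k \<Longrightarrow> s' i = s i"
    "t + sz (f x) \<le> poly q (sz x)"
  using assms unfolding runs_def by blast

text \<open>\<open>runs\<close> charges the size of the result together with the running time, so
  the size bounds that folds and loops ask for are available for every function in
  \<open>PT\<close>.\<close>

lemma PT_sz:
  assumes "PT f" obtains q :: "nat poly" where "\<And>x. sz (f x) \<le> poly q (sz x)"
proof -
  obtain c q where r: "runs c f q" using assms unfolding PT_def by blast
  have "sz (f x) \<le> poly q (sz x)" for x
    using runsD[OF r, of "\<lambda>_. encode x" 0 x] by (metis add_leD2)
  then show thesis using that by blast
qed

named_theorems PT_intros

lemma PT_id [PT_intros]: "PT (\<lambda>x. x)"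
proof (rule PTI[where c = "\<lambda>_. Skip" and q = "[:1,1:]"])
  fix k and s :: state and x :: 'a assume "s k = encode x"
  then show "\<exists>t s'. exec Skip s t s' \<and> s' k = encode x \<and> (\<forall>i<k. s' i = s i) \<and> t + sz x \<le> poly [:1,1:] (sz x)"
    by (intro exI[of _ 1] exI[of _ s]) (use exec_Skip[of s] in auto)
qed

text \<open>The second program is charged in the size of the intermediate value, which is itself
  polynomially bounded; hence the composed polynomial.\<close>

lemma PT_comp:
  assumes "PT g" "PT f" shows "PT (\<lambda>x. g (f x))"
proof -
  obtain cf qf cg qg where f: "runs cf f qf" and g: "runs cg g qg"
    using assms unfolding PT_def by blast
  show ?thesis
  proof (rule PTI[where c = "\<lambda>k. Seq (cf k) (cg k)" and q = "qf + (qg \<circ>\<^sub>p qf) + 1"])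
    fix k and s :: state and x :: 'c assume s: "s k = encode x"
    obtain t1 s1 where 1: "exec (cf k) s t1 s1" "s1 k = encode (f x)" "\<And>i. i < k \<Longrightarrow> s1 i = s i"
      "t1 + sz (f x) \<le> poly qf (sz x)" using runsD[OF f, of s k, OF s] by blast
    obtain t2 s2 where 2: "exec (cg k) s1 t2 s2" "s2 k = encode (g (f x))" "\<And>i. i < k \<Longrightarrow> s2 i = s1 i"
      "t2 + sz (g (f x)) \<le> poly qg (sz (f x))" using runsD[OF g, of s1 k, OF 1(2)] by blast
    have "poly qg (sz (f x)) \<le> poly qg (poly qf (sz x))" using 1(4) by (intro poly_mono_nat) simp
    then show "\<exists>t s'. exec (Seq (cf k) (cg k)) s t s' \<and> s' k = encode (g (f x)) \<and>
        (\<forall>i<k. s' i = s i) \<and> t + sz (g (f x)) \<le> poly (qf + (qg \<circ>\<^sub>p qf) + 1) (sz x)"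
      using 1 2 by (intro exI[of _ "Suc (t1 + t2)"] exI[of _ s2])
        (auto intro: exec_Seq simp: poly_pcompose)
  qed
qed

lemma PT_expr:
  assumes ev: "\<And>s k x. s k = encode x \<Longrightarrow> eval_expr (e k) s = encode (f x)"
    and cost: "\<And>s k x. s k = encode x \<Longrightarrow> ecost (e k) s + sz (f x) \<le> poly q (sz x)"
  shows "PT f"
proof (rule PTI[where c = "\<lambda>k. Assign k (e k)" and q = "q + 1"])
  fix k and s :: state and x :: 'a assume s: "s k = encode x"
  show "\<exists>t s'. exec (Assign k (e k)) s t s' \<and> s' k = encode (f x) \<and>
        (\<forall>i<k. s' i = s i) \<and> t + sz (f x) \<le> poly (q + 1) (sz x)"
    using ev[of s, OF s] cost[of s, OF s] exec_Assign[of k "e k" s]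
    by (intro exI[of _ "Suc (ecost (e k) s)"] exI[of _ "s(k := eval_expr (e k) s)"])
      auto
qed

primrec lit_expr :: "val \<Rightarrow> expr" where
  "lit_expr (Atom z) = Lit z"
| "lit_expr (Node a b) = Cons (lit_expr a) (lit_expr b)"

lemma eval_lit_expr [simp]: "eval_expr (lit_expr v) s = v" by (induction v) auto

lemma ecost_lit_expr: "ecost (lit_expr v) s = ecost (lit_expr v) s'" by (induction v) auto

lemma PT_const [PT_intros]: "PT (\<lambda>x. c)"
  by (rule PT_expr[where e = "\<lambda>_. lit_expr (encode c)" and
        q = "[:ecost (lit_expr (encode c)) (\<lambda>_. Atom 0) + sz c:]"]) (auto intro: eq_imp_le ecost_lit_expr)

lemma PT_fst' : "PT fst"
proof (rule PT_expr[where e = "\<lambda>k. Left (Var k)" and q = "[:0,3:]"])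
  fix s :: state and k and x :: "'a \<times> 'b" assume "s k = encode x"
  then show "eval_expr (Left (Var k)) s = encode (fst x)"
    "ecost (Left (Var k)) s + sz (fst x) \<le> poly [:0, 3:] (sz x)" by (cases x; simp)+
qed

lemma PT_snd': "PT snd"
proof (rule PT_expr[where e = "\<lambda>k. Right (Var k)" and q = "[:0,3:]"])
  fix s :: state and k and x :: "'a \<times> 'b" assume "s k = encode x"
  then show "eval_expr (Right (Var k)) s = encode (snd x)"
    "ecost (Right (Var k)) s + sz (snd x) \<le> poly [:0, 3:] (sz x)" by (cases x; simp)+
qed

lemmas PT_fst [PT_intros] = PT_comp[OF PT_fst'] and PT_snd [PT_intros] = PT_comp[OF PT_snd']

text \<open>A program may destroy all registers above its own. So \<open>f\<close> runs on a copy in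
  \<open>Suc k\<close>, which protects the argument in \<open>k\<close>, and then \<open>g\<close>
  on a copy in \<open>Suc (Suc k)\<close>, which protects the result of \<open>f\<close>.\<close>

lemma PT_Pair [PT_intros]:
  assumes "PT f" "PT g" shows "PT (\<lambda>x. (f x, g x))"
proof -
  obtain cf qf cg qg where f: "runs cf f qf" and g: "runs cg g qg"
    using assms unfolding PT_def by blast
  show ?thesis
  proof (rule PTI[where c = "\<lambda>k. Seq (Assign (Suc k) (Var k)) (Seq (cf (Suc k))
       (Seq (Assign (Suc (Suc k)) (Var k)) (Seq (cg (Suc (Suc k)))
         (Assign k (Cons (Var (Suc k)) (Var (Suc (Suc k))))))))" and
       q = "[:9,2:] + qf * [:3:] + qg * [:3:]"])
    fix k and s :: state and x :: 'a assume s: "s k = encode x"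
    let ?s0 = "s(Suc k := encode x)"
    have 0: "exec (Assign (Suc k) (Var k)) s (Suc (sz x)) ?s0"
      using exec_Assign[of "Suc k" "Var k" s] s by simp
    obtain t1 s1 where 1: "exec (cf (Suc k)) ?s0 t1 s1" "s1 (Suc k) = encode (f x)"
      "\<And>i. i < Suc k \<Longrightarrow> s1 i = ?s0 i" "t1 + sz (f x) \<le> poly qf (sz x)"
      using runsD[OF f, of ?s0 "Suc k" x] by auto
    let ?s2 = "s1(Suc (Suc k) := encode x)"
    have 2: "exec (Assign (Suc (Suc k)) (Var k)) s1 (Suc (sz x)) ?s2"
      using exec_Assign[of "Suc (Suc k)" "Var k" s1] s 1(3)[of k] by simp
    obtain t3 s3 where 3: "exec (cg (Suc (Suc k))) ?s2 t3 s3" "s3 (Suc (Suc k)) = encode (g x)"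
      "\<And>i. i < Suc (Suc k) \<Longrightarrow> s3 i = ?s2 i" "t3 + sz (g x) \<le> poly qg (sz x)"
      using runsD[OF g, of ?s2 "Suc (Suc k)" x] by auto
    let ?s4 = "s3(k := encode (f x, g x))"
    have 4: "exec (Assign k (Cons (Var (Suc k)) (Var (Suc (Suc k))))) s3
        (Suc (Suc (2 * sz (f x) + 2 * sz (g x)))) ?s4"
      using exec_Assign[of k "Cons (Var (Suc k)) (Var (Suc (Suc k)))" s3] 3(2) 3(3)[of "Suc k"] 1(2)
      by (simp add: algebra_simps mult_2)
    note ex = exec_Seq[OF 0 exec_Seq[OF 1(1) exec_Seq[OF 2 exec_Seq[OF 3(1) 4]]]]
    show "\<exists>t s'. exec (Seq (Assign (Suc k) (Var k)) (Seq (cf (Suc k))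
       (Seq (Assign (Suc (Suc k)) (Var k)) (Seq (cg (Suc (Suc k)))
         (Assign k (Cons (Var (Suc k)) (Var (Suc (Suc k))))))))) s t s' \<and> s' k = encode (f x, g x) \<and>
        (\<forall>i<k. s' i = s i) \<and> t + sz (f x, g x) \<le> poly ([:9,2:] + qf * [:3:] + qg * [:3:]) (sz x)"
      by (rule exI, rule exI, rule conjI, rule ex) (use 1 3 in auto)
  qed
qed

lemma PT_if [PT_intros]:
  assumes "PT b" "PT f" "PT g" shows "PT (\<lambda>x. if b x then f x else g x)"
proof -
  obtain cb qb cf qf cg qg where b: "runs cb b qb" and f: "runs cf f qf" and g: "runs cg g qg"
    using assms unfolding PT_def by blast
  show ?thesis
  proof (rule PTI[where c = "\<lambda>k. Seq (Assign (Suc k) (Var k)) (Seq (cb (Suc k))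
       (Cond (Var (Suc k)) (cf k) (cg k)))" and q = "[:4,1:] + qb + qf + qg"])
    fix k and s :: state and x :: 'a assume s: "s k = encode x"
    let ?s0 = "s(Suc k := encode x)"
    have 0: "exec (Assign (Suc k) (Var k)) s (Suc (sz x)) ?s0"
      using exec_Assign[of "Suc k" "Var k" s] s by simp
    obtain t1 s1 where 1: "exec (cb (Suc k)) ?s0 t1 s1" "s1 (Suc k) = encode (b x)"
      "\<And>i. i < Suc k \<Longrightarrow> s1 i = ?s0 i" "t1 + sz (b x) \<le> poly qb (sz x)"
      using runsD[OF b, of ?s0 "Suc k" x] by auto
    have sk: "s1 k = encode x" using 1(3)[of k] s by simp
    obtain t2 s2 where 2: "exec (Cond (Var (Suc k)) (cf k) (cg k)) s1 (Suc (sz (b x) + t2)) s2"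
      "s2 k = encode (if b x then f x else g x)"
      "\<And>i. i < k \<Longrightarrow> s2 i = s1 i"
      "t2 + sz (if b x then f x else g x) \<le> poly qf (sz x) + poly qg (sz x)"
    proof (cases "b x")
      case True
      obtain t2 s2 where 2: "exec (cf k) s1 t2 s2" "s2 k = encode (f x)"
        "\<And>i. i < k \<Longrightarrow> s2 i = s1 i" "t2 + sz (f x) \<le> poly qf (sz x)"
        using runsD[OF f, of s1 k, OF sk] by auto
      show thesis using that[of t2 s2] exec_CondT[of "Var (Suc k)" s1 "cf k" t2 s2 "cg k"] 2 1(2) True
        by (simp add: encode_bool_def)
    next
      case False
      obtain t2 s2 where 2: "exec (cg k) s1 t2 s2" "s2 k = encode (g x)"
        "\<And>i. i < k \<Longrightarrow> s2 i = s1 i" "t2 + sz (g x) \<le> poly qg (sz x)"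
        using runsD[OF g, of s1 k, OF sk] by auto
      show thesis using that[of t2 s2] exec_CondF[of "Var (Suc k)" s1 "cg k" t2 s2 "cf k"] 2 1(2) False
        by (simp add: encode_bool_def)
    qed
    note ex = exec_Seq[OF 0 exec_Seq[OF 1(1) 2(1)]]
    show "\<exists>t s'. exec (Seq (Assign (Suc k) (Var k)) (Seq (cb (Suc k))
       (Cond (Var (Suc k)) (cf k) (cg k)))) s t s' \<and> s' k = encode (if b x then f x else g x) \<and>
        (\<forall>i<k. s' i = s i) \<and> t + sz (if b x then f x else g x) \<le> poly ([:4,1:] + qb + qf + qg) (sz x)"
      by (rule exI, rule exI, rule conjI, rule ex) (use 1 2 in auto)
  qed
qed

section \<open>Bit sizes of integers, arithmetic and comparisons\<close>

lemma vsize_Atom_le_iff: "vsize (Atom z) \<le> Suc m \<longleftrightarrow> \<bar>z\<bar> < 2 ^ m"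
  using bitlen_le_iff_power[of "\<bar>z\<bar>" m] by (simp add: nat_le_iff)

lemma vsize_Atom_obtain: obtains m where "vsize (Atom z) = Suc m" "\<bar>z\<bar> < 2 ^ m"
  using vsize_Atom_le_iff[of z "nat (bitlen \<bar>z\<bar>)"] by auto

lemma vsize_Atom_add: "vsize (Atom (a + b)) \<le> vsize (Atom a) + vsize (Atom b)"
proof -
  obtain m where m: "vsize (Atom a) = Suc m" "\<bar>a\<bar> < 2 ^ m" by (rule vsize_Atom_obtain)
  obtain n where n: "vsize (Atom b) = Suc n" "\<bar>b\<bar> < 2 ^ n" by (rule vsize_Atom_obtain)
  have "\<bar>a + b\<bar> < 2 ^ m + 2 ^ n" using m(2) n(2) by linarith
  also have "(2::int) ^ m + 2 ^ n \<le> 2 ^ (m + n) + 2 ^ (m + n)"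
    by (intro add_mono power_increasing) auto
  also have "\<dots> = 2 ^ (m + n + 1)" by simp
  finally show ?thesis using vsize_Atom_le_iff[of "a + b" "m + n + 1"] m(1) n(1) by simp
qed

lemma vsize_Atom_diff: "vsize (Atom (a - b)) \<le> vsize (Atom a) + vsize (Atom b)"
  using vsize_Atom_add[of a "- b"] by simp

lemma vsize_Atom_mult: "vsize (Atom (a * b)) \<le> vsize (Atom a) + vsize (Atom b)"
proof -
  obtain m where m: "vsize (Atom a) = Suc m" "\<bar>a\<bar> < 2 ^ m" by (rule vsize_Atom_obtain)
  obtain n where n: "vsize (Atom b) = Suc n" "\<bar>b\<bar> < 2 ^ n" by (rule vsize_Atom_obtain)
  have "\<bar>a * b\<bar> < 2 ^ m * 2 ^ n" using m(2) n(2) by (simp add: abs_mult mult_strict_mono)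
  then have "\<bar>a * b\<bar> < 2 ^ (m + n)" by (simp add: power_add)
  then show ?thesis using vsize_Atom_le_iff[of "a * b" "m + n"] m(1) n(1) by simp
qed

lemma PT_binop:
  fixes h :: "'a::encodable \<Rightarrow> 'b::encodable \<Rightarrow> 'c::encodable"
  assumes ev: "\<And>x y s e f. eval_expr e s = encode x \<Longrightarrow> eval_expr f s = encode y \<Longrightarrow> eval_expr (op e f) s = encode (h x y)"
    and cost: "\<And>s e f. ecost (op e f) s = ecost e s + ecost f s + vsize (eval_expr (op e f) s)"
    and size: "\<And>x y. sz (h x y) \<le> sz x + sz y"
    and f: "PT f" and g: "PT g"
  shows "PT (\<lambda>x. h (f x) (g x))"
proof -
  have "PT (\<lambda>p. h (fst p) (snd p))"
  proof (rule PT_expr[where e = "\<lambda>k. op (Left (Var k)) (Right (Var k))" and q = "[:0,6:]"])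
    fix s :: state and k and p :: "'a \<times> 'b" assume s: "s k = encode p"
    obtain x y where p: "p = (x, y)" by (cases p)
    have e: "eval_expr (op (Left (Var k)) (Right (Var k))) s = encode (h x y)"
      by (rule ev) (use s p in simp_all)
    then show "eval_expr (op (Left (Var k)) (Right (Var k))) s = encode (h (fst p) (snd p))"
      using p by simp
    show "ecost (op (Left (Var k)) (Right (Var k))) s + sz (h (fst p) (snd p)) \<le> poly [:0, 6:] (sz p)"
      using size[of x y] e s p by (simp add: cost)
  qed
  from PT_comp[OF this PT_Pair[OF f g]] show ?thesis by simp
qed

lemma PT_add_int [PT_intros]: "PT f \<Longrightarrow> PT g \<Longrightarrow> PT (\<lambda>x. f x + g x :: int)"
  by (rule PT_binop[where op = Add]) (auto simp: encode_int_def simp del: vsize.simps intro: vsize_Atom_add)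

lemma PT_mult_int [PT_intros]: "PT f \<Longrightarrow> PT g \<Longrightarrow> PT (\<lambda>x. f x * g x :: int)"
  by (rule PT_binop[where op = Mul]) (auto simp: encode_int_def simp del: vsize.simps intro: vsize_Atom_mult)

lemma PT_diff_int [PT_intros]: "PT f \<Longrightarrow> PT g \<Longrightarrow> PT (\<lambda>x. f x - g x :: int)"
  by (rule PT_binop[where op = Sub]) (auto simp: encode_int_def simp del: vsize.simps intro: vsize_Atom_diff)

lemma PT_add_nat [PT_intros]: "PT f \<Longrightarrow> PT g \<Longrightarrow> PT (\<lambda>x. f x + g x :: nat)"
  by (rule PT_binop[where op = Add])
    (auto simp: encode_nat_def simp del: vsize.simps intro: vsize_Atom_add)

lemma PT_le_int [PT_intros]: "PT f \<Longrightarrow> PT g \<Longrightarrow> PT (\<lambda>x. (f x :: int) \<le> g x)"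
  by (rule PT_binop[where op = Leq and h = "(\<le>)"])
    (simp_all add: encode_int_def encode_bool_def bitlen_alt_def)

lemma PT_le_nat [PT_intros]: "PT f \<Longrightarrow> PT g \<Longrightarrow> PT (\<lambda>x. (f x :: nat) \<le> g x)"
  by (rule PT_binop[where op = Leq and h = "(\<le>)"])
    (simp_all add: encode_nat_def encode_bool_def bitlen_alt_def)

lemma PT_not [PT_intros]: "PT f \<Longrightarrow> PT (\<lambda>x. \<not> f x)"
proof -
  assume "PT f"
  moreover have "(\<lambda>x. \<not> f x) = (\<lambda>x. if f x then False else True)" by auto
  ultimately show ?thesis by (simp only:) (intro PT_intros)
qed

lemma PT_conj [PT_intros]: "PT f \<Longrightarrow> PT g \<Longrightarrow> PT (\<lambda>x. f x \<and> g x)"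
proof -
  assume "PT f" "PT g"
  moreover have "(\<lambda>x. f x \<and> g x) = (\<lambda>x. if f x then g x else False)" by auto
  ultimately show ?thesis by (simp only:) (intro PT_intros)
qed

lemma PT_less_int [PT_intros]: "PT f \<Longrightarrow> PT g \<Longrightarrow> PT (\<lambda>x. (f x :: int) < g x)"
  unfolding not_le[symmetric] by (intro PT_intros)

lemma PT_less_nat [PT_intros]: "PT f \<Longrightarrow> PT g \<Longrightarrow> PT (\<lambda>x. (f x :: nat) < g x)"
  unfolding not_le[symmetric] by (intro PT_intros)

lemma PT_eq_int [PT_intros]: "PT f \<Longrightarrow> PT g \<Longrightarrow> PT (\<lambda>x. (f x :: int) = g x)"
  unfolding order_class.order_eq_iff by (intro PT_intros)

lemma PT_eq_nat [PT_intros]: "PT f \<Longrightarrow> PT g \<Longrightarrow> PT (\<lambda>x. (f x :: nat) = g x)"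
  unfolding order_class.order_eq_iff by (intro PT_intros)

lemma PT_eq_prod [PT_intros]:
  assumes "PT (\<lambda>x. fst (f x) = fst (g x))" "PT (\<lambda>x. snd (f x) = snd (g x))"
  shows "PT (\<lambda>x. f x = g x)"
  unfolding prod_eq_iff by (intro PT_conj assms)

text \<open>A bound variable becomes a further component of the argument. All rules for constructs
  with binders take their body in this uncurried form.\<close>

lemma PT_Let [PT_intros]:
  assumes "PT f" "PT (\<lambda>z. g (fst z) (snd z))" shows "PT (\<lambda>x. let y = f x in g x y)"
  using PT_comp[OF assms(2) PT_Pair[OF PT_id assms(1)]] by (simp add: Let_def)

text \<open>A list cell has the same encoding as the pair of its head and tail, so nothing has to be
  computed once the pair is built.\<close>

lemma PT_Cons [PT_intros]:
  assumes "PT f" "PT g" shows "PT (\<lambda>x. f x # g x)"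
proof -
  have "PT (\<lambda>p. fst p # snd p)"
    by (rule PT_expr[where e = "\<lambda>k. Var k" and q = "[:0,2:]"]) (auto simp: encode_prod_def)
  from PT_comp[OF this PT_Pair[OF assms]] show ?thesis by simp
qed

text \<open>The encodings of \<open>(x, a # r)\<close> and \<open>(x, a, r)\<close> coincide, so in
  the nonempty case the register already holds the argument of \<open>g\<close>; only the empty case
  has to strip the list.\<close>

lemma PT_case_list [PT_intros]:
  fixes xs :: "'a::encodable \<Rightarrow> 'd::encodable list" and f :: "'a \<Rightarrow> 'b::encodable"
  assumes xs: "PT xs" and f: "PT f" and g: "PT (\<lambda>z. g (fst z) (fst (snd z)) (snd (snd z)))"
  shows "PT (\<lambda>x. case xs x of [] \<Rightarrow> f x | a # r \<Rightarrow> g x a r)"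
proof -
  obtain cf qf cg qg where f: "runs cf f qf"
    and g: "runs cg (\<lambda>z. g (fst z) (fst (snd z)) (snd (snd z))) qg"
    using f g unfolding PT_def by blast
  let ?h = "\<lambda>p. case snd p of [] \<Rightarrow> f (fst p) | a # r \<Rightarrow> g (fst p) a r"
  have "PT ?h"
  proof (rule PTI[where c = "\<lambda>k. Cond (IsNode (Right (Var k))) (cg k) (Seq (Assign k (Left (Var k))) (cf k))"
        and q = "[:9,5:] + qf + qg"])
    fix k and s :: state and p :: "'a \<times> 'd list" assume s: "s k = encode p"
    obtain x ys where p: "p = (x, ys)" by (cases p)
    show "\<exists>t s'. exec (Cond (IsNode (Right (Var k))) (cg k) (Seq (Assign k (Left (Var k))) (cf k))) s t s' \<and>
       s' k = encode (?h p) \<and> (\<forall>i<k. s' i = s i) \<and> t + sz (?h p) \<le> poly ([:9,5:] + qf + qg) (sz p)"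
    proof (cases ys)
      case Nil
      have gd: "eval_expr (IsNode (Right (Var k))) s = Atom 0" using s p Nil by simp
      have 0: "exec (Assign k (Left (Var k))) s (Suc (sz p + sz x)) (s(k := encode x))"
        using exec_Assign[of k "Left (Var k)" s] s p by simp
      obtain t s' where 1: "exec (cf k) (s(k := encode x)) t s'" "s' k = encode (f x)"
        "\<And>i. i < k \<Longrightarrow> s' i = (s(k := encode x)) i" "t + sz (f x) \<le> poly qf (sz x)"
        using runsD[OF f, of "s(k := encode x)" k x] by auto
      note ex = exec_CondF[OF gd exec_Seq[OF 0 1(1)], of "cg k"]
      have "poly qf (sz x) \<le> poly qf (sz p)" using p by (intro poly_mono_nat) simp
      with ex show ?thesis using 1 s p Nil
        by (intro exI[of _ s'] exI[of _ "Suc (ecost (IsNode (Right (Var k))) s + Suc (Suc (sz p + sz x) + t))"]) auto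
    next
      case (Cons a r)
      have gd: "eval_expr (IsNode (Right (Var k))) s \<noteq> Atom 0" using s p Cons by simp
      have s': "s k = encode (x, a, r)" using s p Cons by simp
      obtain t s' where 1: "exec (cg k) s t s'" "s' k = encode (g x a r)"
        "\<And>i. i < k \<Longrightarrow> s' i = s i" "t + sz (g x a r) \<le> poly qg (sz (x, a, r))"
        using runsD[OF g, of s k, OF s'] by auto
      note ex = exec_CondT[OF gd 1(1), of "Seq (Assign k (Left (Var k))) (cf k)"]
      have "sz (x, a, r) = sz p" using p Cons by simp
      with ex show ?thesis using 1 s p Cons
        by (intro exI[of _ s'] exI[of _ "Suc (ecost (IsNode (Right (Var k))) s + t)"])
            (auto simp: bitlen_alt_def)
    qed
  qed
  from PT_comp[OF this PT_Pair[OF PT_id xs]] show ?thesis unfolding fst_conv snd_conv .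
qed

text \<open>Exponentially growing intermediate results are excluded by the explicit size bound.\<close>

lemma PT_while:
  fixes f i :: "'a::encodable \<Rightarrow> 'b::encodable"
  assumes b: "PT b" and g: "PT g" and i: "PT i"
    and bound: "\<And>x. \<exists>N. N \<le> poly qn (sz x) \<and> \<not> b ((g ^^ N) (i x)) \<and> (\<forall>k<N. b ((g ^^ k) (i x))) \<and>
       (\<forall>k\<le>N. sz ((g ^^ k) (i x)) \<le> poly qs (sz x)) \<and> f x = (g ^^ N) (i x)"
  shows "PT f"
proof -
  obtain cb qb cg qg ci qi where b: "runs cb b qb" and g: "runs cg g qg" and i: "runs ci i qi"
    using assms unfolding PT_def by blast
  define body where "body k = Seq (cg k) (Seq (Assign (Suc k) (Var k)) (cb (Suc k)))" for k
  define loop where "loop k = While (Var (Suc k)) (body k)" for k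
  \<comment> \<open>\<open>R\<close> pays for one round: test, body, copy of the state and the next
    test, all on states of size at most \<open>qs\<close>.\<close>
  define R where "R = [:9:] + (qg \<circ>\<^sub>p qs) + [:2:] * (qb \<circ>\<^sub>p qs) + qs"
  show ?thesis
  proof (rule PTI[where c = "\<lambda>k. Seq (ci k) (Seq (Assign (Suc k) (Var k)) (Seq (cb (Suc k)) (loop k)))"
        and q = "qi + qs * [:2:] + (qb \<circ>\<^sub>p qs) * [:2:] + (qn + 1) * R + [:9:]"])
    fix k and s :: state and x :: 'a assume s: "s k = encode x"
    obtain N where N: "N \<le> poly qn (sz x)" "\<not> b ((g ^^ N) (i x))" "\<And>m. m < N \<Longrightarrow> b ((g ^^ m) (i x))"
      "\<And>m. m \<le> N \<Longrightarrow> sz ((g ^^ m) (i x)) \<le> poly qs (sz x)" "f x = (g ^^ N) (i x)"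
      using bound by blast
    define st where "st m = (g ^^ m) (i x)" for m
    have qbs: "poly qb (sz (st m)) \<le> poly qb (poly qs (sz x))" if "m \<le> N" for m
      using N(4)[OF that] by (intro poly_mono_nat) (simp add: st_def)
    have qgs: "poly qg (sz (st m)) \<le> poly qg (poly qs (sz x))" if "m \<le> N" for m
      using N(4)[OF that] by (intro poly_mono_nat) (simp add: st_def)
    \<comment> \<open>The guard is evaluated in advance on a copy and left in \<open>Suc k\<close>,
      since a while guard can only be an expression. The induction is on the number of rounds still
      to come.\<close>
    have loop: "\<exists>t r'. exec (loop k) r t r' \<and> r' k = encode (st N) \<and> (\<forall>i<k. r' i = r i) \<and>
       t \<le> (N - m + 1) * poly R (sz x)"
      if "r k = encode (st m)" "r (Suc k) = encode (b (st m))" "m \<le> N" for m r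
      using that
    proof (induction "N - m" arbitrary: m r)
      case 0
      then have m: "m = N" by simp
      have bf: "\<not> b (st N)" using N(2) st_def by simp
      have "exec (loop k) r (Suc (ecost (Var (Suc k)) r)) r"
        unfolding loop_def by (rule exec_WhileF) (use 0 m bf in \<open>simp add: encode_bool_def\<close>)
      then show ?case using 0 m bf
        by (intro exI[of _ "Suc (ecost (Var (Suc k)) r)"] exI[of _ r])
          (simp add: R_def encode_bool_def bitlen_alt_def)
    next
      case (Suc d)
      then have m: "m < N" by simp
      have bt: "b (st m)" using N(3)[OF m] st_def by simp
      obtain t1 r1 where 1: "exec (cg k) r t1 r1" "r1 k = encode (g (st m))"
        "\<And>i. i < k \<Longrightarrow> r1 i = r i" "t1 + sz (g (st m)) \<le> poly qg (sz (st m))"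
        using runsD[OF g, of r k, OF Suc.prems(1)] by blast
      have sm: "g (st m) = st (Suc m)" by (simp add: st_def)
      let ?r2 = "r1(Suc k := encode (st (Suc m)))"
      have 2: "exec (Assign (Suc k) (Var k)) r1 (Suc (sz (st (Suc m)))) ?r2"
        using exec_Assign[of "Suc k" "Var k" r1] 1(2) sm by simp
      obtain t3 r3 where 3: "exec (cb (Suc k)) ?r2 t3 r3" "r3 (Suc k) = encode (b (st (Suc m)))"
        "\<And>i. i < Suc k \<Longrightarrow> r3 i = ?r2 i" "t3 + sz (b (st (Suc m))) \<le> poly qb (sz (st (Suc m)))"
        using runsD[OF b, of ?r2 "Suc k" "st (Suc m)"] by auto
      have "\<exists>t r'. exec (loop k) r3 t r' \<and> r' k = encode (st N) \<and> (\<forall>i<k. r' i = r3 i) \<and>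
          t \<le> (N - Suc m + 1) * poly R (sz x)"
        using Suc.hyps(2) m 1(2) 3(2) 3(3)[of k] sm by (intro Suc.hyps(1)) auto
      then obtain t4 r4 where 4: "exec (loop k) r3 t4 r4" "r4 k = encode (st N)"
        "\<And>i. i < k \<Longrightarrow> r4 i = r3 i" "t4 \<le> (N - Suc m + 1) * poly R (sz x)" by blast
      have gd: "eval_expr (Var (Suc k)) r \<noteq> Atom 0"
        using Suc.prems(2) bt by (simp add: encode_bool_def)
      note ex = exec_WhileT[OF gd exec_Seq[OF 1(1) exec_Seq[OF 2 3(1)]] 4(1)[unfolded loop_def body_def]]
      have cost: "ecost (Var (Suc k)) r \<le> 2"
        using Suc.prems(2) bt by (simp add: encode_bool_def bitlen_alt_def)
      have "Suc (ecost (Var (Suc k)) r + Suc (t1 + Suc (Suc (sz (st (Suc m))) + t3)) + t4)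
          \<le> poly R (sz x) + (N - Suc m + 1) * poly R (sz x)"
        using 1(4) 3(4) 4(4) cost qbs[of "Suc m"] qgs[of m] N(4)[of "Suc m"] m
        by (simp add: R_def poly_pcompose st_def)
      also have "\<dots> = (N - m + 1) * poly R (sz x)" using m by (simp add: Suc_diff_Suc)
      finally have le: "Suc (ecost (Var (Suc k)) r + Suc (t1 + Suc (Suc (sz (st (Suc m))) + t3)) + t4)
          \<le> (N - m + 1) * poly R (sz x)" .
      have "r4 i = r i" if "i < k" for i
        using 1(3)[OF that] 3(3)[of i] 4(3)[OF that] that by simp
      with le 4(2) show ?case unfolding loop_def body_def using ex by blast
    qed
    obtain t1 s1 where 1: "exec (ci k) s t1 s1" "s1 k = encode (st 0)"
      "\<And>i. i < k \<Longrightarrow> s1 i = s i" "t1 + sz (st 0) \<le> poly qi (sz x)"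
      using runsD[OF i, of s k, OF s] st_def by auto
    let ?s2 = "s1(Suc k := encode (st 0))"
    have 2: "exec (Assign (Suc k) (Var k)) s1 (Suc (sz (st 0))) ?s2"
      using exec_Assign[of "Suc k" "Var k" s1] 1(2) by simp
    obtain t3 s3 where 3: "exec (cb (Suc k)) ?s2 t3 s3" "s3 (Suc k) = encode (b (st 0))"
      "\<And>i. i < Suc k \<Longrightarrow> s3 i = ?s2 i" "t3 + sz (b (st 0)) \<le> poly qb (sz (st 0))"
      using runsD[OF b, of ?s2 "Suc k" "st 0"] by auto
    obtain t4 s4 where 4: "exec (loop k) s3 t4 s4" "s4 k = encode (st N)" "\<And>i. i < k \<Longrightarrow> s4 i = s3 i"
      "t4 \<le> (N + 1) * poly R (sz x)"
      using loop[of s3 0] 3(2) 3(3)[of k] 1(2) by auto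
    note ex = exec_Seq[OF 1(1) exec_Seq[OF 2 exec_Seq[OF 3(1) 4(1)]]]
    have fx: "f x = st N" using N(5) st_def by simp
    have NR: "(N + 1) * poly R (sz x) \<le> (poly qn (sz x) + 1) * poly R (sz x)"
      using N(1) by (intro mult_right_mono) auto
    have "Suc (t1 + Suc (Suc (sz (st 0)) + Suc (t3 + t4))) + sz (f x)
      \<le> poly (qi + qs * [:2:] + (qb \<circ>\<^sub>p qs) * [:2:] + (qn + 1) * R + [:9:]) (sz x)"
    proof -
      have "poly (qi + qs * [:2:] + (qb \<circ>\<^sub>p qs) * [:2:] + (qn + 1) * R + [:9:]) (sz x) =
          poly qi (sz x) + 2 * poly qs (sz x) + 2 * poly qb (poly qs (sz x)) +
          (poly qn (sz x) + 1) * poly R (sz x) + 9"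
        by (simp add: poly_pcompose)
      moreover have "sz (st 0) \<le> poly qs (sz x)" "sz (f x) \<le> poly qs (sz x)"
        using N(4)[of 0] N(4)[of N] fx by (auto simp: st_def)
      ultimately show ?thesis
        using 1(4) 3(4) 4(4) NR qbs[of 0] by linarith
    qed
    moreover have "s4 i = s i" if "i < k" for i
      using 1(3)[OF that] 3(3)[of i] 4(3)[OF that] that by simp
    ultimately show "\<exists>t s'. exec (Seq (ci k) (Seq (Assign (Suc k) (Var k)) (Seq (cb (Suc k)) (loop k)))) s t s' \<and>
       s' k = encode (f x) \<and> (\<forall>i<k. s' i = s i) \<and>
       t + sz (f x) \<le> poly (qi + qs * [:2:] + (qb \<circ>\<^sub>p qs) * [:2:] + (qn + 1) * R + [:9:]) (sz x)"
      using ex 4(2) fx by metis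
  qed
qed

section \<open>Sizes of lists, folds and derived list functions\<close>

lemma sz_list: "sz (xs :: 'a::encodable list) = Suc (\<Sum>x\<leftarrow>xs. Suc (sz x))"
  by (induction xs) (auto simp: bitlen_alt_def)

lemma length_less_sz: "length (xs :: 'a::encodable list) < sz xs"
  by (induction xs) auto

lemma sz_member: "x \<in> set xs \<Longrightarrow> sz (x::'a::encodable) \<le> sz xs"
  by (induction xs) auto

lemma sz_list_le:
  assumes "\<And>x. x \<in> set xs \<Longrightarrow> sz (x::'a::encodable) \<le> B" "length xs \<le> m"
  shows "sz xs \<le> Suc (m * Suc B)"
proof -
  have "(\<Sum>x\<leftarrow>xs. Suc (sz x)) \<le> (\<Sum>x\<leftarrow>xs. Suc B)"
    using assms(1) by (intro sum_list_mono) auto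
  also have "\<dots> = length xs * Suc B" by (simp add: sum_list_triv)
  also have "\<dots> \<le> m * Suc B" using assms(2) by (intro mult_right_mono) auto
  finally show ?thesis by (simp add: sz_list)
qed

lemma sz_append: "Suc (sz (xs @ ys)) = sz xs + sz (ys :: 'a::encodable list)"
  by (simp add: sz_list)

text \<open>The loop state holds the context, the unread part of the list and the accumulator. The
  size bound is asked for every prefix because an accumulator may be large in the middle even if the
  end result is small.\<close>

lemma PT_foldl:
  fixes xs :: "'a::encodable \<Rightarrow> 'c::encodable list" and i :: "'a \<Rightarrow> 'b::encodable"
  assumes xs: "PT xs" and i: "PT i"
    and g: "PT (\<lambda>z. g (fst z) (fst (snd z)) (snd (snd z)))"
    and bound: "\<And>x ys zs. xs x = ys @ zs \<Longrightarrow> sz (foldl (g x) (i x) ys) \<le> poly q (sz x)"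
  shows "PT (\<lambda>x. foldl (g x) (i x) (xs x))"
proof -
  obtain qx where qx: "\<And>x. sz (xs x) \<le> poly qx (sz x)" using PT_sz[OF xs] by blast
  define b where "b st = (case fst (snd st) of [] \<Rightarrow> False | a # r \<Rightarrow> True)"
    for st :: "'a \<times> 'c list \<times> 'b"
  define h where "h st = (case fst (snd st) of [] \<Rightarrow> st | a # r \<Rightarrow> (fst st, r, g (fst st) (snd (snd st)) a))"
    for st :: "'a \<times> 'c list \<times> 'b"
  have PTg: "PT (\<lambda>z::('a \<times> 'c list \<times> 'b) \<times> 'c \<times> 'c list.
      g (fst (fst z)) (snd (snd (fst z))) (fst (snd z)))"
    by (rule PT_comp[OF g, of "\<lambda>z. (fst (fst z), snd (snd (fst z)), fst (snd z))", unfolded fst_conv snd_conv])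
      (intro PT_intros)
  have PTb: "PT b" unfolding b_def by (intro PT_intros)
  have PTh: "PT h" unfolding h_def by (intro PT_intros PTg)
  have iter: "(h ^^ k) (x, ys, acc) = (x, drop k ys, foldl (g x) acc (take k ys))" if "k \<le> length ys"
    for k x ys acc
    using that
  proof (induction k)
    case (Suc k)
    then have "drop k ys = ys ! k # drop (Suc k) ys" by (simp add: Cons_nth_drop_Suc)
    with Suc show ?case by (simp add: h_def take_Suc_conv_app_nth)
  qed simp
  have "PT (\<lambda>x. (x, [] :: 'c list, foldl (g x) (i x) (xs x)))"
  proof (rule PT_while[OF PTb PTh, where i = "\<lambda>x. (x, xs x, i x)" and qn = qx
        and qs = "[:2,1:] + qx + q"])
    show "PT (\<lambda>x. (x, xs x, i x))" by (intro PT_intros xs i)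
    fix x
    have size: "sz (x, drop k (xs x), foldl (g x) (i x) (take k (xs x))) \<le> poly ([:2,1:] + qx + q) (sz x)" for k
    proof -
      have "sz (drop k (xs x)) \<le> sz (xs x)"
        using sz_append[of "take k (xs x)" "drop k (xs x)"] vsize_pos[of "encode (take k (xs x))"]
        by (simp only: append_take_drop_id)
      then show ?thesis
        using qx[of x] bound[of x "take k (xs x)" "drop k (xs x)"] by simp
    qed
    show "\<exists>N. N \<le> poly qx (sz x) \<and> \<not> b ((h ^^ N) (x, xs x, i x)) \<and>
       (\<forall>k<N. b ((h ^^ k) (x, xs x, i x))) \<and>
       (\<forall>k\<le>N. sz ((h ^^ k) (x, xs x, i x)) \<le> poly ([:2,1:] + qx + q) (sz x)) \<and>
       (x, [], foldl (g x) (i x) (xs x)) = (h ^^ N) (x, xs x, i x)"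
    proof (intro exI[of _ "length (xs x)"] conjI allI impI)
      show "length (xs x) \<le> poly qx (sz x)" using length_less_sz[of "xs x"] qx[of x] by linarith
      show "\<not> b ((h ^^ length (xs x)) (x, xs x, i x))" by (simp add: iter b_def)
      show "b ((h ^^ k) (x, xs x, i x))" if "k < length (xs x)" for k
        using that by (auto simp: iter b_def split: list.splits)
      show "sz ((h ^^ k) (x, xs x, i x)) \<le> poly ([:2,1:] + qx + q) (sz x)" if "k \<le> length (xs x)" for k
        using size[of k] that by (simp only: iter)
    qed (simp add: iter)
  qed
  from PT_snd[OF PT_snd[OF this]] show ?thesis by simp
qed

text \<open>If a round adds at most an amount that depends on the context and the current element
  only, the accumulator stays polynomial. This covers the folds that never multiply what they have
  accumulated.\<close>

lemma PT_foldl_additive: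
  fixes xs :: "'a::encodable \<Rightarrow> 'c::encodable list" and i :: "'a \<Rightarrow> 'b::encodable"
  assumes xs: "PT xs" and i: "PT i"
    and g: "PT (\<lambda>z. g (fst z) (fst (snd z)) (snd (snd z)))"
    and size: "\<And>x acc a. sz (g x acc a) \<le> sz acc + poly q (sz (x, a))"
  shows "PT (\<lambda>x. foldl (g x) (i x) (xs x))"
proof -
  obtain qx where qx: "\<And>x. sz (xs x) \<le> poly qx (sz x)" using PT_sz[OF xs] by blast
  obtain qi where qi: "\<And>x. sz (i x) \<le> poly qi (sz x)" using PT_sz[OF i] by blast
  show ?thesis
  proof (rule PT_foldl[OF xs i g, where q = "qi + qx * (q \<circ>\<^sub>p ([:1,1:] + qx))"])
    fix x ys zs assume xs: "xs x = ys @ zs"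
    define B where "B = poly q (poly ([:1,1:] + qx) (sz x))"
    have B: "poly q (sz (x, a)) \<le> B" if "a \<in> set (ys @ zs)" for a
      unfolding B_def using sz_member[OF that] xs qx[of x] by (intro poly_mono_nat) simp
    have "sz (foldl (g x) acc ys) \<le> sz acc + length ys * B" for acc
      using B
    proof (induction ys arbitrary: acc)
      case (Cons a ys)
      have "sz (foldl (g x) (g x acc a) ys) \<le> sz (g x acc a) + length ys * B"
        using Cons by auto
      with size[of x acc a] Cons.prems[of a] show ?case by simp
    qed simp
    then have "sz (foldl (g x) (i x) ys) \<le> sz (i x) + length ys * B" .
    moreover have "length ys \<le> poly qx (sz x)"
      using length_less_sz[of "xs x"] qx[of x] xs by simp
    then have "length ys * B \<le> poly qx (sz x) * B" by (rule mult_right_mono) simp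
    moreover have "poly (qi + qx * (q \<circ>\<^sub>p ([:1,1:] + qx))) (sz x) = poly qi (sz x) + poly qx (sz x) * B"
      by (simp add: poly_pcompose B_def)
    ultimately show "sz (foldl (g x) (i x) ys) \<le> poly (qi + qx * (q \<circ>\<^sub>p ([:1,1:] + qx))) (sz x)"
      using qi[of x] by linarith
  qed
qed

lemma PT_rev [PT_intros]: assumes "PT xs" shows "PT (\<lambda>x. rev (xs x))"
proof -
  have "foldl (\<lambda>acc a. a # acc) acc ys = rev ys @ acc" for acc ys :: "'b list"
    by (induction ys arbitrary: acc) auto
  moreover have "PT (\<lambda>x. foldl (\<lambda>acc a. a # acc) [] (xs x))"
    by (rule PT_foldl_additive[where q = "[:1,1:]"]) (intro PT_intros assms | simp)+
  ultimately show ?thesis by simp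
qed

lemma PT_append [PT_intros]: assumes "PT xs" "PT ys" shows "PT (\<lambda>x. xs x @ ys x)"
proof -
  have "foldl (\<lambda>acc a. a # acc) acc zs = rev zs @ acc" for acc zs :: "'b list"
    by (induction zs arbitrary: acc) auto
  moreover have "PT (\<lambda>x. foldl (\<lambda>acc a. a # acc) (ys x) (rev (xs x)))"
    by (rule PT_foldl_additive[where q = "[:1,1:]"]) (intro PT_intros assms | simp)+
  ultimately show ?thesis by simp
qed

lemma PT_map [PT_intros]:
  fixes xs :: "'a::encodable \<Rightarrow> 'c::encodable list"
  assumes xs: "PT xs" and g: "PT (\<lambda>z. g (fst z) (snd z))" shows "PT (\<lambda>x. map (g x) (xs x))"
proof -
  obtain q where q: "\<And>z. sz (g (fst z) (snd z)) \<le> poly q (sz z)" using PT_sz[OF g] by blast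
  have q': "sz (g x a) \<le> poly q (sz (x, a))" for x a using q[of "(x, a)"] by simp
  have "foldl (\<lambda>acc a. g x a # acc) acc ys = rev (map (g x) ys) @ acc" for x acc ys
    by (induction ys arbitrary: acc) auto
  moreover have "PT (\<lambda>x. rev (foldl (\<lambda>acc a. g x a # acc) [] (xs x)))"
  proof (rule PT_rev, rule PT_foldl_additive[where q = "q + 1"])
    show "PT (\<lambda>z. g (fst z) (snd (snd z)) # fst (snd z))"
      using PT_comp[OF g, of "\<lambda>z. (fst z, snd (snd z))"] by (intro PT_Cons) (simp_all add: PT_intros)
    show "sz (g x a # acc) \<le> sz acc + poly (q + 1) (sz (x, a))" for x acc a
      using q'[of x a] by simp
  qed (intro PT_intros xs)+
  ultimately show ?thesis by simp
qed

lemma PT_concat [PT_intros]: assumes "PT xs" shows "PT (\<lambda>x. concat (xs x))"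
proof -
  have "foldl (\<lambda>acc a. acc @ a) acc ys = acc @ concat ys" for acc and ys :: "'b list list"
    by (induction ys arbitrary: acc) auto
  moreover have "PT (\<lambda>x. foldl (\<lambda>acc a. acc @ a) [] (xs x))"
  proof (rule PT_foldl_additive[where q = "[:0,1:]"])
    show "sz (acc @ a) \<le> sz acc + poly [:0, 1:] (sz (x, a))" for x :: 'a and acc a :: "'b list"
      using sz_append[of acc a] by simp
  qed (intro PT_intros assms)+
  ultimately show ?thesis by simp
qed

lemma PT_filter [PT_intros]:
  assumes xs: "PT xs" and g: "PT (\<lambda>z. P (fst z) (snd z))" shows "PT (\<lambda>x. filter (P x) (xs x))"
proof -
  have "filter (P x) ys = concat (map (\<lambda>a. if P x a then [a] else []) ys)" for x ys
    by (induction ys) simp_all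
  then show ?thesis by (simp only:) (intro PT_intros xs g)
qed

lemma PT_list_ex [PT_intros]:
  assumes xs: "PT xs" and g: "PT (\<lambda>z. P (fst z) (snd z))" shows "PT (\<lambda>x. list_ex (P x) (xs x))"
proof -
  have "list_ex (P x) ys = (case filter (P x) ys of [] \<Rightarrow> False | a # r \<Rightarrow> True)" for x ys
    by (induction ys) simp_all
  then show ?thesis by (simp only:) (intro PT_intros xs g)
qed

lemma PT_member [PT_intros]:
  assumes "PT a" "PT xs" and "PT (\<lambda>z :: 'b::encodable \<times> 'b. fst z = snd z)"
  shows "PT (\<lambda>x. (a x :: 'b) \<in> set (xs x))"
proof -
  have "a x \<in> set (xs x) \<longleftrightarrow> list_ex (\<lambda>y. y = a x) (xs x)" for x
    by (auto simp: list_ex_iff)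
  moreover have "PT (\<lambda>z. snd z = a (fst z))"
    by (rule PT_comp[OF assms(3), of "\<lambda>z. (snd z, a (fst z))", unfolded fst_conv snd_conv])
      (intro PT_intros PT_comp[OF assms(1)])
  ultimately show ?thesis by (simp only:) (intro PT_intros assms)
qed

lemma PT_remdups [PT_intros]:
  assumes "PT xs" and "PT (\<lambda>z :: 'b::encodable \<times> 'b. fst z = snd z)"
  shows "PT (\<lambda>x. remdups (xs x :: 'b list))"
proof -
  have 1: "foldl (\<lambda>acc a. if a \<in> set acc then acc else a # acc) [] (rev ys) = remdups ys" for ys :: "'b list"
    by (induction ys) (auto simp: foldl_conv_foldr)
  have "PT (\<lambda>x. foldl (\<lambda>acc a. if a \<in> set acc then acc else a # acc) [] (rev (xs x)))"
    by (rule PT_foldl_additive[where q = "[:1,1:]"]) (intro PT_intros assms | simp)+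
  then show ?thesis unfolding 1 .
qed

lemma PT_length [PT_intros]: assumes "PT xs" shows "PT (\<lambda>x. length (xs x))"
proof -
  have 1: "foldl (\<lambda>acc a. acc + 1) n ys = n + length ys" for n and ys :: "'b list"
    by (induction ys arbitrary: n) auto
  have "PT (\<lambda>x. foldl (\<lambda>acc a. acc + 1) (0::nat) (xs x))"
  proof (rule PT_foldl_additive[where q = "[:sz (1::nat):]"])
    show "sz (acc + 1) \<le> sz acc + poly [:sz (1::nat):] (sz (x, a))" for acc :: nat and x :: 'a and a :: 'b
      using vsize_Atom_add[of "int acc" 1] by (simp add: encode_nat_def add.commute del: vsize.simps)
  qed (intro PT_intros assms)+
  then show ?thesis unfolding 1 by simp
qed

text \<open>List access is a fold with a running index. The default value makes it total, as
  membership in \<open>PT\<close> speaks about all arguments, also ill-formed ones.\<close>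

lemma PT_nth_default [PT_intros]:
  assumes d: "PT d" and xs: "PT xs" and k: "PT k" shows "PT (\<lambda>x. nth_default (d x) (xs x) (k x))"
proof -
  let ?g = "\<lambda>k acc y. (fst acc + (1::nat), if fst acc = k then y else snd acc)"
  have 1: "foldl (?g k) (i, d) ys = (i + length ys, if i \<le> k \<and> k < i + length ys then ys ! (k - i) else d)"
    for k i d and ys :: "'b list"
    by (induction ys arbitrary: i d) (auto simp: nth_Cons' )
  have 2: "nth_default (d x) (xs x) (k x) = snd (foldl (?g (k x)) (0, d x) (xs x))" for x
    using 1[of "k x" 0 "d x" "xs x"] by (simp add: nth_default_def)
  have "PT (\<lambda>x. foldl (?g (k x)) (0, d x) (xs x))"
  proof (rule PT_foldl_additive[where q = "[:sz (1::nat), 1:]"])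
    show "sz (?g (k x) acc a) \<le> sz acc + poly [:sz (1::nat),1:] (sz (x, a))" for acc :: "nat \<times> 'b" and x a
      using vsize_Atom_add[of "int (fst acc)" 1]
      by (cases acc) (auto simp: encode_nat_def add.commute simp del: vsize.simps(1))
  qed (intro PT_intros assms PT_comp[OF k])+
  then show ?thesis unfolding 2 by (intro PT_intros)
qed

section \<open>The algorithm\<close>

text \<open>The result has at most one element; this stands for an option.\<close>

definition min_sel :: "('k::linorder \<times> 'b) list \<Rightarrow> ('k \<times> 'b) list" where
  "min_sel cs = foldl (\<lambda>acc a. case acc of [] \<Rightarrow> [a] | b # r \<Rightarrow> if fst a < fst b then [a] else acc) [] cs"

definition wt :: "nat \<times> int list \<Rightarrow> nat \<Rightarrow> nat \<Rightarrow> int" where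
  "wt E u v = nth_default 0 (snd E) (u * fst E + v)"

text \<open>The common denominator is the product of all denominators: bit lengths add under
  multiplication, so the numbers stay polynomially long without any gcd computation. The second
  component is the denominator of the prefix read so far.\<close>

definition scale_entries :: "(int \<times> int) list \<Rightarrow> int list \<times> int" where
  "scale_entries es = foldl (\<lambda>acc e. (map (\<lambda>z. z * snd e) (fst acc) @ [fst e * snd acc], snd acc * snd e)) ([], 1) es"

text \<open>The points are counted off along the rows and not up to the number \<open>n\<close> of
  the input: \<open>n\<close> is written in binary, so on an ill-formed input a loop up to
  \<open>n\<close> could be exponentially long.\<close>

definition points :: "'a list \<Rightarrow> nat list" where
  "points rws = foldl (\<lambda>acc _. length acc # acc) [] rws"

text \<open>A tour entry \<open>(y, c, l)\<close> is a step of length \<open>l\<close> that arrives at \<open>y\<close> along the tree edge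
  between \<open>c\<close> and its parent; the entry \<open>(r, r, 0)\<close> starts the tour of the depot \<open>r\<close>.\<close>

type_synonym step = "nat \<times> nat \<times> int"

definition insert_after :: "nat \<Rightarrow> step list \<Rightarrow> step list \<Rightarrow> step list" where
  "insert_after u new T = snd (foldl (\<lambda>acc e. if \<not> fst acc \<and> fst e = u
      then (True, snd acc @ (e # new)) else (fst acc, snd acc @ [e])) (False, []) T)"

definition unvisited :: "nat list \<Rightarrow> step list \<Rightarrow> nat list" where
  "unvisited vs T = filter (\<lambda>v. v \<notin> set (map fst T)) vs"

definition candidates :: "(nat \<Rightarrow> nat \<Rightarrow> int) \<Rightarrow> nat list \<Rightarrow> step list \<Rightarrow> (int \<times> nat \<times> nat) list" where
  "candidates w vs T = concat (map (\<lambda>e. map (\<lambda>v. (w (fst e) v, fst e, v)) (unvisited vs T)) T)"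

text \<open>One step of Prim's algorithm with all depots as a common source. The new edge is
  inserted as a detour \<open>u\<close>, \<open>v\<close>, \<open>u\<close>, so the tour stays
  closed.\<close>

definition tour_step :: "(nat \<Rightarrow> nat \<Rightarrow> int) \<Rightarrow> nat list \<Rightarrow> step list \<Rightarrow> step list" where
  "tour_step w vs T = (case min_sel (candidates w vs T) of [] \<Rightarrow> T
     | (l, u, v) # _ \<Rightarrow> insert_after u [(v, v, l), (u, v, l)] T)"

text \<open>The fold over \<open>vs\<close> only counts rounds: one round per point is enough, and
  further rounds change nothing.\<close>

definition tour :: "(nat \<Rightarrow> nat \<Rightarrow> int) \<Rightarrow> nat list \<Rightarrow> nat list \<Rightarrow> step list" where
  "tour w vs ds = foldl (\<lambda>T _. tour_step w vs T) (map (\<lambda>r. (r, r, 0)) ds) vs"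

text \<open>Each entry is annotated with its position within the tour of its depot, and with the depot.\<close>

type_synonym pstep = "nat \<times> nat \<times> int \<times> int \<times> nat"

definition annotate :: "step list \<Rightarrow> pstep list" where
  "annotate T = snd (snd (foldl (\<lambda>(r, P, out) (y, c, l). if l = 0 then (y, 0, out @ [(y, c, 0, 0, y)])
      else (r, P + l, out @ [(y, c, l, P + l, r)])) (0, 0, []) T))"

text \<open>Only an interval that the tour traverses to its right end carries the whole length
  \<open>L\<close>; at most the last piece of a tour fails this.\<close>

definition full :: "pstep list \<Rightarrow> int \<Rightarrow> nat \<Rightarrow> int \<Rightarrow> bool" where
  "full st L r a \<longleftrightarrow> list_ex (\<lambda>(y, c, l, P, r'). r' = r \<and> a + L \<le> P) st"

text \<open>The distance is measured to \<open>c\<close>, the point whose greedy edge is being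
  traversed: the interval is charged to the edge lengths of these points, so it matters which trees
  of a cover contain them.\<close>

definition nbs :: "(nat \<Rightarrow> nat \<Rightarrow> int) \<Rightarrow> pstep list \<Rightarrow> int \<Rightarrow> nat list \<Rightarrow> nat \<times> int \<Rightarrow> nat list" where
  "nbs w st L avail j = filter (\<lambda>q. list_ex (\<lambda>(y, c, l, P, r').
      r' = fst j \<and> snd j < P \<and> P - l < snd j + L \<and> w q c \<le> L) st) avail"

text \<open>A job is an identifier with the list of depots that may serve it.  A slot \<open>(q, i, p, own)\<close>
  is the \<open>i\<close>-th place at depot \<open>q\<close>, with price \<open>p\<close> and the list \<open>own\<close> of at most one job.\<close>

type_synonym 'j job = "'j \<times> nat list"
type_synonym 'j slot = "nat \<times> nat \<times> nat \<times> 'j job list"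
type_synonym 'j market = "'j job list \<times> 'j slot list \<times> 'j job list"

definition auction_step :: "'j market \<Rightarrow> 'j market" where
  "auction_step m = (case m of (pend, sl, G) \<Rightarrow> (case pend of [] \<Rightarrow> m | a # rest \<Rightarrow>
     (case min_sel (map (\<lambda>s. (fst (snd (snd s)), s))
         (filter (\<lambda>(q, i, p, own). q \<in> set (snd a) \<and> p \<le> length sl) sl)) of
       [] \<Rightarrow> (rest, sl, a # G)
     | (_, (q, i, p, own)) # _ \<Rightarrow> (case own of [] \<Rightarrow> rest | b # _ \<Rightarrow> b # rest,
         map (\<lambda>s. if fst s = q \<and> fst (snd s) = i \<and> fst (snd (snd s)) = p then (q, i, p + 1, [a]) else s) sl, G))))"

definition auction :: "'j market \<Rightarrow> 'j market" where
  "auction m = (auction_step ^^ (LEAST k. fst ((auction_step ^^ k) m) = [])) m"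

text \<open>The least number missing from \<open>ps\<close>; the fold over \<open>ps\<close> only
  counts rounds, and \<open>length ps\<close> of them suffice.\<close>

definition mex :: "nat list \<Rightarrow> nat" where
  "mex ps = foldl (\<lambda>t _. if t \<in> set ps then t + 1 else t) 0 ps"

text \<open>A record \<open>(v, P, r, a, L, q, act)\<close> says that the point \<open>v\<close>, at position \<open>P\<close> in the tour of
  depot \<open>r\<close>, lies in the interval \<open>{a<..a+L}\<close> of that tour and is assigned to depot \<open>q\<close>.\<close>

type_synonym rec = "nat \<times> int \<times> nat \<times> int \<times> int \<times> nat \<times> bool"

text \<open>Each active interval is halved and its points go to the half that contains them. They
  keep the depot of the coarser level, which is the fallback if the finer assignment fails.\<close>

definition refine :: "int \<Rightarrow> rec list \<Rightarrow> rec list" where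
  "refine L rs = map (\<lambda>(v, P, r, a, L0, q, act). if act
     then (v, P, r, if a + L < P then a + L else a, L, q, act) else (v, P, r, a, L0, q, act)) rs"

definition jobs :: "pstep list \<Rightarrow> int \<Rightarrow> rec list \<Rightarrow> (nat \<times> int) list" where
  "jobs st L rs = remdups (map (\<lambda>(v, P, r, a, _). (r, a))
     (filter (\<lambda>(v, P, r, a, L0, q, act). act \<and> full st L r a) rs))"

text \<open>Two places per depot: a deficient set of jobs is then at least twice as large as its set
  of depots, which is what leaves the light trees only a quarter of the length.\<close>

definition slots :: "nat list \<Rightarrow> 'j slot list" where
  "slots avail = concat (map (\<lambda>q. [(q, 0, 0, []), (q, 1, 0, [])]) avail)"

text \<open>A Hall violator: the jobs that gave up, and the holders of all slots priced above a
  value \<open>t\<close> that is nobody's price.\<close>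

definition dense :: "'j slot list \<Rightarrow> 'j job list \<Rightarrow> 'j job list" where
  "dense sl G = (let t = mex (map (\<lambda>s. fst (snd (snd s))) sl) in
     G @ concat (map (\<lambda>s. snd (snd (snd s))) (filter (\<lambda>s. t < fst (snd (snd s))) sl)))"

definition server :: "(nat \<times> int) slot list \<Rightarrow> nat \<times> int \<Rightarrow> nat \<Rightarrow> nat" where
  "server sl j r = foldl (\<lambda>acc (q, i, p, own). if list_ex (\<lambda>jb. fst jb = j) own then q else acc) r sl"

text \<open>An unfinished last piece goes back to its own depot, a violating interval is frozen with
  the depot it had at the coarser level, and every other interval goes to the depot that won it in
  the auction.\<close>

definition reassign :: "pstep list \<Rightarrow> int \<Rightarrow> (nat \<times> int) slot list \<Rightarrow> (nat \<times> int) list \<Rightarrow> rec list \<Rightarrow> rec list" where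
  "reassign st L sl vio rs = map (\<lambda>(v, P, r, a, L0, q, act).
     if \<not> act then (v, P, r, a, L0, q, act)
     else if \<not> full st L r a then (v, P, r, a, L0, r, True)
     else if (r, a) \<in> set vio then (v, P, r, a, L0, q, False)
     else (v, P, r, a, L0, server sl (r, a) r, True)) rs"

text \<open>The second component of the state collects the blocked depots: those adjacent to
  violators. They take part in no later auction, so the deficient sets of different levels involve
  disjoint sets of depots.\<close>

definition level_step :: "(nat \<Rightarrow> nat \<Rightarrow> int) \<Rightarrow> nat list \<Rightarrow> pstep list \<Rightarrow>
    rec list \<times> nat list \<Rightarrow> int \<Rightarrow> rec list \<times> nat list" where
  "level_step w ds st S L = (let
      rs = refine L (fst S);
      avail = filter (\<lambda>q. q \<notin> set (snd S)) ds;
      m = auction (map (\<lambda>j. (j, nbs w st L avail j)) (jobs st L rs), slots avail, []);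
      vio = dense (fst (snd m)) (snd (snd m))
    in (reassign st L (fst (snd m)) (map fst vio) rs,
        snd S @ filter (\<lambda>q. list_ex (\<lambda>jb. q \<in> set (snd jb)) vio) avail))"

definition pow_step :: "int \<times> int \<times> int list \<Rightarrow> int \<times> int \<times> int list" where
  "pow_step = (\<lambda>(x, L, Ls). (x, L + L, L # Ls))"

text \<open>Yields the first power of two that is at least \<open>x\<close>, together with all
  smaller powers in decreasing order; these are the levels still to be processed below the starting
  level.\<close>

definition pows :: "int \<Rightarrow> int \<times> int \<times> int list" where
  "pows x = (pow_step ^^ (LEAST k. x \<le> 2 ^ k)) (x, 1, [])"

text \<open>Only the step that first reaches a point along its own greedy edge is kept, so each
  point outside the depots has exactly one record. At the starting level a whole tour is one
  interval.\<close>

definition init_recs :: "pstep list \<Rightarrow> int \<Rightarrow> rec list" where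
  "init_recs st L = map (\<lambda>(y, c, l, P, r). (y, P, r, 0, L, r, True))
     (filter (\<lambda>(y, c, l, P, r). y = c \<and> l \<noteq> 0) st)"

definition max_pos :: "pstep list \<Rightarrow> int" where
  "max_pos st = foldl (\<lambda>m (y, c, l, P, r). if m < P then P else m) 0 st"

definition final_recs :: "(nat \<Rightarrow> nat \<Rightarrow> int) \<Rightarrow> nat list \<Rightarrow> pstep list \<Rightarrow> rec list" where
  "final_recs w ds st = (let pw = pows (max_pos st) in
     fst (foldl (level_step w ds st) (init_recs st (fst (snd pw)), []) (snd (snd pw))))"

definition served :: "rec list \<Rightarrow> nat \<Rightarrow> nat list" where
  "served rs q = map fst (filter (\<lambda>(v, P, r, a, L, q', act). q' = q) rs)"

definition path_edges :: "nat \<Rightarrow> nat list \<Rightarrow> (nat \<times> nat) list" where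
  "path_edges q vs = snd (foldl (\<lambda>(u, out) v. (v, out @ [(u, v)])) (q, []) vs)"

definition solve :: "nat \<times> nat list \<times> (int \<times> int) list list \<Rightarrow> solution" where
  "solve I = (let
      ds = fst (snd I);
      E = (fst I, fst (scale_entries (concat (snd (snd I)))));
      rs = final_recs (wt E) ds (annotate (tour (wt E) (points (snd (snd I))) ds))
    in map (\<lambda>q. let vs = served rs q in (q # vs, path_edges q vs)) ds)"

section \<open>The algorithm runs in polynomial time\<close>

lemma PT_mult_nat [PT_intros]: "PT f \<Longrightarrow> PT g \<Longrightarrow> PT (\<lambda>x. f x * g x :: nat)"
  by (rule PT_binop[where op = Mul])
    (auto simp: encode_nat_def simp del: vsize.simps intro: vsize_Atom_mult)

lemma PT_min_sel [PT_intros]: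
  assumes "PT cs" and "PT (\<lambda>z :: 'k::{linorder,encodable} \<times> 'k. fst z < snd z)"
  shows "PT (\<lambda>x. min_sel (cs x :: ('k \<times> 'b::encodable) list))"
  unfolding min_sel_def
proof (rule PT_foldl_additive[where q = "[:2,1:]"])
  have "PT (\<lambda>z. fst (f z) < fst (g z))" if "PT f" "PT g"
    for f g :: "'d::encodable \<Rightarrow> 'k \<times> 'b"
    by (rule PT_comp[OF assms(2), of "\<lambda>z. (fst (f z), fst (g z))", unfolded fst_conv snd_conv])
      (intro PT_intros that)
  note [PT_intros] = this
  show "PT (\<lambda>z::'a \<times> ('k \<times> 'b) list \<times> 'k \<times> 'b. case fst (snd z) of [] \<Rightarrow> [snd (snd z)]
     | b # r \<Rightarrow> if fst (snd (snd z)) < fst b then [snd (snd z)] else fst (snd z))"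
    by (intro PT_intros)
  show "sz (case acc of [] \<Rightarrow> [a] | b # r \<Rightarrow> if fst a < fst b then [a] else acc)
       \<le> sz acc + poly [:2, 1:] (sz (x, a))" for x :: 'a and acc and a :: "'k \<times> 'b"
    by (auto split: list.split)
qed (intro PT_intros assms)+

lemma PT_wt [PT_intros]:
  assumes "PT E" "PT u" "PT v" shows "PT (\<lambda>x. wt (E x) (u x) (v x))"
  unfolding wt_def by (intro PT_intros assms[THEN PT_comp])

lemma PT_full [PT_intros]:
  assumes "PT st" "PT L" "PT r" "PT a" shows "PT (\<lambda>x. full (st x) (L x) (r x) (a x))"
  unfolding full_def case_prod_unfold by (intro PT_intros assms[THEN PT_comp])

lemma PT_nbs [PT_intros]:
  assumes "PT E" "PT st" "PT L" "PT avail" "PT j"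
  shows "PT (\<lambda>x. nbs (wt (E x)) (st x) (L x) (avail x) (j x))"
  unfolding nbs_def case_prod_unfold by (intro PT_intros assms[THEN PT_comp])

lemma PT_unvisited [PT_intros]:
  assumes "PT vs" "PT T" shows "PT (\<lambda>x. unvisited (vs x) (T x))"
  unfolding unvisited_def by (intro PT_intros assms[THEN PT_comp])

lemma PT_candidates [PT_intros]:
  assumes "PT E" "PT vs" "PT T" shows "PT (\<lambda>x. candidates (wt (E x)) (vs x) (T x))"
  unfolding candidates_def by (intro PT_intros assms[THEN PT_comp])

lemma PT_insert_after [PT_intros]:
  assumes "PT u" "PT new" "PT T" shows "PT (\<lambda>x. insert_after (u x) (new x) (T x))"
proof -
  have "PT (\<lambda>z. insert_after (fst z) (fst (snd z)) (snd (snd z)))"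
    unfolding insert_after_def
    apply (rule PT_snd)
    apply (rule PT_foldl_additive[where q = "[:2,1:]"])
       apply (intro PT_intros)
      apply (intro PT_intros)
     apply (intro PT_intros)
    subgoal for x acc a
      using sz_append[of "snd acc" "a # fst (snd x)"] sz_append[of "snd acc" "[a]"]
      by (cases x; cases acc) (auto simp: encode_bool_def bitlen_alt_def)
    done
  from PT_comp[OF this PT_Pair[OF assms(1) PT_Pair[OF assms(2,3)]]] show ?thesis
    unfolding fst_conv snd_conv .
qed

lemma PT_refine [PT_intros]:
  assumes "PT L" "PT rs" shows "PT (\<lambda>x. refine (L x) (rs x))"
  unfolding refine_def case_prod_unfold by (intro PT_intros assms[THEN PT_comp])

lemma PT_jobs [PT_intros]:
  assumes "PT st" "PT L" "PT rs" shows "PT (\<lambda>x. jobs (st x) (L x) (rs x))"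
  unfolding jobs_def case_prod_unfold by (intro PT_intros assms[THEN PT_comp])

lemma PT_slots [PT_intros]:
  assumes "PT avail" shows "PT (\<lambda>x. slots (avail x) :: 'j::encodable slot list)"
  unfolding slots_def by (intro PT_intros assms[THEN PT_comp])

lemma PT_mex [PT_intros]: assumes "PT ps" shows "PT (\<lambda>x. mex (ps x))"
  unfolding mex_def
proof (rule PT_foldl_additive[where q = "[:sz (1::nat):]"])
  show "sz (if acc \<in> set (ps x) then acc + 1 else acc) \<le> sz acc + poly [:sz (1::nat):] (sz (x, a))"
    for acc x and a :: nat
    using vsize_Atom_add[of "int acc" 1] by (simp add: encode_nat_def add.commute del: vsize.simps)
qed (intro PT_intros assms[THEN PT_comp])+

lemma PT_dense [PT_intros]:
  assumes "PT sl" "PT G" shows "PT (\<lambda>x. dense (sl x) (G x) :: 'j::encodable job list)"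
  unfolding dense_def by (intro PT_intros assms[THEN PT_comp])

lemma PT_server [PT_intros]:
  assumes "PT sl" "PT j" "PT r" shows "PT (\<lambda>x. server (sl x) (j x) (r x))"
  unfolding server_def case_prod_unfold
  by (rule PT_foldl_additive[where q = "[:0,1:]"])
    ((intro PT_intros assms[THEN PT_comp])+, auto simp: encode_prod_def)

lemma PT_reassign [PT_intros]:
  assumes "PT st" "PT L" "PT sl" "PT vio" "PT rs"
  shows "PT (\<lambda>x. reassign (st x) (L x) (sl x) (vio x) (rs x))"
  unfolding reassign_def case_prod_unfold by (intro PT_intros assms[THEN PT_comp])

lemma PT_init_recs [PT_intros]:
  assumes "PT st" "PT L" shows "PT (\<lambda>x. init_recs (st x) (L x))"
  unfolding init_recs_def case_prod_unfold by (intro PT_intros assms[THEN PT_comp])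

lemma PT_max_pos [PT_intros]: assumes "PT st" shows "PT (\<lambda>x. max_pos (st x))"
  unfolding max_pos_def case_prod_unfold
  by (rule PT_foldl_additive[where q = "[:0,1:]"])
    ((intro PT_intros assms[THEN PT_comp])+, auto simp: encode_prod_def)

lemma PT_served [PT_intros]: assumes "PT rs" "PT q" shows "PT (\<lambda>x. served (rs x) (q x))"
  unfolding served_def case_prod_unfold by (intro PT_intros assms[THEN PT_comp])

lemma PT_path_edges [PT_intros]: assumes "PT q" "PT vs" shows "PT (\<lambda>x. path_edges (q x) (vs x))"
  unfolding path_edges_def case_prod_unfold
  apply (rule PT_snd, rule PT_foldl_additive[where q = "[:2,2:]"])
     apply (intro PT_intros assms[THEN PT_comp])+
  subgoal for x acc a
    using sz_append[of "snd acc" "[(fst acc, a)]"] by (cases acc) auto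
  done

section \<open>Termination of the auction and the size of its states\<close>

lemma PT_auction_step: "PT (auction_step :: 'j::encodable market \<Rightarrow> _)"
  unfolding auction_step_def case_prod_unfold by (intro PT_intros)

lemma min_sel_cases:
  obtains "min_sel cs = []" "cs = []"
  | a where "min_sel cs = [a]" "a \<in> set cs" "\<And>b. b \<in> set cs \<Longrightarrow> fst a \<le> fst b"
proof -
  have "min_sel cs = [] \<and> cs = [] \<or> (\<exists>a\<in>set cs. min_sel cs = [a] \<and> (\<forall>b\<in>set cs. fst a \<le> fst b))"
  proof (induction cs rule: rev_induct)
    case (snoc c cs)
    have "min_sel (cs @ [c]) = (case min_sel cs of [] \<Rightarrow> [c] | b # r \<Rightarrow> if fst c < fst b then [c] else min_sel cs)"
      unfolding min_sel_def by simp
    note step = this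
    from snoc show ?case
    proof
      assume "\<exists>a\<in>set cs. min_sel cs = [a] \<and> (\<forall>b\<in>set cs. fst a \<le> fst b)"
      then obtain a where "a \<in> set cs" "min_sel cs = [a]" "\<forall>b\<in>set cs. fst a \<le> fst b" by blast
      with step show ?thesis by (cases "fst c < fst a") (auto simp: not_less dest: order.trans less_imp_le)
    qed (use step in \<open>auto simp: min_sel_def\<close>)
  qed (simp add: min_sel_def)
  then show thesis using that by blast
qed

lemma sz_nat_le: "sz (n::nat) \<le> n + 1"
proof -
  have "int n < 2 ^ n" by (metis of_nat_less_two_power)
  then show ?thesis using vsize_Atom_le_iff[of "int n" n] by (simp add: encode_nat_def del: vsize.simps)
qed

lemma auction_step_cases [consumes 1]:
  assumes "m = (a # rest, sl, G)"
  obtains (give_up) "auction_step m = (rest, sl, a # G)"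
      "\<And>q i p own. (q, i, p, own) \<in> set sl \<Longrightarrow> q \<in> set (snd a) \<Longrightarrow> length sl < p"
  | (assign) q i p own where "(q, i, p, own) \<in> set sl" "q \<in> set (snd a)" "p \<le> length sl"
      "\<And>q' i' p' own'. (q', i', p', own') \<in> set sl \<Longrightarrow> q' \<in> set (snd a) \<Longrightarrow> p \<le> p'"
      "auction_step m = (case own of [] \<Rightarrow> rest | b # _ \<Rightarrow> b # rest,
         map (\<lambda>s. if fst s = q \<and> fst (snd s) = i \<and> fst (snd (snd s)) = p then (q, i, p + 1, [a]) else s) sl, G)"
proof -
  let ?cs = "map (\<lambda>s. (fst (snd (snd s)), s))
         (filter (\<lambda>(q, i, p, own). q \<in> set (snd a) \<and> p \<le> length sl) sl)"
  show thesis
  proof (cases rule: min_sel_cases[of ?cs])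
    case 1
    then have "auction_step m = (rest, sl, a # G)" using assms by (simp add: auction_step_def)
    moreover have "length sl < p" if "(q, i, p, own) \<in> set sl" "q \<in> set (snd a)" for q i p own
      using 1(2) that by (fastforce simp: filter_empty_conv)
    ultimately show thesis by (rule give_up)
  next
    case (2 c)
    then obtain q i p own where c: "c = (p, q, i, p, own)" "(q, i, p, own) \<in> set sl"
      "q \<in> set (snd a)" "p \<le> length sl" by auto
    have min: "p \<le> p'" if "(q', i', p', own') \<in> set sl" "q' \<in> set (snd a)" for q' i' p' own'
    proof (cases "p' \<le> length sl")
      case True
      then have "(p', q', i', p', own') \<in> set ?cs" using that by force
      from 2(3)[OF this] c show ?thesis by simp
    qed (use c in simp)
    show thesis
      by (rule assign[OF c(2-4) min]) (use assms c 2 in \<open>simp_all add: auction_step_def\<close>)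
  qed
qed

lemma sum_list_map_less:
  fixes f g :: "'a \<Rightarrow> nat"
  assumes "\<And>x. x \<in> set xs \<Longrightarrow> f x \<le> g x" "y \<in> set xs" "f y < g y"
  shows "(\<Sum>x\<leftarrow>xs. f x) < (\<Sum>x\<leftarrow>xs. g x)"
proof -
  obtain ys zs where xs: "xs = ys @ y # zs" using assms(2) split_list by metis
  have "(\<Sum>x\<leftarrow>ys. f x) \<le> (\<Sum>x\<leftarrow>ys. g x)" "(\<Sum>x\<leftarrow>zs. f x) \<le> (\<Sum>x\<leftarrow>zs. g x)"
    using assms(1) xs by (auto intro!: sum_list_mono)
  then show ?thesis using assms(3) xs by simp
qed

text \<open>An assignment raises a price that has not passed the cap, so the first summand drops
  while the pending list does not grow. Giving up shortens the pending list and leaves prices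
  alone.\<close>

definition auction_pot :: "'j market \<Rightarrow> nat" where
  "auction_pot m = (case m of (pend, sl, G) \<Rightarrow>
     (\<Sum>s\<leftarrow>sl. Suc (length sl) - fst (snd (snd s))) + length pend)"

lemma auction_pot_decreases:
  assumes "fst m \<noteq> []" shows "auction_pot (auction_step m) < auction_pot m"
proof -
  obtain a rest sl G where m: "m = (a # rest, sl, G)" using assms by (cases m) (auto simp: neq_Nil_conv)
  from m show ?thesis
  proof (cases rule: auction_step_cases)
    case give_up
    then show ?thesis using m by (simp add: auction_pot_def)
  next
    case (assign q i p own)
    let ?h = "\<lambda>s. if fst s = q \<and> fst (snd s) = i \<and> fst (snd (snd s)) = p then (q, i, p + 1, [a]) else s"
    have min: "p \<le> fst (snd (snd s))" if "s \<in> set sl" "fst s = q" for s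
      using assign(2,4) that by (metis prod.collapse)
    have "(\<Sum>s\<leftarrow>sl. Suc (length sl) - fst (snd (snd (?h s)))) < (\<Sum>s\<leftarrow>sl. Suc (length sl) - fst (snd (snd s)))"
    proof (rule sum_list_map_less)
      show "(q, i, p, own) \<in> set sl" by (rule assign)
    next
      fix s assume s: "s \<in> set sl"
      show "Suc (length sl) - fst (snd (snd (?h s))) \<le> Suc (length sl) - fst (snd (snd s))"
        by auto
    qed (use assign(3) in simp)
    moreover have "length (case own of [] \<Rightarrow> rest | b # _ \<Rightarrow> b # rest) \<le> length (a # rest)"
      by (cases own) auto
    ultimately show ?thesis using m assign(5) by (simp add: auction_pot_def comp_def del: length_Cons)
  qed
qed

lemma auction_pot_funpow:
  assumes "\<And>k. k < n \<Longrightarrow> fst ((auction_step ^^ k) m) \<noteq> []"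
  shows "auction_pot ((auction_step ^^ n) m) + n \<le> auction_pot m"
  using assms
proof (induction n)
  case (Suc n)
  have "auction_pot ((auction_step ^^ Suc n) m) < auction_pot ((auction_step ^^ n) m)"
    using auction_pot_decreases[of "(auction_step ^^ n) m"] Suc.prems[of n] by simp
  moreover have "auction_pot ((auction_step ^^ n) m) + n \<le> auction_pot m" using Suc by simp
  ultimately show ?case by linarith
qed simp

lemma auction_terminates: "\<exists>k\<le>auction_pot m. fst ((auction_step ^^ k) m) = []"
proof (rule ccontr)
  assume "\<not> ?thesis"
  then have "\<And>k. k < Suc (auction_pot m) \<Longrightarrow> fst ((auction_step ^^ k) m) \<noteq> []" by auto
  from auction_pot_funpow[of "Suc (auction_pot m)", OF this] show False by simp
qed

lemma auction_eq_funpow: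
  obtains n where "auction m = (auction_step ^^ n) m" "fst (auction m) = []" "n \<le> auction_pot m"
    "\<And>k. k < n \<Longrightarrow> fst ((auction_step ^^ k) m) \<noteq> []"
proof -
  let ?n = "LEAST k. fst ((auction_step ^^ k) m) = []"
  obtain k where k: "k \<le> auction_pot m" "fst ((auction_step ^^ k) m) = []"
    using auction_terminates by blast
  show thesis
  proof (rule that[of ?n])
    show "auction m = (auction_step ^^ ?n) m" by (simp add: auction_def)
    show "fst (auction m) = []" unfolding auction_def by (rule LeastI[of _ k]) (rule k)
    show "?n \<le> auction_pot m" using Least_le[of "\<lambda>k. fst ((auction_step ^^ k) m) = []" k] k by simp
    show "fst ((auction_step ^^ k) m) \<noteq> []" if "k < ?n" for k using not_less_Least[OF that] by blast
  qed
qed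

text \<open>Jobs are only moved around, so the size \<open>S\<close> of the start bounds each of
  them and their number for good. A price ends at most one above the cap, which explains
  \<open>S + 2\<close>.\<close>

definition auction_bounded :: "nat \<Rightarrow> 'j::encodable market \<Rightarrow> bool" where
  "auction_bounded S m \<longleftrightarrow> (case m of (pend, sl, G) \<Rightarrow>
     length pend + length G \<le> S \<and> length sl \<le> S \<and> (\<forall>a\<in>set pend \<union> set G. sz a \<le> S) \<and>
     (\<forall>(q, i, p, own)\<in>set sl. sz q \<le> S \<and> sz i \<le> S \<and> sz p \<le> S + 2 \<and> length own \<le> S \<and> (\<forall>a\<in>set own. sz a \<le> S)))"

lemma auction_bounded_init: "auction_bounded (sz m) m"
proof -
  obtain pend sl G where m: "m = (pend, sl, G)" by (cases m)
  have "length pend + length G \<le> sz m"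
    using m length_less_sz[of pend] length_less_sz[of G] by simp
  moreover have "length sl \<le> sz m" using m length_less_sz[of sl] by simp
  moreover have "sz a \<le> sz m" if "a \<in> set pend \<union> set G" for a
    using that sz_member[of a pend] sz_member[of a G] m by auto
  moreover have "sz q \<le> sz m \<and> sz i \<le> sz m \<and> sz p \<le> sz m + 2 \<and> length own \<le> sz m \<and> (\<forall>a\<in>set own. sz a \<le> sz m)"
    if s: "(q, i, p, own) \<in> set sl" for q i p own
  proof -
    have "sz (q, i, p, own) \<le> sz m" using sz_member[OF s] m by simp
    then show ?thesis using length_less_sz[of own] sz_member[of _ own] by fastforce
  qed
  ultimately show ?thesis unfolding auction_bounded_def m by fastforce
qed

lemma auction_bounded_step:
  assumes "auction_bounded S m" shows "auction_bounded S (auction_step m)"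
proof (cases "fst m")
  case Nil
  then show ?thesis using assms by (auto simp: auction_step_def split: prod.splits)
next
  case (Cons a rest)
  then obtain sl G where m: "m = (a # rest, sl, G)" by (cases m) auto
  from m show ?thesis
  proof (cases rule: auction_step_cases)
    case give_up
    then show ?thesis using assms m by (auto simp: auction_bounded_def)
  next
    case (assign q i p own)
    have "sz (Suc p) \<le> S + 2"
      using sz_nat_le[of "Suc p"] assign(3) assms m by (auto simp: auction_bounded_def)
    moreover have "0 < S" using assms m by (auto simp: auction_bounded_def)
    ultimately show ?thesis using assms m assign(1) unfolding assign(5)
      by (cases own) (fastforce simp: auction_bounded_def Ball_def)+
  qed
qed

lemma auction_bounded_sz:
  assumes "auction_bounded S m"
  shows "sz m \<le> poly [:9, 20, 9, 2:] S"
proof -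
  obtain pend sl G where m: "m = (pend, sl, G)" by (cases m)
  have p: "sz pend \<le> Suc (S * Suc S)" and g: "sz G \<le> Suc (S * Suc S)"
    by (rule sz_list_le; use assms m in \<open>auto simp: auction_bounded_def\<close>)+
  have "sz sl \<le> Suc (S * Suc (3 + (S + S + (S + 2) + Suc (S * Suc S))))"
  proof (rule sz_list_le)
    fix s assume s: "s \<in> set sl"
    obtain q i p own where q: "s = (q, i, p, own)" by (cases s)
    have 1: "sz q \<le> S" "sz i \<le> S" "sz p \<le> S + 2" "length own \<le> S" "\<forall>a\<in>set own. sz a \<le> S"
      using assms m s q by (auto simp: auction_bounded_def)
    have "sz own \<le> Suc (S * Suc S)" by (rule sz_list_le) (use 1 in auto)
    then show "sz s \<le> 3 + (S + S + (S + 2) + Suc (S * Suc S))" using 1 q by simp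
  qed (use assms m in \<open>auto simp: auction_bounded_def\<close>)
  then show ?thesis using p g m by (simp add: algebra_simps power2_eq_square)
qed

lemma PT_auction [PT_intros]:
  assumes "PT f" shows "PT (\<lambda>x. auction (f x :: 'j::encodable market))"
proof -
  have "PT (auction :: 'j market \<Rightarrow> _)"
  proof (rule PT_while[where b = "\<lambda>m. fst m \<noteq> []" and g = auction_step and i = "\<lambda>m. m"
        and qn = "[:0,2,1:]" and qs = "[:9,20,9,2:]"])
    have "PT (\<lambda>m :: 'j market. case fst m of [] \<Rightarrow> False | a # r \<Rightarrow> True)" by (intro PT_intros)
    moreover have "(\<lambda>m :: 'j market. case fst m of [] \<Rightarrow> False | a # r \<Rightarrow> True) = (\<lambda>m. fst m \<noteq> [])"
      by (auto split: list.splits)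
    ultimately show "PT (\<lambda>m :: 'j market. fst m \<noteq> [])" by simp
    fix m :: "'j market"
    obtain n where n: "auction m = (auction_step ^^ n) m" "fst (auction m) = []" "n \<le> auction_pot m"
      "\<And>k. k < n \<Longrightarrow> fst ((auction_step ^^ k) m) \<noteq> []" by (rule auction_eq_funpow) blast
    have "auction_pot m \<le> sz m * (sz m + 2)"
    proof -
      obtain pend sl G where m: "m = (pend, sl, G)" by (cases m)
      have "(\<Sum>s\<leftarrow>sl. Suc (length sl) - fst (snd (snd s))) \<le> (\<Sum>s\<leftarrow>sl. Suc (length sl))"
        by (intro sum_list_mono) simp
      also have "\<dots> = length sl * Suc (length sl)" by (simp add: sum_list_triv)
      also have "\<dots> \<le> sz m * (sz m + 1)"
        using length_less_sz[of sl] m by (intro mult_mono) auto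
      finally show ?thesis using length_less_sz[of pend] m by (simp add: auction_pot_def algebra_simps)
    qed
    moreover have "sz ((auction_step ^^ k) m) \<le> poly [:9,20,9,2:] (sz m)" for k
    proof (rule auction_bounded_sz)
      show "auction_bounded (sz m) ((auction_step ^^ k) m)"
        by (induction k) (simp_all add: auction_bounded_init auction_bounded_step)
    qed
    ultimately show "\<exists>N. N \<le> poly [:0, 2, 1:] (sz m) \<and> \<not> fst ((auction_step ^^ N) m) \<noteq> [] \<and>
        (\<forall>k<N. fst ((auction_step ^^ k) m) \<noteq> []) \<and>
        (\<forall>k\<le>N. sz ((auction_step ^^ k) m) \<le> poly [:9,20,9,2:] (sz m)) \<and> auction m = (auction_step ^^ N) m"
      using n by (intro exI[of _ n]) (auto simp: algebra_simps)
  qed (intro PT_intros PT_auction_step)+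
  from PT_comp[OF this assms] show ?thesis .
qed

lemma pow_step_funpow: "(pow_step ^^ k) (x, 1, []) = (x, 2 ^ k, rev (map (\<lambda>i. 2 ^ i) [0..<k]))"
  by (induction k) (auto simp: pow_step_def)

text \<open>The number of levels is at most the bit length of the largest position, hence linear in
  its encoding.\<close>

lemma PT_pows [PT_intros]: assumes "PT f" shows "PT (\<lambda>x. pows (f x))"
proof -
  have "PT pows"
  proof (rule PT_while[where b = "\<lambda>z. fst (snd z) < fst z" and g = pow_step and i = "\<lambda>x. (x, 1, [])"
        and qn = "[:0,1:]" and qs = "[:9,9,9:]"])
    show "PT pow_step" unfolding pow_step_def case_prod_unfold by (intro PT_intros)
    fix x :: int
    define n where "n = (LEAST k. x \<le> 2 ^ k)"
    have "x \<le> 2 ^ sz x"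
      using vsize_Atom_le_iff[of x "sz x"] by (simp add: encode_int_def del: vsize.simps)
    then have n: "x \<le> 2 ^ n" "n \<le> sz x" unfolding n_def by (rule LeastI, rule Least_le)
    have n': "2 ^ k < x" if "k < n" for k
      using not_less_Least[OF that[unfolded n_def]] by simp
    have p: "sz ((2::int) ^ k) \<le> k + 2" for k
      using vsize_Atom_le_iff[of "2 ^ k" "k + 1"] by (simp add: encode_int_def del: vsize.simps)
    have "sz ((pow_step ^^ k) (x, 1, [])) \<le> poly [:9,9,9:] (sz x)" if "k \<le> n" for k
    proof -
      have "sz (rev (map (\<lambda>i. (2::int) ^ i) [0..<k])) \<le> Suc (sz x * Suc (sz x + 2))"
      proof (rule sz_list_le)
        fix z :: int assume "z \<in> set (rev (map (\<lambda>i. 2 ^ i) [0..<k]))"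
        then obtain i where i: "z = 2 ^ i" "i < k" by auto
        then show "sz z \<le> sz x + 2" using p[of i] that n(2) by simp
      qed (use that n(2) in simp)
      then show ?thesis using p[of k] that n(2) by (simp add: pow_step_funpow algebra_simps)
    qed
    then show "\<exists>N. N \<le> poly [:0, 1:] (sz x) \<and> \<not> fst (snd ((pow_step ^^ N) (x, 1, []))) < fst ((pow_step ^^ N) (x, 1, [])) \<and>
        (\<forall>k<N. fst (snd ((pow_step ^^ k) (x, 1, []))) < fst ((pow_step ^^ k) (x, 1, []))) \<and>
        (\<forall>k\<le>N. sz ((pow_step ^^ k) (x, 1, [])) \<le> poly [:9,9,9:] (sz x)) \<and> pows x = (pow_step ^^ N) (x, 1, [])"
      using n n' by (intro exI[of _ n]) (auto simp: pow_step_funpow pows_def n_def[symmetric])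
  qed (intro PT_intros)+
  from PT_comp[OF this assms] show ?thesis .
qed

lemma PT_points [PT_intros]: assumes "PT xs" shows "PT (\<lambda>x. points (xs x :: 'b::encodable list))"
proof -
  obtain qx where qx: "\<And>x. sz (xs x) \<le> poly qx (sz x)" using PT_sz[OF assms] by blast
  show ?thesis unfolding points_def
  proof (rule PT_foldl[where q = "1 + qx * (qx + 2)"])
    fix x ys zs assume x: "xs x = ys @ zs"
    have "length (foldl (\<lambda>acc _. length acc # acc) [] ys) = length ys \<and>
       (\<forall>v\<in>set (foldl (\<lambda>acc _. length acc # acc) [] ys). v < length ys)"
      by (induction ys rule: rev_induct) auto
    then have "sz (foldl (\<lambda>acc _. length acc # acc) [] ys) \<le> Suc (poly qx (sz x) * Suc (poly qx (sz x) + 1))"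
      using length_less_sz[of "xs x"] qx[of x] x
      by (intro sz_list_le) (force intro: order_trans[OF sz_nat_le])+
    then show "sz (foldl (\<lambda>acc _. length acc # acc) [] ys) \<le> poly (1 + qx * (qx + 2)) (sz x)"
      by simp
  qed (intro PT_intros assms)+
qed

lemma sz_list_prefix: "xs = ys @ zs \<Longrightarrow> Suc (\<Sum>y\<leftarrow>ys. Suc (sz y)) \<le> sz (xs :: 'a::encodable list)"
  by (simp add: sz_list)

text \<open>This fold multiplies its accumulator, so the additive rule does not apply. The bit
  length of every entry is bounded by the total size of the prefix read, since sizes add under
  multiplication.\<close>

lemma PT_scale_entries [PT_intros]: assumes "PT xs" shows "PT (\<lambda>x. scale_entries (xs x))"
proof -
  obtain qx where qx: "\<And>x. sz (xs x) \<le> poly qx (sz x)" using PT_sz[OF assms] by blast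
  show ?thesis unfolding scale_entries_def
  proof (rule PT_foldl[where q = "qx * (qx + 2) + qx + 5"])
    fix x ys zs assume x: "xs x = ys @ zs"
    let ?g = "\<lambda>acc e. (map (\<lambda>z. z * snd e) (fst acc) @ [fst e * snd acc], snd acc * snd e)"
    let ?f = "foldl ?g ([], 1) ys"
    have one: "sz (1::int) = 2" by (simp add: encode_int_def bitlen_alt_def)
    have mul: "sz (a * b) \<le> sz a + sz b" for a b :: int
      using vsize_Atom_mult[of a b] by (simp add: encode_int_def del: vsize.simps)
    have "length (fst ?f) = length ys \<and> (\<forall>z\<in>set (fst ?f). sz z \<le> 2 + (\<Sum>y\<leftarrow>ys. Suc (sz y))) \<and>
       sz (snd ?f) \<le> 2 + (\<Sum>y\<leftarrow>ys. Suc (sz y))"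
    proof (induction ys rule: rev_induct)
      case (snoc e ys)
      let ?f = "foldl ?g ([], 1) ys"
      have e: "sz e = Suc (sz (fst e) + sz (snd e))" by (simp add: encode_prod_def)
      have 1: "sz (fst e * snd ?f) \<le> 2 + (\<Sum>y\<leftarrow>ys @ [e]. Suc (sz y))"
        using mul[of "fst e" "snd ?f"] snoc e by simp
      have 2: "sz (snd ?f * snd e) \<le> 2 + (\<Sum>y\<leftarrow>ys @ [e]. Suc (sz y))"
        using mul[of "snd ?f" "snd e"] snoc e by simp
      have 3: "sz (z * snd e) \<le> 2 + (\<Sum>y\<leftarrow>ys @ [e]. Suc (sz y))" if "z \<in> set (fst ?f)" for z
        using mul[of z "snd e"] snoc e that by fastforce
      from 1 2 3 snoc show ?case by auto
    qed (simp add: one)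
    moreover have "2 + (\<Sum>y\<leftarrow>ys. Suc (sz y)) \<le> poly qx (sz x) + 1"
      using sz_list_prefix[OF x] qx[of x] by simp
    moreover have "length ys \<le> poly qx (sz x)" using length_less_sz[of "xs x"] qx[of x] x by simp
    ultimately have 2: "sz (snd ?f) \<le> poly qx (sz x) + 1"
      and 1: "sz (fst ?f) \<le> Suc (poly qx (sz x) * Suc (poly qx (sz x) + 1))"
      by (linarith, intro sz_list_le) force+
    have "sz ?f = Suc (sz (fst ?f) + sz (snd ?f))" by (simp add: encode_prod_def)
    with 1 2 show "sz ?f \<le> poly (qx * (qx + 2) + qx + 5) (sz x)" by simp
  qed (intro PT_intros assms)+
qed

text \<open>A position is a prefix sum of step lengths, and each output entry repeats the current
  position and depot. Both are bounded by the size of the prefix read.\<close>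

lemma PT_annotate [PT_intros]: assumes "PT T" shows "PT (\<lambda>x. annotate (T x))"
proof -
  obtain qx where qx: "\<And>x. sz (T x) \<le> poly qx (sz x)" using PT_sz[OF assms] by blast
  show ?thesis unfolding annotate_def case_prod_unfold
  proof (intro PT_snd, rule PT_foldl[where q = "qx * (5 * qx + 10) + 2 * qx + 10"])
    fix x ys zs assume x: "T x = ys @ zs"
    let ?g = "\<lambda>acc e. if snd (snd e) = 0
          then (fst e, 0, snd (snd acc) @ [(fst e, fst (snd e), 0, 0, fst e)])
          else (fst acc, fst (snd acc) + snd (snd e),
                snd (snd acc) @ [(fst e, fst (snd e), snd (snd e), fst (snd acc) + snd (snd e), fst acc)])"
    let ?F = "\<lambda>ys. foldl ?g ((0::nat), (0::int), []) ys"
    let ?S = "\<lambda>ys :: step list. 1 + (\<Sum>y\<leftarrow>ys. Suc (sz y))"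
    have add: "sz (a + b) \<le> sz a + sz b" for a b :: int
      using vsize_Atom_add[of a b] by (simp add: encode_int_def del: vsize.simps)
    have z: "sz (0::int) = 1" "sz (0::nat) = 1" by (simp_all add: encode_int_def encode_nat_def bitlen_alt_def)
    have "length (snd (snd (?F ys))) = length ys \<and> sz (fst (?F ys)) \<le> ?S ys \<and> sz (fst (snd (?F ys))) \<le> ?S ys \<and>
        (\<forall>e\<in>set (snd (snd (?F ys))). sz e \<le> 4 + 5 * ?S ys)"
    proof (induction ys rule: rev_induct)
      case (snoc e ys)
      obtain r P out where F: "?F ys = (r, P, out)" by (cases "?F ys")
      obtain y c l where e: "e = (y, c, l)" by (cases e)
      have S: "?S (ys @ [e]) = ?S ys + (3 + sz y + sz c + sz l)" by (simp add: e)
      from snoc F have IH: "length out = length ys" "sz r \<le> ?S ys" "sz P \<le> ?S ys"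
        "\<forall>e\<in>set out. sz e \<le> 4 + 5 * ?S ys" by auto
      show ?case
      proof (cases "l = 0")
        case True
        have "?F (ys @ [e]) = (y, 0, out @ [(y, c, 0, 0, y)])" by (simp add: F e True)
        then show ?thesis using IH unfolding S by (fastforce simp: z)
      next
        case False
        have "?F (ys @ [e]) = (r, P + l, out @ [(y, c, l, P + l, r)])" by (simp add: F e False)
        then show ?thesis using IH add[of P l] unfolding S by fastforce
      qed
    qed (simp add: z)
    moreover have "?S ys \<le> poly qx (sz x)" using sz_list_prefix[OF x] qx[of x] by simp
    moreover have "length ys \<le> poly qx (sz x)" using length_less_sz[of "T x"] qx[of x] x by simp
    ultimately have 1: "sz (fst (?F ys)) \<le> poly qx (sz x)" "sz (fst (snd (?F ys))) \<le> poly qx (sz x)"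
      and 2: "sz (snd (snd (?F ys))) \<le> Suc (poly qx (sz x) * Suc (4 + 5 * poly qx (sz x)))"
      by (linarith, linarith, intro sz_list_le) force+
    have "sz (?F ys) = 2 + sz (fst (?F ys)) + sz (fst (snd (?F ys))) + sz (snd (snd (?F ys)))"
      by (simp add: encode_prod_def)
    with 1 2 show "sz (?F ys) \<le> poly (qx * (5 * qx + 10) + 2 * qx + 10) (sz x)"
      by (simp add: algebra_simps)
  qed (intro PT_intros assms)+
qed

lemma insert_after_append:
  assumes "u \<notin> fst ` set A" "fst e = u"
  shows "insert_after u new (A @ e # B) = A @ e # new @ B"
proof -
  let ?g = "\<lambda>acc e. if \<not> fst acc \<and> fst e = u
      then (True, snd acc @ (e # new)) else (fst acc, snd acc @ [e])"
  have "foldl ?g (True, out) B = (True, out @ B)" for out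
    by (induction B arbitrary: out) auto
  moreover have "foldl ?g (False, out) A = (False, out @ A)" for out
    using assms(1) by (induction A arbitrary: out) auto
  ultimately show ?thesis using assms(2) by (simp add: insert_after_def)
qed

lemma insert_after_cases:
  assumes "u \<in> fst ` set T"
  obtains A e B where "T = A @ e # B" "fst e = u" "insert_after u new T = A @ e # new @ B"
proof -
  have "\<exists>e\<in>set T. fst e = u" using assms by auto
  from split_list_first_prop[OF this] obtain A e B
    where "T = A @ e # B" "fst e = u" "\<forall>a\<in>set A. fst a \<noteq> u" by blast
  note T = this
  have "u \<notin> fst ` set A" using T(3) by auto
  from insert_after_append[OF this T(2)] T(1,2) show thesis by (intro that) simp_all
qed

lemma tour_step_cases:
  obtains (stop) "tour_step w vs T = T" "unvisited vs T = [] \<or> T = []"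
  | (grow) u v A e B where "T = A @ e # B" "fst e = u" "v \<in> set vs" "v \<notin> fst ` set T"
      "tour_step w vs T = A @ e # (v, v, w u v) # (u, v, w u v) # B"
      "\<And>x y. x \<in> fst ` set T \<Longrightarrow> y \<in> set vs \<Longrightarrow> y \<notin> fst ` set T \<Longrightarrow> w u v \<le> w x y"
proof (cases rule: min_sel_cases[of "candidates w vs T"])
  case 1
  have "unvisited vs T = [] \<or> T = []"
    using 1(2) by (cases T; cases "unvisited vs T") (simp_all add: candidates_def)
  then show thesis by (intro stop) (simp_all add: tour_step_def 1(1))
next
  case (2 a)
  obtain u v l where a: "a = (l, u, v)" by (cases a)
  have uv: "l = w u v" "u \<in> fst ` set T" "v \<in> set vs" "v \<notin> fst ` set T"
    using 2(2) a by (auto simp: candidates_def unvisited_def)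
  obtain A e B where T: "T = A @ e # B" "fst e = u"
    "insert_after u [(v, v, l), (u, v, l)] T = A @ e # [(v, v, l), (u, v, l)] @ B"
    using insert_after_cases[OF uv(2)] by blast
  have min: "w u v \<le> w x y" if "x \<in> fst ` set T" "y \<in> set vs" "y \<notin> fst ` set T" for x y
  proof -
    have "(w x y, x, y) \<in> set (candidates w vs T)"
      using that by (force simp: candidates_def unvisited_def)
    from 2(3)[OF this] a uv show ?thesis by simp
  qed
  show thesis
    by (rule grow[OF T(1,2) uv(3,4) _ min]) (use 2(1) a T uv in \<open>simp_all add: tour_step_def\<close>)
qed

lemma sz_nth_default: "sz (nth_default d xs k) \<le> sz d + sz (xs :: 'a::encodable list)"
  using sz_member[of "xs ! k" xs] by (auto simp: nth_default_def)

lemma PT_tour_step [PT_intros]: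
  assumes "PT E" "PT vs" "PT T" shows "PT (\<lambda>x. tour_step (wt (E x)) (vs x) (T x))"
  unfolding tour_step_def case_prod_unfold by (intro PT_intros assms[THEN PT_comp])

text \<open>Points are copied from the input and lengths are entries of the matrix, so no entry
  grows; only the length of the tour does, by two per round.\<close>

lemma PT_tour [PT_intros]:
  assumes "PT E" "PT vs" "PT ds" shows "PT (\<lambda>x. tour (wt (E x)) (vs x) (ds x))"
proof -
  obtain qe where qe: "\<And>x. sz (E x) \<le> poly qe (sz x)" using PT_sz[OF assms(1)] by blast
  obtain qv where qv: "\<And>x. sz (vs x) \<le> poly qv (sz x)" using PT_sz[OF assms(2)] by blast
  obtain qd where qd: "\<And>x. sz (ds x) \<le> poly qd (sz x)" using PT_sz[OF assms(3)] by blast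
  show ?thesis unfolding tour_def
  proof (rule PT_foldl[where q = "1 + (qd + 2 * qv) * (6 + 2 * qd + 2 * qv + qe)"])
    fix x ys zs assume x: "vs x = ys @ zs"
    let ?F = "\<lambda>ys. foldl (\<lambda>T _. tour_step (wt (E x)) (vs x) T) (map (\<lambda>r. (r, r, 0)) (ds x)) ys"
    have z: "sz (0::int) = 1" by (simp add: encode_int_def bitlen_alt_def)
    have w: "sz (wt (E x) u v) \<le> 1 + sz (E x)" for u v
      using sz_nth_default[of 0 "snd (E x)" "u * fst (E x) + v"] z
      by (cases "E x") (simp add: wt_def)
    have "length (?F ys) \<le> length (ds x) + 2 * length ys \<and>
      (\<forall>(y, c, l)\<in>set (?F ys). sz y \<le> sz (ds x) + sz (vs x) \<and> sz c \<le> sz (ds x) + sz (vs x) \<and> sz l \<le> 1 + sz (E x))"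
    proof (induction ys rule: rev_induct)
      case Nil
      then show ?case using sz_member[of _ "ds x"] by (auto simp: z intro: trans_le_add1)
    next
      case (snoc a ys)
      have step: "?F (ys @ [a]) = tour_step (wt (E x)) (vs x) (?F ys)" by simp
      show ?case
      proof (cases rule: tour_step_cases[of "wt (E x)" "vs x" "?F ys"])
        case stop
        then show ?thesis using snoc step by auto
      next
        case (grow u v A e B)
        have "sz u \<le> sz (ds x) + sz (vs x)" using snoc grow(1,2) by (cases e) auto
        moreover have "sz v \<le> sz (vs x)" using grow(3) by (rule sz_member)
        ultimately show ?thesis unfolding step grow(5) using snoc w[of u v] unfolding grow(1) by auto
      qed
    qed
    moreover have "length (ds x) \<le> poly qd (sz x)" "length ys \<le> poly qv (sz x)"
      using length_less_sz[of "ds x"] qd[of x] length_less_sz[of "vs x"] qv[of x] x by simp_all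
    ultimately have "sz (?F ys) \<le> Suc ((poly qd (sz x) + 2 * poly qv (sz x)) *
        Suc (3 + 2 * (poly qd (sz x) + poly qv (sz x)) + poly qe (sz x)))"
      using qd[of x] qv[of x] qe[of x] by (intro sz_list_le) fastforce+
    then show "sz (?F ys) \<le> poly (1 + (qd + 2 * qv) * (6 + 2 * qd + 2 * qv + qe)) (sz x)"
      by (simp add: algebra_simps)
  qed (intro PT_intros assms[THEN PT_comp])+
qed

section \<open>Sizes of the records over all levels\<close>

lemma PT_level_step [PT_intros]:
  assumes "PT E" "PT ds" "PT st" "PT S" "PT L"
  shows "PT (\<lambda>x. level_step (wt (E x)) (ds x) (st x) (S x) (L x))"
  unfolding level_step_def by (intro PT_intros assms[THEN PT_comp])

text \<open>The left end \<open>a\<close> is the only component that is accumulated, by at most one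
  level length per round. All others are copies of input data, hence the separate bounds
  \<open>B\<close> and \<open>C\<close>.\<close>

definition rec_bounded :: "nat \<Rightarrow> nat \<Rightarrow> rec \<Rightarrow> bool" where
  "rec_bounded B C = (\<lambda>(v, P, r, a, L, q, act). sz v \<le> B \<and> sz P \<le> B \<and> sz r \<le> B \<and> sz q \<le> B \<and> sz L \<le> B \<and> sz a \<le> C)"

lemma rec_bounded_sz: "rec_bounded B C x \<Longrightarrow> sz x \<le> 5 * B + C + 8"
  by (cases x) (auto simp: rec_bounded_def encode_bool_def bitlen_alt_def)

lemma server_cases: "server sl j r = r \<and> (\<forall>(q, i, p, own)\<in>set sl. \<forall>jb\<in>set own. fst jb \<noteq> j) \<or>
   (\<exists>(q, i, p, own)\<in>set sl. \<exists>jb\<in>set own. fst jb = j \<and> server sl j r = q)"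
proof (induction sl rule: rev_induct)
  case (snoc s sl)
  obtain q i p own where s: "s = (q, i, p, own)" by (cases s)
  have "server (sl @ [s]) j r = (if list_ex (\<lambda>jb. fst jb = j) own then q else server sl j r)"
    by (simp add: server_def s)
  with snoc s show ?case by (auto simp: list_ex_iff)
qed (simp add: server_def)

lemma auction_step_slots:
  assumes "\<forall>s\<in>set (fst (snd m)). fst s \<in> Q"
  shows "\<forall>s\<in>set (fst (snd (auction_step m))). fst s \<in> Q"
proof (cases "fst m")
  case Nil
  then show ?thesis using assms by (auto simp: auction_step_def split: prod.splits)
next
  case (Cons a rest)
  then obtain sl G where m: "m = (a # rest, sl, G)" by (cases m) auto
  then show ?thesis by (cases rule: auction_step_cases) (use assms m in auto)
qed

lemma auction_slots:
  assumes "\<forall>s\<in>set (fst (snd m)). fst s \<in> Q"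
  shows "\<forall>s\<in>set (fst (snd (auction m))). fst s \<in> Q"
proof -
  have "\<forall>s\<in>set (fst (snd ((auction_step ^^ k) m))). fst s \<in> Q" for k
    by (induction k) (simp_all add: assms auction_step_slots)
  then show ?thesis by (simp add: auction_def)
qed

lemma level_step_bounded:
  assumes "\<forall>x\<in>set (fst S). rec_bounded B C x" "sz L \<le> B" "\<forall>q\<in>set ds. sz q \<le> B"
  shows "\<forall>x\<in>set (fst (level_step w ds st S L)). rec_bounded B (C + B) x"
proof -
  define rs where "rs = refine L (fst S)"
  define avail where "avail = filter (\<lambda>q. q \<notin> set (snd S)) ds"
  define m where "m = auction (map (\<lambda>j. (j, nbs w st L avail j)) (jobs st L rs), slots avail, [])"
  define vio where "vio = dense (fst (snd m)) (snd (snd m))"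
  have add: "sz (a + L) \<le> sz a + sz L" for a
    using vsize_Atom_add[of a L] by (simp add: encode_int_def del: vsize.simps)
  have 1: "rec_bounded B (C + B) x" if "x \<in> set rs" for x
  proof -
    obtain y where y: "y \<in> set (fst S)" "x = (case y of (v, P, r, a, L0, q, act) \<Rightarrow> if act
       then (v, P, r, if a + L < P then a + L else a, L, q, act) else (v, P, r, a, L0, q, act))"
      using \<open>x \<in> set rs\<close> unfolding rs_def refine_def set_map by blast
    obtain v P r a L0 q act where e: "y = (v, P, r, a, L0, q, act)" by (cases y)
    have "rec_bounded B C (v, P, r, a, L0, q, act)" using y(1) e assms(1) by blast
    then show ?thesis using assms(2) add[of a] unfolding y(2) e by (simp add: rec_bounded_def)
  qed
  have sl: "\<forall>s\<in>set (fst (snd m)). fst s \<in> set ds"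
    unfolding m_def by (rule auction_slots) (auto simp: slots_def avail_def)
  have srv: "sz (server (fst (snd m)) j r) \<le> B" if "sz r \<le> B" for j r
    using server_cases[of "fst (snd m)" j r] that assms(3) sl by fastforce
  have "rec_bounded B (C + B) x" if "x \<in> set (reassign st L (fst (snd m)) (map fst vio) rs)" for x
  proof -
    obtain y where y: "y \<in> set rs" "x = (case y of (v, P, r, a, L0, q, act) \<Rightarrow>
       if \<not> act then (v, P, r, a, L0, q, act)
       else if \<not> full st L r a then (v, P, r, a, L0, r, True)
       else if (r, a) \<in> fst ` set vio then (v, P, r, a, L0, q, False)
       else (v, P, r, a, L0, server (fst (snd m)) (r, a) r, True))"
      using \<open>x \<in> set (reassign st L (fst (snd m)) (map fst vio) rs)\<close>
      unfolding reassign_def set_map by blast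
    obtain v P r a L0 q act where e: "y = (v, P, r, a, L0, q, act)" by (cases y)
    have "rec_bounded B (C + B) (v, P, r, a, L0, q, act)" using y(1) e 1 by blast
    then show ?thesis using srv[of r "(r, a)"] unfolding y(2) e by (simp add: rec_bounded_def)
  qed
  then show ?thesis
    by (simp add: level_step_def Let_def rs_def avail_def m_def vio_def)
qed

lemma level_step_length:
  "length (fst (level_step w ds st S L)) = length (fst S)"
  "length (snd (level_step w ds st S L)) \<le> length (snd S) + length ds"
  "set (snd (level_step w ds st S L)) \<subseteq> set (snd S) \<union> set ds"
  by (auto simp: level_step_def Let_def reassign_def refine_def
      intro!: order_trans[OF length_filter_le])

lemma PT_final_recs [PT_intros]:
  assumes "PT E" "PT ds" "PT st"
  shows "PT (\<lambda>x. final_recs (wt (E x)) (ds x) (st x))"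
proof -
  let ?Ls = "\<lambda>x. snd (snd (pows (max_pos (st x))))"
  let ?i = "\<lambda>x. init_recs (st x) (fst (snd (pows (max_pos (st x)))))"
  have Ls: "PT ?Ls" and i: "PT ?i" by (intro PT_intros assms)+
  obtain ql where ql: "\<And>x. sz (?Ls x) \<le> poly ql (sz x)" using PT_sz[OF Ls] by blast
  obtain qi where qi: "\<And>x. sz (?i x) \<le> poly qi (sz x)" using PT_sz[OF i] by blast
  obtain qd where qd: "\<And>x. sz (ds x) \<le> poly qd (sz x)" using PT_sz[OF assms(2)] by blast
  define QB where "QB = ql + qi + qd"
  define QC where "QC = QB + ql * QB"
  have "PT (\<lambda>x. foldl (level_step (wt (E x)) (ds x) (st x)) (?i x, []) (?Ls x))"
  proof (rule PT_foldl[where q = "3 + qi * (9 + (5 * QB + QC)) + (ql * qd + ql * qd * qd)"])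
    fix x ys zs assume x: "?Ls x = ys @ zs"
    let ?F = "\<lambda>ys. foldl (level_step (wt (E x)) (ds x) (st x)) (?i x, []) ys"
    define B where "B = poly QB (sz x)"
    have B: "sz e \<le> B" if "e \<in> set (ys @ zs)" for e
      using sz_member[of e "?Ls x"] that x ql[of x] by (simp add: B_def QB_def)
    have ds: "\<forall>q\<in>set (ds x). sz q \<le> B"
      using sz_member[of _ "ds x"] qd[of x] by (fastforce simp: B_def QB_def)
    have "(\<forall>e\<in>set (fst (?F ys)). rec_bounded B (B + length ys * B) e) \<and>
      length (fst (?F ys)) = length (?i x) \<and> length (snd (?F ys)) \<le> length ys * length (ds x) \<and>
      set (snd (?F ys)) \<subseteq> set (ds x)"
      using B
    proof (induction ys rule: rev_induct)
      case Nil
      have "rec_bounded B B e" if "e \<in> set (?i x)" for e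
      proof -
        have "sz e \<le> B" using sz_member[OF that] qi[of x] by (simp add: B_def QB_def)
        then show ?thesis by (cases e) (auto simp: rec_bounded_def)
      qed
      then show ?case by simp
    next
      case (snoc L ys)
      have "rec_bounded B (B + length (ys @ [L]) * B) e" if "e \<in> set (fst (?F (ys @ [L])))" for e
        using level_step_bounded[of "?F ys" B "B + length ys * B" L "ds x" "wt (E x)" "st x"] snoc ds that
        by (simp add: algebra_simps)
      then show ?case
        using level_step_length[of "wt (E x)" "ds x" "st x" "?F ys" L] snoc by auto
    qed
    note F = this
    have lys: "length ys \<le> poly ql (sz x)" using length_less_sz[of "?Ls x"] ql[of x] x by simp
    have lds: "length (ds x) \<le> poly qd (sz x)" using length_less_sz[of "ds x"] qd[of x] by simp
    have C: "B + length ys * B \<le> poly QC (sz x)"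
      using mult_right_mono[OF lys, of B] by (simp add: QC_def B_def)
    have 1: "sz (fst (?F ys)) \<le> Suc (poly qi (sz x) * Suc (5 * B + poly QC (sz x) + 8))"
    proof (rule sz_list_le)
      fix e assume "e \<in> set (fst (?F ys))"
      then have "rec_bounded B (B + length ys * B) e" using F by blast
      from rec_bounded_sz[OF this] C show "sz e \<le> 5 * B + poly QC (sz x) + 8" by linarith
    next
      show "length (fst (?F ys)) \<le> poly qi (sz x)"
        using F length_less_sz[of "?i x"] qi[of x] by simp
    qed
    have 2: "sz (snd (?F ys)) \<le> Suc (poly ql (sz x) * poly qd (sz x) * Suc (poly qd (sz x)))"
    proof (rule sz_list_le)
      fix e assume "e \<in> set (snd (?F ys))"
      then show "sz e \<le> poly qd (sz x)" using F sz_member[of e "ds x"] qd[of x] by fastforce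
    next
      have "length ys * length (ds x) \<le> poly ql (sz x) * poly qd (sz x)"
        using lys lds by (intro mult_mono) auto
      then show "length (snd (?F ys)) \<le> poly ql (sz x) * poly qd (sz x)" using F by linarith
    qed
    have "sz (?F ys) = Suc (sz (fst (?F ys)) + sz (snd (?F ys)))" by (simp add: encode_prod_def)
    moreover have "poly (3 + qi * (9 + (5 * QB + QC)) + (ql * qd + ql * qd * qd)) (sz x) =
        3 + poly qi (sz x) * (9 + (5 * B + poly QC (sz x))) + (poly ql (sz x) * poly qd (sz x) + poly ql (sz x) * poly qd (sz x) * poly qd (sz x))"
      by (simp add: B_def)
    ultimately show "sz (?F ys) \<le> poly (3 + qi * (9 + (5 * QB + QC)) + (ql * qd + ql * qd * qd)) (sz x)"
      using 1 2 by (simp add: B_def)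
  qed (intro PT_intros Ls i assms[THEN PT_comp])+
  then show ?thesis unfolding final_recs_def Let_def by (rule PT_fst)
qed

lemma PT_solve: "PT solve"
  unfolding solve_def by (intro PT_intros)

section \<open>The greedy tours\<close>

definition reach :: "nat set set \<Rightarrow> nat set \<Rightarrow> nat set" where
  "reach E S = {x. \<exists>y\<in>S. (x, y) \<in> {(a, b). {a, b} \<in> E}\<^sup>*}"

lemma reach_base: "x \<in> S \<Longrightarrow> x \<in> reach E S"
  by (auto simp: reach_def)

lemma reach_step: "{x, y} \<in> E \<Longrightarrow> y \<in> reach E S \<Longrightarrow> x \<in> reach E S"
  unfolding reach_def by (auto intro: converse_rtrancl_into_rtrancl)

lemma reach_mono: "S \<subseteq> S' \<Longrightarrow> reach E S \<subseteq> reach E S'"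
  by (auto simp: reach_def)

text \<open>The first edge on the way from \<open>v\<close> into \<open>S\<close> becomes superfluous once \<open>v\<close> joins \<open>S\<close>.\<close>

lemma reach_exchange:
  assumes v: "v \<in> reach E S" "v \<notin> S"
  obtains x y where "{x, y} \<in> E" "x \<notin> S" "y \<in> S" "reach E S \<subseteq> reach (E - {{x, y}}) (insert v S)"
proof -
  define X where "X = {x. (v, x) \<in> {(a, b). {a, b} \<in> E \<and> a \<notin> S \<and> b \<notin> S}\<^sup>*}"
  have XS: "x \<notin> S" if "x \<in> X" for x
    using that v(2) unfolding X_def by (auto elim: rtranclE)
  obtain s where s: "s \<in> S" "(v, s) \<in> {(a, b). {a, b} \<in> E}\<^sup>*" using v by (auto simp: reach_def)
  have "z \<in> X \<or> (\<exists>x\<in>X. \<exists>y\<in>S. {x, y} \<in> E)" if "(v, z) \<in> {(a, b). {a, b} \<in> E}\<^sup>*" for z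
    using that
  proof (induction rule: rtrancl_induct)
    case (step a b)
    show ?case
    proof (cases "a \<in> X \<and> b \<notin> S")
      case True
      then have "b \<in> X" using step(2) XS[of a] unfolding X_def
        by (auto intro: rtrancl_into_rtrancl)
      then show ?thesis by blast
    qed (use step in blast)
  qed (simp add: X_def)
  from this[OF s(2)] s(1) XS obtain x y where xy: "x \<in> X" "y \<in> S" "{x, y} \<in> E" by blast
  let ?E = "E - {{x, y}}"
  \<comment> \<open>The paths that define \<open>X\<close> stay outside \<open>S\<close>, so none of
    their edges is the removed edge, whose end \<open>y\<close> lies in \<open>S\<close>.\<close>
  have xv: "a \<in> reach ?E (insert v S)" if "(v, a) \<in> {(a, b). {a, b} \<in> E \<and> a \<notin> S \<and> b \<notin> S}\<^sup>*" for a
    using that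
  proof (induction rule: rtrancl_induct)
    case base
    show ?case by (simp add: reach_base)
  next
    case (step a b)
    have "{b, a} \<in> ?E" using step(2) xy(2) by (auto simp: insert_commute doubleton_eq_iff)
    from reach_step[OF this step(3)] show ?case .
  qed
  \<comment> \<open>A path into \<open>S\<close> is interrupted only where it uses
    \<open>{x, y}\<close>; there \<open>y\<close> is in \<open>S\<close>, and \<open>x\<close> is
    still attached to \<open>v\<close>.\<close>
  have "z \<in> reach ?E (insert v S)" if "(z, t) \<in> {(a, b). {a, b} \<in> E}\<^sup>*" "t \<in> S" for z t
    using that
  proof (induction rule: converse_rtrancl_induct)
    case base
    then show ?case by (simp add: reach_base)
  next
    case (step a b)
    show ?case
    proof (cases "{a, b} = {x, y}")
      case True
      then have "a = x \<or> a = y" by (auto simp: doubleton_eq_iff)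
      then show ?thesis using xy(2) xv[of x] xy(1) unfolding X_def by (auto intro: reach_base)
    qed (use step in \<open>auto intro: reach_step\<close>)
  qed
  then have "reach E S \<subseteq> reach ?E (insert v S)" by (auto simp: reach_def)
  with xy XS that show thesis by blast
qed

text \<open>The walker stands at \<open>x\<close> in the tour of \<open>r\<close>, with the depots
  \<open>R\<close> still ahead. Length 0 marks the start of the next tour, which is unambiguous
  because distinct points have positive distance. Demanding \<open>x = r\<close> at such a start and
  at the end makes every tour closed.\<close>

fun walk :: "(nat \<Rightarrow> nat \<Rightarrow> int) \<Rightarrow> nat list \<Rightarrow> nat \<Rightarrow> nat \<Rightarrow> step list \<Rightarrow> bool" where
  "walk w R r x [] \<longleftrightarrow> x = r \<and> R = []"
| "walk w R r x ((y, c, l) # es) \<longleftrightarrow> (if l = 0 then x = r \<and> R \<noteq> [] \<and> y = hd R \<and> walk w (tl R) y y es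
     else 0 < l \<and> l = w x y \<and> walk w R r y es)"

text \<open>\<open>annotate\<close> as a recursion on the remaining steps, with the current depot
  and position as arguments; inductions run parallel to \<open>walk\<close>.\<close>

fun ann :: "nat \<Rightarrow> int \<Rightarrow> step list \<Rightarrow> pstep list" where
  "ann r P [] = []"
| "ann r P ((y, c, l) # es) = (if l = 0 then (y, c, 0, 0, y) # ann y 0 es
     else (y, c, l, P + l, r) # ann r (P + l) es)"

lemma annotate_eq_ann: "annotate T = ann 0 0 T"
proof -
  let ?g = "\<lambda>(r, P, out) (y, c, l). if l = 0 then (y, 0, out @ [(y, c, 0, 0, y)])
      else (r, P + l, out @ [(y, c, l, P + l, r)])"
  have "snd (snd (foldl ?g (r, P, out) T)) = out @ ann r P T" for r P out
    by (induction r P T arbitrary: out rule: ann.induct) auto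
  from this[of 0 0 "[]"] show ?thesis by (simp add: annotate_def)
qed

lemma ann_steps: "map (\<lambda>(y, c, l, P, r). (y, c, l)) (ann r P es) = es"
  by (induction r P es rule: ann.induct) auto

lemma ann_steps_mem: "(y, c, l, P', r') \<in> set (ann r P es) \<Longrightarrow> (y, c, l) \<in> set es"
  using arg_cong[OF ann_steps[of r P es], of set] by force

lemma ann_roots:
  assumes "walk w R r x es" "(y, c, l, P', r') \<in> set (ann r P es)"
  shows "r' \<in> set (r # R)"
  using assms
proof (induction es arbitrary: R r x P)
  case (Cons e es)
  obtain z d k where e: "e = (z, d, k)" by (cases e)
  show ?case
  proof (cases "k = 0")
    case True
    then obtain R1 where "R = z # R1" using Cons.prems e by (cases R) auto
    then show ?thesis using Cons.prems Cons.IH[of R1 z z 0] e True by auto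
  next
    case False
    then show ?thesis using Cons.prems Cons.IH[of R r z "P + k"] e by auto
  qed
qed simp

text \<open>Depots occur in increasing order, each once, so the entries of \<open>r'\<close> come
  from the single stretch that starts when \<open>r'\<close> is opened. Whatever follows in
  \<open>es'\<close> belongs to later depots and does not interfere.\<close>

lemma ann_segment:
  assumes "walk w R r x es" "sorted_wrt (<) (r # R)" "r' \<in> set R"
  shows "\<exists>R' es' c. walk w R' r' r' es' \<and> sorted_wrt (<) (r' # R') \<and> set es' \<subseteq> set es \<and>
    (\<forall>y d l P'. (y, d, l, P', r') \<in> set (ann r P es) \<longleftrightarrow>
       (y, d, l, P', r') = (r', c, 0, 0, r') \<or> (y, d, l, P', r') \<in> set (ann r' 0 es'))"
  using assms
proof (induction es arbitrary: R r x P)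
  case (Cons e es)
  obtain z d k where e: "e = (z, d, k)" by (cases e)
  show ?case
  proof (cases "k = 0")
    case True
    then obtain R1 where R: "R = z # R1" "walk w R1 z z es" using Cons.prems e by (cases R) auto
    show ?thesis
    proof (cases "r' = z")
      case True
      then show ?thesis using R Cons.prems e \<open>k = 0\<close>
        by (intro exI[of _ R1] exI[of _ es] exI[of _ d]) auto
    next
      case False
      then have "r' \<in> set R1" using Cons.prems R by auto
      from Cons.IH[OF R(2) _ this, of 0] Cons.prems(2) R(1) obtain R' es' c where
        "walk w R' r' r' es'" "sorted_wrt (<) (r' # R')" "set es' \<subseteq> set es"
        "\<forall>y d l P'. (y, d, l, P', r') \<in> set (ann z 0 es) \<longleftrightarrow>
         (y, d, l, P', r') = (r', c, 0, 0, r') \<or> (y, d, l, P', r') \<in> set (ann r' 0 es')" by auto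
      then show ?thesis using e \<open>k = 0\<close> False
        by (intro exI[of _ R'] exI[of _ es'] exI[of _ c]) auto
    qed
  next
    case False
    then have W: "walk w R r z es" using Cons.prems e by auto
    from Cons.IH[OF W Cons.prems(2,3), of "P + k"] obtain R' es' c where
        "walk w R' r' r' es'" "sorted_wrt (<) (r' # R')" "set es' \<subseteq> set es"
        "\<forall>y d l P'. (y, d, l, P', r') \<in> set (ann r (P + k) es) \<longleftrightarrow>
         (y, d, l, P', r') = (r', c, 0, 0, r') \<or> (y, d, l, P', r') \<in> set (ann r' 0 es')" by auto
    moreover have "r' \<noteq> r" using Cons.prems by auto
    ultimately show ?thesis using e False
      by (intro exI[of _ R'] exI[of _ es'] exI[of _ c]) auto
  qed
qed simp

text \<open>Consecutive steps of a tour occupy adjacent stretches of positions, so the first step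
  that ends beyond \<open>t\<close> contains \<open>t\<close>.\<close>

lemma ann_cell:
  assumes "walk w R r x es" "sorted_wrt (<) (r # R)"
    "(y, c, l, P', r) \<in> set (ann r P es)" "P \<le> t" "t < P'"
  shows "\<exists>y c l P'. (y, c, l, P', r) \<in> set (ann r P es) \<and> P' - l \<le> t \<and> t < P'"
  using assms
proof (induction es arbitrary: R x P)
  case (Cons e es)
  obtain z d k where e: "e = (z, d, k)" by (cases e)
  show ?case
  proof (cases "k = 0")
    case True
    then obtain R1 where R: "R = z # R1" "walk w R1 z z es" using Cons.prems e by (cases R) auto
    then have "r \<notin> set (z # R1)" using Cons.prems(2) by auto
    then have "(y, c, l, P', r) \<notin> set (ann r P (e # es))"
      using ann_roots[OF R(2), of y c l P' r 0] e True by auto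
    then show ?thesis using Cons.prems by simp
  next
    case False
    show ?thesis
    proof (cases "t < P + k")
      case True
      then show ?thesis using Cons.prems e False
        by (intro exI[of _ z] exI[of _ d] exI[of _ k] exI[of _ "P + k"]) auto
    next
      case le: False
      have "\<exists>y c l P'. (y, c, l, P', r) \<in> set (ann r (P + k) es) \<and> P' - l \<le> t \<and> t < P'"
        using Cons.prems e False le by (intro Cons.IH[of R z]) auto
      then show ?thesis using e False by auto
    qed
  qed
qed simp

section \<open>Distances along the annotated tours\<close>

locale int_metric =
  fixes V D :: "nat set" and w :: "nat \<Rightarrow> nat \<Rightarrow> int"
  assumes finV: "finite V" and DV: "D \<subseteq> V" and D_nonempty: "D \<noteq> {}"
    and sym: "\<And>x y. x \<in> V \<Longrightarrow> y \<in> V \<Longrightarrow> w x y = w y x"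
    and w_refl: "\<And>x. x \<in> V \<Longrightarrow> w x x = 0"
    and pos: "\<And>x y. x \<in> V \<Longrightarrow> y \<in> V \<Longrightarrow> x \<noteq> y \<Longrightarrow> 0 < w x y"
    and tri: "\<And>x y z. x \<in> V \<Longrightarrow> y \<in> V \<Longrightarrow> z \<in> V \<Longrightarrow> w x z \<le> w x y + w y z"

begin

lemma ann_dist:
  assumes "walk w R r x es" "sorted_wrt (<) (r # R)" "x \<in> V" "fst ` set es \<subseteq> V"
    "(y, c, l, P', r) \<in> set (ann r P es)"
  shows "P \<le> P' \<and> w x y \<le> P' - P"
  using assms
proof (induction es arbitrary: R x P)
  case (Cons e es)
  obtain z d k where e: "e = (z, d, k)" by (cases e)
  show ?case
  proof (cases "k = 0")
    case True
    then obtain R1 where R: "R = z # R1" "walk w R1 z z es" using Cons.prems e by (cases R) auto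
    then have "r \<notin> set (z # R1)" using Cons.prems(2) by auto
    then show ?thesis using Cons.prems ann_roots[OF R(2), of y c l P' r 0] e True by auto
  next
    case False
    show ?thesis
    proof (cases "(y, c, l, P', r) \<in> set (ann r (P + k) es)")
      case True
      have "P + k \<le> P' \<and> w z y \<le> P' - (P + k)"
        using Cons.prems False True e by (intro Cons.IH) auto
      moreover have "w x y \<le> w x z + w z y"
        using Cons.prems e ann_steps_mem[OF True] by (intro tri) force+
      ultimately show ?thesis using Cons.prems False e by auto
    qed (use Cons.prems False e in auto)
  qed
qed simp

text \<open>\<open>M\<close> is the final position in the tour of \<open>r\<close>. The tour ends at
  \<open>r\<close>, so the remaining steps bound the distance of every entry from
  \<open>r\<close>.\<close>

lemma ann_return:
  assumes "walk w R r x es" "sorted_wrt (<) (r # R)" "x \<in> V" "fst ` set es \<subseteq> V" "r \<in> V"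
  shows "\<exists>M\<ge>P. w x r \<le> M - P \<and> (M = P \<or> (\<exists>y c l. (y, c, l, M, r) \<in> set (ann r P es))) \<and>
    (\<forall>y c l P'. (y, c, l, P', r) \<in> set (ann r P es) \<longrightarrow> P' \<le> M \<and> w y r \<le> M - P')"
  using assms
proof (induction es arbitrary: R x P)
  case Nil
  then show ?case using w_refl by auto
next
  case (Cons e es)
  obtain z d k where e: "e = (z, d, k)" by (cases e)
  show ?case
  proof (cases "k = 0")
    case True
    then obtain R1 where R: "R = z # R1" "walk w R1 z z es" using Cons.prems e by (cases R) auto
    then have "r \<notin> set (z # R1)" using Cons.prems(2) by auto
    then have "(y, c, l, P', r) \<notin> set (ann r P (e # es))" for y c l P'
      using ann_roots[OF R(2), of y c l P' r 0] e True by auto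
    then show ?thesis using Cons.prems e True w_refl by auto
  next
    case False
    have z: "z \<in> V" using Cons.prems e by auto
    have "\<exists>M\<ge>P + k. w z r \<le> M - (P + k) \<and> (M = P + k \<or> (\<exists>y c l. (y, c, l, M, r) \<in> set (ann r (P + k) es))) \<and>
      (\<forall>y c l P'. (y, c, l, P', r) \<in> set (ann r (P + k) es) \<longrightarrow> P' \<le> M \<and> w y r \<le> M - P')"
      using Cons.prems e False by (intro Cons.IH) auto
    then obtain M where M: "P + k \<le> M" "w z r \<le> M - (P + k)"
      "M = P + k \<or> (\<exists>y c l. (y, c, l, M, r) \<in> set (ann r (P + k) es))"
      "\<And>y c l P'. (y, c, l, P', r) \<in> set (ann r (P + k) es) \<Longrightarrow> P' \<le> M \<and> w y r \<le> M - P'" by blast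
    have "w x r \<le> M - P" using tri[of x z r] M(2) Cons.prems e False z by auto
    moreover have "P \<le> M" using M(1) Cons.prems e False by auto
    moreover have A: "set (ann r P (e # es)) = insert (z, d, k, P + k, r) (set (ann r (P + k) es))"
      using e False by simp
    moreover have "\<exists>y c l. (y, c, l, M, r) \<in> set (ann r P (e # es))" using M(3) unfolding A by blast
    moreover have "P' \<le> M \<and> w y r \<le> M - P'" if "(y, c, l, P', r) \<in> set (ann r P (e # es))" for y c l P'
      using that M unfolding A by auto
    ultimately show ?thesis by blast
  qed
qed

lemma ann_sorted:
  assumes "walk w R r x es" "sorted_wrt (<) (r # R)" "x \<in> V" "fst ` set es \<subseteq> V" "set R \<subseteq> V"
  shows "sorted_wrt (\<lambda>(y1, c1, l1, P1, r1) (y2, c2, l2, P2, r2). r1 < r2 \<or> r1 = r2 \<and> P1 \<le> P2) (ann r P es)"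
  using assms
proof (induction es arbitrary: R r x P)
  case (Cons e es)
  obtain z d k where e: "e = (z, d, k)" by (cases e)
  show ?case
  proof (cases "k = 0")
    case True
    then obtain R1 where R: "R = z # R1" "walk w R1 z z es" using Cons.prems e by (cases R) auto
    have "z < r2 \<or> z = r2 \<and> 0 \<le> P2" if "(y2, c2, l2, P2, r2) \<in> set (ann z 0 es)" for y2 c2 l2 P2 r2
      using ann_roots[OF R(2) that] ann_dist[OF R(2), of y2 c2 l2 P2 0] that Cons.prems R(1) e by auto
    then have "\<forall>e2\<in>set (ann z 0 es). case e2 of (y2, c2, l2, P2, r2) \<Rightarrow> z < r2 \<or> z = r2 \<and> 0 \<le> P2" by blast
    moreover have "sorted_wrt (\<lambda>(y1, c1, l1, P1, r1) (y2, c2, l2, P2, r2). r1 < r2 \<or> r1 = r2 \<and> P1 \<le> P2) (ann z 0 es)"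
      using Cons.prems R e by (intro Cons.IH[of R1 z z]) auto
    ultimately show ?thesis using e True by auto
  next
    case False
    then have W: "walk w R r z es" using Cons.prems e by auto
    have "r < r2 \<or> r = r2 \<and> P + k \<le> P2" if "(y2, c2, l2, P2, r2) \<in> set (ann r (P + k) es)" for y2 c2 l2 P2 r2
      using ann_roots[OF W that] ann_dist[OF W, of y2 c2 l2 P2 "P + k"] that Cons.prems e by auto
    then have "\<forall>e2\<in>set (ann r (P + k) es). case e2 of (y2, c2, l2, P2, r2) \<Rightarrow> r < r2 \<or> r = r2 \<and> P + k \<le> P2" by blast
    moreover have "sorted_wrt (\<lambda>(y1, c1, l1, P1, r1) (y2, c2, l2, P2, r2). r1 < r2 \<or> r1 = r2 \<and> P1 \<le> P2) (ann r (P + k) es)"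
      using Cons.prems W e by (intro Cons.IH[of R r z]) auto
    ultimately show ?thesis using e False by auto
  qed
qed simp

lemma ann_pair_dist:
  assumes "walk w R r x es" "sorted_wrt (<) (r # R)" "x \<in> V" "fst ` set es \<subseteq> V"
    "(y1, c1, l1, P1, r) \<in> set (ann r P es)" "(y2, c2, l2, P2, r) \<in> set (ann r P es)"
  shows "w y1 y2 \<le> \<bar>P1 - P2\<bar>"
  using assms
proof (induction es arbitrary: x P)
  case (Cons e es)
  obtain z d k where e: "e = (z, d, k)" by (cases e)
  show ?case
  proof (cases "k = 0")
    case True
    then obtain R1 where R: "R = z # R1" "walk w R1 z z es" using Cons.prems e by (cases R) auto
    then have "r \<notin> set (z # R1)" using Cons.prems(2) by auto
    then have "(y1, c1, l1, P1, r) \<notin> set (ann r P (e # es))"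
      using ann_roots[OF R(2), of y1 c1 l1 P1 r 0] e True by auto
    then show ?thesis using Cons.prems by simp
  next
    case False
    then have W: "walk w R r z es" and z: "z \<in> V" using Cons.prems e by auto
    have V: "y1 \<in> V" "y2 \<in> V" using Cons.prems(4) ann_steps_mem[OF Cons.prems(5)] ann_steps_mem[OF Cons.prems(6)]
      by force+
    have hd: "P + k \<le> P' \<and> w z y \<le> P' - (P + k)" if "(y, c, l, P', r) \<in> set (ann r (P + k) es)" for y c l P'
      using that W z Cons.prems by (intro ann_dist) auto
    have A: "set (ann r P (e # es)) = insert (z, d, k, P + k, r) (set (ann r (P + k) es))"
      using e False by simp
    have "(y1, c1, l1, P1, r) = (z, d, k, P + k, r) \<or> (y1, c1, l1, P1, r) \<in> set (ann r (P + k) es)"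
      "(y2, c2, l2, P2, r) = (z, d, k, P + k, r) \<or> (y2, c2, l2, P2, r) \<in> set (ann r (P + k) es)"
      using Cons.prems(5,6) unfolding A by simp_all
    then show ?thesis
    proof (elim disjE)
      assume "(y1, c1, l1, P1, r) = (z, d, k, P + k, r)" "(y2, c2, l2, P2, r) = (z, d, k, P + k, r)"
      then show ?thesis using w_refl V by auto
    next
      assume 1: "(y1, c1, l1, P1, r) = (z, d, k, P + k, r)" and "(y2, c2, l2, P2, r) \<in> set (ann r (P + k) es)"
      from hd[OF this(2)] 1 show ?thesis by auto
    next
      assume "(y1, c1, l1, P1, r) \<in> set (ann r (P + k) es)" and 2: "(y2, c2, l2, P2, r) = (z, d, k, P + k, r)"
      from hd[OF this(1)] 2 show ?thesis using sym[OF V] by auto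
    next
      assume "(y1, c1, l1, P1, r) \<in> set (ann r (P + k) es)" "(y2, c2, l2, P2, r) \<in> set (ann r (P + k) es)"
      then show ?thesis using Cons.IH[OF W _ z, of "P + k"] Cons.prems by auto
    qed
  qed
qed simp

end

section \<open>The greedy lower bound and the invariant of the tours\<close>

definition edges_on :: "nat set \<Rightarrow> nat set set" where
  "edges_on V = {{x, y} |x y. x \<in> V \<and> y \<in> V \<and> x \<noteq> y}"

text \<open>An edge is read in the orientation from \<open>Min\<close> to \<open>Max\<close>, the
  one that \<open>weight\<close> uses.\<close>

definition edge_wt :: "(nat \<Rightarrow> nat \<Rightarrow> int) \<Rightarrow> nat set \<Rightarrow> int" where
  "edge_wt w e = w (Min e) (Max e)"

context int_metric begin

lemma finD: "finite D" using finV DV finite_subset by blast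

lemma nonneg: "x \<in> V \<Longrightarrow> y \<in> V \<Longrightarrow> 0 \<le> w x y"
  using pos[of x y] w_refl[of x] by (cases "x = y") auto

lemma edge_wt_doubleton: "x \<in> V \<Longrightarrow> y \<in> V \<Longrightarrow> edge_wt w {x, y} = w x y"
  by (cases "x \<le> y") (simp_all add: edge_wt_def min_def max_def sym)

text \<open>The exchange argument as an invariant: while \<open>S\<close> grows, edges of
  \<open>E\<close> are spent one by one to pay for the greedy edges of the points of
  \<open>W\<close> that were visited, and the unspent edges \<open>E'\<close> still connect
  \<open>W\<close> to \<open>S\<close>.\<close>

definition lower_bound :: "nat set \<Rightarrow> (nat \<Rightarrow> int) \<Rightarrow> bool" where
  "lower_bound S ell \<longleftrightarrow> (\<forall>E W. E \<subseteq> edges_on V \<longrightarrow> W \<subseteq> V \<longrightarrow> W \<subseteq> reach E D \<longrightarrow>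
     (\<exists>E'\<subseteq>E. W \<subseteq> reach E' S \<and>
        (\<Sum>v\<in>W \<inter> (S - D). ell v) + (\<Sum>e\<in>E'. edge_wt w e) \<le> (\<Sum>e\<in>E. edge_wt w e)))"

lemma finite_edges_on: "E \<subseteq> edges_on V \<Longrightarrow> finite E"
  by (rule finite_subset[of _ "Pow V"]) (use finV in \<open>auto simp: edges_on_def\<close>)

text \<open>When a point \<open>v\<close> of \<open>W\<close> is visited, the exchange frees an edge
  of \<open>E'\<close> between \<open>S\<close> and its complement. The greedy edge of length
  \<open>b\<close> is a shortest such edge, so the freed one pays for it.\<close>

lemma lower_bound_step:
  assumes lb: "lower_bound S ell" and S: "S \<subseteq> V" and v: "v \<in> V" "v \<notin> S" "v \<notin> D"
    and min: "\<And>x y. x \<in> S \<Longrightarrow> y \<in> V \<Longrightarrow> y \<notin> S \<Longrightarrow> b \<le> w x y"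
  shows "lower_bound (insert v S) (ell(v := b))"
  unfolding lower_bound_def
proof (intro allI impI)
  fix E W assume E: "E \<subseteq> edges_on V" and W: "W \<subseteq> V" "W \<subseteq> reach E D"
  obtain E' where E': "E' \<subseteq> E" "W \<subseteq> reach E' S"
    "(\<Sum>v\<in>W \<inter> (S - D). ell v) + (\<Sum>e\<in>E'. edge_wt w e) \<le> (\<Sum>e\<in>E. edge_wt w e)"
    using lb[unfolded lower_bound_def, rule_format, OF E W] by blast
  have fW: "finite W" using W finV finite_subset by blast
  have same: "(\<Sum>x\<in>W \<inter> (S - D). (ell(v := b)) x) = (\<Sum>v\<in>W \<inter> (S - D). ell v)"
    using v(2) by (intro sum.cong) auto
  show "\<exists>E'\<subseteq>E. W \<subseteq> reach E' (insert v S) \<and>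
     (\<Sum>x\<in>W \<inter> (insert v S - D). (ell(v := b)) x) + sum (edge_wt w) E' \<le> sum (edge_wt w) E"
  proof (cases "v \<in> W")
    case False
    then have "W \<inter> (insert v S - D) = W \<inter> (S - D)" by auto
    moreover have "W \<subseteq> reach E' (insert v S)" using E'(2) reach_mono[of S "insert v S" E'] by blast
    ultimately show ?thesis using E' same by auto
  next
    case True
    then have "v \<in> reach E' S" using E' by blast
    from reach_exchange[OF this v(2)] obtain x y where xy: "{x, y} \<in> E'" "x \<notin> S" "y \<in> S"
      "reach E' S \<subseteq> reach (E' - {{x, y}}) (insert v S)" by blast
    have "{x, y} \<in> edges_on V" using xy(1) E' E by blast
    then have xV: "x \<in> V" by (auto simp: edges_on_def doubleton_eq_iff)
    have yV: "y \<in> V" using xy S by blast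
    have "b \<le> edge_wt w {x, y}" using min[OF xy(3) xV xy(2)] edge_wt_doubleton[OF xV yV] sym[OF xV yV] by simp
    moreover have "sum (edge_wt w) E' = edge_wt w {x, y} + sum (edge_wt w) (E' - {{x, y}})"
      using xy(1) finite_edges_on[of E'] E' E by (intro sum.remove) auto
    moreover have "(\<Sum>x\<in>W \<inter> (insert v S - D). (ell(v := b)) x) = b + (\<Sum>v\<in>W \<inter> (S - D). ell v)"
    proof -
      have "W \<inter> (insert v S - D) = insert v (W \<inter> (S - D))" using True v by auto
      then show ?thesis using fW v(2) same by simp
    qed
    ultimately have "(\<Sum>x\<in>W \<inter> (insert v S - D). (ell(v := b)) x) + sum (edge_wt w) (E' - {{x, y}}) \<le> sum (edge_wt w) E"
      using E'(3) by linarith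
    moreover have "E' - {{x, y}} \<subseteq> E" "W \<subseteq> reach (E' - {{x, y}}) (insert v S)" using E'(1,2) xy(4) by blast+
    ultimately show ?thesis by blast
  qed
qed

lemma walk_insert:
  assumes "walk w R r x (A @ e # B)" "fst e = u" "w u v = l" "w v u = l" "0 < l"
  shows "walk w R r x (A @ e # (v, v, l) # (u, v, l) # B)"
  using assms(1)
proof (induction A arbitrary: R r x)
  case Nil
  then show ?case using assms(2-5) by (cases e) auto
next
  case (Cons a A)
  then show ?case by (cases a) auto
qed

text \<open>A step with \<open>y = c\<close> and nonzero length arrives at \<open>c\<close> along
  its own greedy edge. There is exactly one for each visited point outside the depots, so descents
  stand for points.\<close>

definition down :: "step list \<Rightarrow> nat list" where
  "down T = map fst (filter (\<lambda>(y, c, l). y = c \<and> l \<noteq> 0) T)"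

text \<open>\<open>ell v\<close> is the length of the greedy edge that added \<open>v\<close>. The
  sum condition says that this edge is traversed at most twice. The last condition holds because
  every depot is visited from the start and competes with the greedy choice.\<close>

definition tour_inv :: "nat list \<Rightarrow> step list \<Rightarrow> (nat \<Rightarrow> int) \<Rightarrow> bool" where
  "tour_inv ds T ell \<longleftrightarrow> walk w ds 0 0 T \<and> snd (snd (hd T)) = 0 \<and>
     (\<forall>y c l. (y, c, l) \<in> set T \<longrightarrow> y \<in> V \<and> c \<in> fst ` set T \<and> (l = 0 \<longrightarrow> y = c \<and> c \<in> D) \<and>
        (l \<noteq> 0 \<longrightarrow> c \<notin> D \<and> l = ell c \<and> w c y \<le> l \<and> 0 < l)) \<and>
     D \<subseteq> fst ` set T \<and>
     distinct (down T) \<and> set (down T) = fst ` set T - D \<and>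
     (\<forall>v\<in>fst ` set T - D. (\<Sum>(y, c, l)\<leftarrow>T. if c = v then l else 0) \<le> 2 * ell v) \<and>
     lower_bound (fst ` set T) ell \<and>
     (\<forall>c\<in>fst ` set T - D. \<forall>q\<in>D. ell c \<le> w q c)"

end

context int_metric begin
lemma tour_inv_init:
  assumes "set ds = D"
  shows "tour_inv ds (map (\<lambda>r. (r, r, 0)) ds) (\<lambda>_. 0)"
proof -
  have "walk w ds r r (map (\<lambda>r. (r, r, 0)) ds)" for r
    by (induction ds arbitrary: r) auto
  moreover have "snd (snd (hd (map (\<lambda>r. (r, r, 0::int)) ds))) = 0"
    using assms D_nonempty by (cases ds) auto
  moreover have "fst ` set (map (\<lambda>r. (r, r, 0::int)) ds) = D" using assms by force
  moreover have "down (map (\<lambda>r. (r, r, 0)) ds) = []" by (simp add: down_def)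
  moreover have "lower_bound D (\<lambda>_. 0)" by (auto simp: lower_bound_def)
  ultimately show ?thesis using assms DV by (auto simp: tour_inv_def)
qed

lemma tour_invD:
  assumes "tour_inv ds T ell"
  shows "walk w ds 0 0 T" "snd (snd (hd T)) = 0" "fst ` set T \<subseteq> V" "D \<subseteq> fst ` set T"
    "(y, c, l) \<in> set T \<Longrightarrow> y \<in> V \<and> c \<in> fst ` set T \<and> (l = 0 \<longrightarrow> y = c \<and> c \<in> D) \<and>
        (l \<noteq> 0 \<longrightarrow> c \<notin> D \<and> l = ell c \<and> w c y \<le> l \<and> 0 < l)"
    "distinct (down T)" "set (down T) = fst ` set T - D"
    "v \<in> fst ` set T \<Longrightarrow> v \<notin> D \<Longrightarrow> (\<Sum>(y, c, l)\<leftarrow>T. if c = v then l else 0) \<le> 2 * ell v"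
    "lower_bound (fst ` set T) ell"
    "v \<in> fst ` set T \<Longrightarrow> v \<notin> D \<Longrightarrow> q \<in> D \<Longrightarrow> ell v \<le> w q v"
  using assms unfolding tour_inv_def by (blast | force)+

lemma tour_inv_step:
  assumes inv: "tour_inv ds T ell" and vs: "set vs = V" and ds: "set ds = D"
  shows "\<exists>ell'. tour_inv ds (tour_step w vs T) ell' \<and>
    (fst ` set (tour_step w vs T) = V \<or> card (fst ` set (tour_step w vs T)) = Suc (card (fst ` set T)))"
proof (cases rule: tour_step_cases[of w vs T])
  case stop
  note i = tour_invD[OF inv]
  have "T \<noteq> []" using i(4) D_nonempty by auto
  then have "\<forall>v\<in>set vs. v \<in> set (map fst T)"
    using stop(2) by (simp add: unvisited_def filter_empty_conv)
  then have "V \<subseteq> fst ` set T" using vs by auto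
  then have "fst ` set T = V" using i(3) by blast
  then show ?thesis using inv stop(1) by metis
next
  case (grow u v A e B)
  note i = tour_invD[OF inv]
  let ?S = "fst ` set T" and ?T = "tour_step w vs T" and ?l = "w u v"
  have u: "u \<in> ?S" "u \<in> V" using grow(1,2) i(3) by auto
  have v: "v \<in> V" "v \<notin> ?S" "v \<notin> D" using grow(3,4) vs i(4) by auto
  have uv: "u \<noteq> v" using u v by auto
  have l: "0 < ?l" "w v u = ?l" using pos[OF u(2) v(1) uv] sym[OF u(2) v(1)] by auto
  have setT: "set ?T = insert (v, v, ?l) (insert (u, v, ?l) (set T))"
    unfolding grow(5) unfolding grow(1) by auto
  have S': "fst ` set ?T = insert v ?S" using setT u by auto
  let ?ell = "ell(v := ?l)"
  have 1: "walk w ds 0 0 ?T"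
    unfolding grow(5) using i(1) grow(1,2) l by (intro walk_insert) auto
  have 2: "snd (snd (hd ?T)) = 0" using i(2) unfolding grow(5) unfolding grow(1) by (cases A) auto
  have 3: "y \<in> V \<and> c \<in> fst ` set ?T \<and> (l = 0 \<longrightarrow> y = c \<and> c \<in> D) \<and>
        (l \<noteq> 0 \<longrightarrow> c \<notin> D \<and> l = ?ell c \<and> w c y \<le> l \<and> 0 < l)" if e: "(y, c, l) \<in> set ?T" for y c l
  proof -
    have "(y, c, l) = (v, v, ?l) \<or> (y, c, l) = (u, v, ?l) \<or> (y, c, l) \<in> set T"
      using e unfolding setT by blast
    then show ?thesis
    proof (elim disjE)
      assume e: "(y, c, l) \<in> set T"
      have "c \<noteq> v" using i(5)[OF e] v(2) by metis
      then show ?thesis using i(5)[OF e] S' by simp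
    qed (use u v l S' w_refl in auto)
  qed
  have 4: "D \<subseteq> fst ` set ?T" using i(4) S' by auto
  have "down ?T = down (A @ [e]) @ v # down B" "down T = down (A @ [e]) @ down B"
    unfolding grow(5) using grow(1) l uv by (auto simp: down_def)
  then have 5: "distinct (down ?T)" "set (down ?T) = fst ` set ?T - D"
    using i(6,7) v S' by auto
  have 6: "(\<Sum>(y, c, l)\<leftarrow>?T. if c = z then l else 0) \<le> 2 * ?ell z" if z: "z \<in> fst ` set ?T - D" for z
  proof -
    have split: "(\<Sum>(y, c, l)\<leftarrow>?T. if c = z then l else 0) =
       (\<Sum>(y, c, l)\<leftarrow>T. if c = z then l else 0) + (if z = v then 2 * ?l else 0)"
      unfolding grow(5) unfolding grow(1) by simp
    show ?thesis
    proof (cases "z = v")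
      case True
      \<comment> \<open>No earlier entry uses the edge of \<open>v\<close>, since its child
        component would already be visited; only the two new steps count.\<close>
      have "map (\<lambda>(y, c, l). if c = v then l else 0) T = map (\<lambda>_. 0) T"
      proof (rule map_cong)
        fix e assume e: "e \<in> set T"
        obtain y c l where ycl: "e = (y, c, l)" by (cases e)
        have "c \<noteq> v" using i(5)[OF e[unfolded ycl]] v(2) by metis
        then show "(case e of (y, c, l) \<Rightarrow> if c = v then l else 0) = 0" by (simp add: ycl)
      qed simp
      then have "(\<Sum>(y, c, l)\<leftarrow>T. if c = v then l else 0) = (\<Sum>_\<leftarrow>T. 0)" by (rule arg_cong)
      then show ?thesis using split True by simp
    next
      case False
      then have "z \<in> ?S" "z \<notin> D" using z S' by auto
      then show ?thesis using split i(8)[of z] False by simp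
    qed
  qed
  have 7: "lower_bound (fst ` set ?T) ?ell"
    unfolding S' using grow(6) vs by (intro lower_bound_step i(9,3) v) auto
  have 8: "?ell c \<le> w q c" if c: "c \<in> fst ` set ?T - D" and q: "q \<in> D" for c q
  proof (cases "c = v")
    case True
    have "q \<in> ?S" using q i(4) by auto
    then show ?thesis using grow(6)[of q v] v vs True by simp
  next
    case False
    then have "c \<in> ?S" "c \<notin> D" using c S' by auto
    then show ?thesis using i(10)[OF _ _ q] False by simp
  qed
  have "tour_inv ds ?T ?ell"
    unfolding tour_inv_def by (intro conjI allI ballI impI 1 2 4 5 6 7 8) (use 3 in \<open>blast+\<close>)
  moreover have "card (fst ` set ?T) = Suc (card ?S)" using S' v by simp
  ultimately show ?thesis by blast
qed

text \<open>A round either visits a new point or finds everything visited, so \<open>card V\<close>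
  rounds suffice.\<close>

lemma tour_inv_tour:
  assumes vs: "set vs = V" "distinct vs" and ds: "set ds = D"
  shows "\<exists>ell. tour_inv ds (tour w vs ds) ell \<and> fst ` set (tour w vs ds) = V"
proof -
  let ?F = "\<lambda>ys. foldl (\<lambda>T _. tour_step w vs T) (map (\<lambda>r. (r, r, 0)) ds) ys"
  have "\<exists>ell. tour_inv ds (?F ys) ell \<and> (fst ` set (?F ys) = V \<or> length ys \<le> card (fst ` set (?F ys)))"
    for ys :: "nat list"
  proof (induction ys rule: rev_induct)
    case Nil
    then show ?case using tour_inv_init[OF ds] by auto
  next
    case (snoc a ys)
    then obtain ell where ell: "tour_inv ds (?F ys) ell"
      "fst ` set (?F ys) = V \<or> length ys \<le> card (fst ` set (?F ys))" by blast
    obtain ell' where ell': "tour_inv ds (?F (ys @ [a])) ell'"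
      "fst ` set (?F (ys @ [a])) = V \<or> card (fst ` set (?F (ys @ [a]))) = Suc (card (fst ` set (?F ys)))"
      using tour_inv_step[OF ell(1) vs(1) ds] by auto
    have "fst ` set (?F (ys @ [a])) \<subseteq> V" using tour_invD(3)[OF ell'(1)] .
    then have "card (fst ` set (?F (ys @ [a]))) \<le> card V" using finV card_mono by blast
    then have "fst ` set (?F (ys @ [a])) = V \<or> length (ys @ [a]) \<le> card (fst ` set (?F (ys @ [a])))"
      using ell(2) ell'(2) by auto
    with ell'(1) show ?case by blast
  qed
  from this[of vs] obtain ell where ell: "tour_inv ds (tour w vs ds) ell"
    "fst ` set (tour w vs ds) = V \<or> length vs \<le> card (fst ` set (tour w vs ds))"
    unfolding tour_def by blast
  have len: "length vs = card V" using vs distinct_card by metis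
  have sub: "fst ` set (tour w vs ds) \<subseteq> V" using tour_invD(3)[OF ell(1)] .
  have "fst ` set (tour w vs ds) = V" using ell(2)
  proof
    assume "length vs \<le> card (fst ` set (tour w vs ds))"
    then have "card (fst ` set (tour w vs ds)) = card V"
      using len card_mono[OF finV sub] by linarith
    then show ?thesis by (rule card_subset_eq[OF finV sub])
  qed
  with ell(1) show ?thesis by blast
qed

end

text \<open>All that the assignment and its analysis use of the greedy tours.\<close>

locale tours = int_metric +
  fixes ell :: "nat \<Rightarrow> int" and st :: "pstep list"
  assumes st_mem: "\<And>y c l P r. (y, c, l, P, r) \<in> set st \<Longrightarrow> y \<in> V \<and> c \<in> V \<and> r \<in> D \<and> 0 \<le> P"
    and st_tree: "\<And>y c l P r. (y, c, l, P, r) \<in> set st \<Longrightarrow> l \<noteq> 0 \<Longrightarrow>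
        c \<notin> D \<and> l = ell c \<and> w c y \<le> l \<and> 0 < l"
    and st_start: "\<And>y c P r. (y, c, 0, P, r) \<in> set st \<Longrightarrow> P = 0"
    and st_dist: "\<And>y1 c1 l1 P1 y2 c2 l2 P2 r. (y1, c1, l1, P1, r) \<in> set st \<Longrightarrow>
        (y2, c2, l2, P2, r) \<in> set st \<Longrightarrow> w y1 y2 \<le> \<bar>P1 - P2\<bar>"
    and st_root: "\<And>y c l P r. (y, c, l, P, r) \<in> set st \<Longrightarrow> w r y \<le> P"
    and st_return: "\<And>y c l P r. (y, c, l, P, r) \<in> set st \<Longrightarrow>
        \<exists>y' c' l' M. (y', c', l', M, r) \<in> set st \<and> w r y \<le> M - P"
    and st_cell: "\<And>y c l P r t. (y, c, l, P, r) \<in> set st \<Longrightarrow> 0 \<le> t \<Longrightarrow> t < P \<Longrightarrow>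
        \<exists>y' c' l' P'. (y', c', l', P', r) \<in> set st \<and> P' - l' \<le> t \<and> t < P'"
    and st_sorted: "sorted_wrt (\<lambda>(y1, c1, l1, P1, r1) (y2, c2, l2, P2, r2). r1 < r2 \<or> r1 = r2 \<and> P1 \<le> P2) st"
    and st_down: "distinct (map fst (filter (\<lambda>(y, c, l, P, r). y = c \<and> l \<noteq> 0) st))"
      "fst ` set (filter (\<lambda>(y, c, l, P, r). y = c \<and> l \<noteq> 0) st) = V - D"
    and st_mass: "\<And>v. v \<in> V - D \<Longrightarrow> (\<Sum>(y, c, l, P, r)\<leftarrow>st. if c = v then l else 0) \<le> 2 * ell v"
    and ell_le: "\<And>c q. c \<in> V - D \<Longrightarrow> q \<in> D \<Longrightarrow> ell c \<le> w q c"
    and lower: "\<And>E W. E \<subseteq> edges_on V \<Longrightarrow> W \<subseteq> V \<Longrightarrow> W \<subseteq> reach E D \<Longrightarrow>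
        (\<Sum>v\<in>W - D. ell v) \<le> (\<Sum>e\<in>E. edge_wt w e)"

lemma ann_start: "(y, c, 0, P', r') \<in> set (ann r P es) \<Longrightarrow> P' = 0"
  by (induction r P es rule: ann.induct) (auto split: if_splits)

context int_metric begin

lemma tours_exist:
  assumes vs: "set vs = V" "distinct vs" and ds: "set ds = D" "sorted_wrt (<) ds"
  shows "\<exists>ell. tours V D w ell (annotate (tour w vs ds))"
proof -
  define T where "T = tour w vs ds"
  obtain ell where inv: "tour_inv ds T ell" and S: "fst ` set T = V"
    using tour_inv_tour[OF vs ds(1)] unfolding T_def by blast
  have entry: "y \<in> V \<and> c \<in> V \<and> (l = 0 \<longrightarrow> y = c \<and> c \<in> D) \<and>
        (l \<noteq> 0 \<longrightarrow> c \<notin> D \<and> l = ell c \<and> w c y \<le> l \<and> 0 < l)" if "(y, c, l) \<in> set T" for y c l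
    using tour_invD(5)[OF inv that] S by simp
  have "walk w ds 0 0 T" "snd (snd (hd T)) = 0" "T \<noteq> []"
    using tour_invD(1,2,4)[OF inv] D_nonempty by auto
  then obtain r0 c0 R es where T: "T = (r0, c0, 0) # es" "ds = r0 # R" "walk w R r0 r0 es"
    by (cases T; cases ds) auto
  have c0: "c0 = r0" using entry[of r0 c0 0] T by auto
  define st where "st = annotate T"
  have st: "st = (r0, r0, 0, 0, r0) # ann r0 0 es"
    by (simp add: st_def annotate_eq_ann T c0)
  have srt: "sorted_wrt (<) (r0 # R)" using ds T by simp
  have D: "D = set (r0 # R)" using ds T by simp
  have esV: "fst ` set es \<subseteq> V" using S T by auto
  have steps: "map (\<lambda>(y, c, l, P, r). (y, c, l)) st = T"
    using ann_steps by (simp add: st T c0)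
  have stT: "(y, c, l) \<in> set T" if "(y, c, l, P, r) \<in> set st" for y c l P r
    using that unfolding steps[symmetric] by force
  have root: "r \<in> D" if "(y, c, l, P, r) \<in> set st" for y c l P r
    using that ann_roots[OF T(3), of y c l P r 0] D by (auto simp: st)
  \<comment> \<open>Every depot's entries are a start entry followed by a walk from position 0, so
    the lemmas on walks apply to each depot separately. The first depot is not a member of
    \<open>R\<close> and is treated by hand.\<close>
  have seg: "\<exists>R' es' c. walk w R' r r es' \<and> sorted_wrt (<) (r # R') \<and> fst ` set es' \<subseteq> V \<and>
    (\<forall>y d l P. (y, d, l, P, r) \<in> set st \<longleftrightarrow> (y, d, l, P, r) = (r, c, 0, 0, r) \<or> (y, d, l, P, r) \<in> set (ann r 0 es'))"
    if r: "r \<in> D" for r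
  proof (cases "r = r0")
    case True
    then show ?thesis using T(3) srt esV by (intro exI[of _ R] exI[of _ es] exI[of _ r0]) (auto simp: st)
  next
    case False
    then have "r \<in> set R" using r D by auto
    from ann_segment[OF T(3) srt this, of 0] obtain R' es' c where seg:
      "walk w R' r r es' \<and> sorted_wrt (<) (r # R') \<and> set es' \<subseteq> set es \<and>
       (\<forall>y d l P. (y, d, l, P, r) \<in> set (ann r0 0 es) \<longleftrightarrow>
       (y, d, l, P, r) = (r, c, 0, 0, r) \<or> (y, d, l, P, r) \<in> set (ann r 0 es'))"
      by (elim exE) (rule that)
    have "fst ` set es' \<subseteq> V" using seg[THEN conjunct2, THEN conjunct2, THEN conjunct1] esV by blast
    then show ?thesis using seg False
      by (intro exI[of _ R'] exI[of _ es'] exI[of _ c]) (simp add: st)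
  qed
  have dist: "0 \<le> P \<and> w r y \<le> P" if e: "(y, c, l, P, r) \<in> set st" for y c l P r
  proof -
    have r: "r \<in> D" "r \<in> V" using root[OF e] DV by auto
    obtain R' es' c' where W0: "walk w R' r r es' \<and> sorted_wrt (<) (r # R') \<and> fst ` set es' \<subseteq> V \<and>
      (\<forall>y d l P. (y, d, l, P, r) \<in> set st \<longleftrightarrow> (y, d, l, P, r) = (r, c', 0, 0, r) \<or> (y, d, l, P, r) \<in> set (ann r 0 es'))"
      using seg[OF r(1)] by (elim exE) (rule that)
    then have W: "walk w R' r r es'" "sorted_wrt (<) (r # R')" "fst ` set es' \<subseteq> V"
      by simp_all
    have m: "(y, d, l, P, r) \<in> set st \<longleftrightarrow> (y, d, l, P, r) = (r, c', 0, 0, r) \<or> (y, d, l, P, r) \<in> set (ann r 0 es')"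
      for y d l P using W0 by (elim conjE allE)
    have "(y, c, l, P, r) \<in> set (ann r 0 es') \<Longrightarrow> 0 \<le> P \<and> w r y \<le> P - 0"
      by (rule ann_dist[OF W(1,2) r(2) W(3)])
    then show ?thesis using e m[of y c l P] w_refl r(2) by auto
  qed
  have "tours V D w ell st"
  proof (unfold_locales)
    fix y c l P r assume e: "(y, c, l, P, r) \<in> set st"
    show "y \<in> V \<and> c \<in> V \<and> r \<in> D \<and> 0 \<le> P" using entry[OF stT[OF e]] root[OF e] dist[OF e] by auto
    show "w r y \<le> P" using dist[OF e] by auto
    show "c \<notin> D \<and> l = ell c \<and> w c y \<le> l \<and> 0 < l" if "l \<noteq> 0" using entry[OF stT[OF e]] that by auto
    have r: "r \<in> D" "r \<in> V" using root[OF e] DV by auto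
    obtain R' es' c' where W0: "walk w R' r r es' \<and> sorted_wrt (<) (r # R') \<and> fst ` set es' \<subseteq> V \<and>
      (\<forall>y d l P. (y, d, l, P, r) \<in> set st \<longleftrightarrow> (y, d, l, P, r) = (r, c', 0, 0, r) \<or> (y, d, l, P, r) \<in> set (ann r 0 es'))"
      using seg[OF r(1)] by (elim exE) (rule that)
    then have W: "walk w R' r r es'" "sorted_wrt (<) (r # R')" "fst ` set es' \<subseteq> V"
      by simp_all
    have m: "(y, d, l, P, r) \<in> set st \<longleftrightarrow> (y, d, l, P, r) = (r, c', 0, 0, r) \<or> (y, d, l, P, r) \<in> set (ann r 0 es')"
      for y d l P using W0 by (elim conjE allE)
    obtain M where M: "0 \<le> M" "M = 0 \<or> (\<exists>y c l. (y, c, l, M, r) \<in> set (ann r 0 es'))"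
      "w r r \<le> M - 0"
      "\<And>y c l P'. (y, c, l, P', r) \<in> set (ann r 0 es') \<Longrightarrow> P' \<le> M \<and> w y r \<le> M - P'"
      using ann_return[OF W(1,2) r(2) W(3) r(2), of 0] by blast
    have "\<exists>y' c' l'. (y', c', l', M, r) \<in> set st" using M(2) m by blast
    moreover have "w r y \<le> M - P"
      using e m[of y c l P] M sym[of r y] r(2) entry[OF stT[OF e]] by fastforce
    ultimately show "\<exists>y' c' l' M. (y', c', l', M, r) \<in> set st \<and> w r y \<le> M - P" by blast
    show "\<exists>y' c' l' P'. (y', c', l', P', r) \<in> set st \<and> P' - l' \<le> t \<and> t < P'" if t: "0 \<le> t" "t < P" for t
    proof -
      have "(y, c, l, P, r) \<in> set (ann r 0 es')" using e m[of y c l P] t by auto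
      from ann_cell[OF W(1,2) this t] m show ?thesis by blast
    qed
    show "w y y2 \<le> \<bar>P - P2\<bar>" if e2: "(y2, c2, l2, P2, r) \<in> set st" for y2 c2 l2 P2
    proof -
      have V: "y \<in> V" "y2 \<in> V" using entry[OF stT[OF e]] entry[OF stT[OF e2]] by auto
      consider "y = r" "P = 0" | "y2 = r" "P2 = 0"
        | "(y, c, l, P, r) \<in> set (ann r 0 es')" "(y2, c2, l2, P2, r) \<in> set (ann r 0 es')"
        using e e2 m by auto
      then show ?thesis
      proof cases
        case 1
        then show ?thesis using dist[OF e2] by auto
      next
        case 2
        then show ?thesis using dist[OF e] sym[OF V] by auto
      next
        case 3
        then show ?thesis by (rule ann_pair_dist[OF W(1,2) r(2) W(3)])
      qed
    qed
  next
    show "P = 0" if "(y, c, 0, P, r) \<in> set st" for y c P r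
      using that ann_start by (auto simp: st)
    have "r0 < r \<or> r0 = r \<and> 0 \<le> P" if "(y, c, l, P, r) \<in> set (ann r0 0 es)" for y c l P r
      using ann_roots[OF T(3) that] dist[of y c l P r] that srt by (auto simp: st)
    then have "\<forall>x\<in>set (ann r0 0 es). case x of (y, c, l, P, r) \<Rightarrow> r0 < r \<or> r0 = r \<and> 0 \<le> P" by blast
    moreover have "sorted_wrt (\<lambda>(y1, c1, l1, P1, r1) (y2, c2, l2, P2, r2). r1 < r2 \<or> r1 = r2 \<and> P1 \<le> P2) (ann r0 0 es)"
      using ann_sorted[OF T(3) srt _ esV] D DV by auto
    ultimately show "sorted_wrt (\<lambda>(y1, c1, l1, P1, r1) (y2, c2, l2, P2, r2). r1 < r2 \<or> r1 = r2 \<and> P1 \<le> P2) st"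
      by (auto simp: st)
    have "map fst (filter (\<lambda>(y, c, l, P, r). y = c \<and> l \<noteq> 0) st) = down (map (\<lambda>(y, c, l, P, r). (y, c, l)) st)" for st
      by (induction st) (auto simp: down_def)
    then have dn: "map fst (filter (\<lambda>(y, c, l, P, r). y = c \<and> l \<noteq> 0) st) = down T" using steps by metis
    show "distinct (map fst (filter (\<lambda>(y, c, l, P, r). y = c \<and> l \<noteq> 0) st))"
      unfolding dn using inv by (simp add: tour_inv_def)
    show "fst ` set (filter (\<lambda>(y, c, l, P, r). y = c \<and> l \<noteq> 0) st) = V - D"
      unfolding set_map[symmetric] dn using inv S by (simp add: tour_inv_def)
    fix v assume v: "v \<in> V - D"
    have "map (\<lambda>(y, c, l). if c = v then l else 0) (map (\<lambda>(y, c, l, P, r). (y, c, l)) st) =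
        map (\<lambda>(y, c, l, P, r). if c = v then l else 0) st" by auto
    then have "(\<Sum>(y, c, l, P, r)\<leftarrow>st. if c = v then l else 0) = (\<Sum>(y, c, l)\<leftarrow>T. if c = v then l else 0)"
      using steps by metis
    then show "(\<Sum>(y, c, l, P, r)\<leftarrow>st. if c = v then l else 0) \<le> 2 * ell v"
      using inv v S by (simp add: tour_inv_def)
    show "ell v \<le> w q v" if "q \<in> D" for q using inv v S that by (simp add: tour_inv_def)
  next
    fix E W assume E: "E \<subseteq> edges_on V" and W: "W \<subseteq> V" "W \<subseteq> reach E D"
    have lb: "lower_bound V ell" using inv S by (simp add: tour_inv_def)
    obtain E' where E': "E' \<subseteq> E" "(\<Sum>v\<in>W \<inter> (V - D). ell v) + sum (edge_wt w) E' \<le> sum (edge_wt w) E"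
      using lb[unfolded lower_bound_def, rule_format, OF E W] by blast
    \<comment> \<open>Once all of \<open>V\<close> is visited, the unspent edges are needed no more
      and are dropped as nonnegative.\<close>
    have "0 \<le> edge_wt w e" if "e \<in> E'" for e
    proof -
      have "e \<in> edges_on V" using \<open>e \<in> E'\<close> E'(1) E by blast
      then obtain x y where "e = {x, y}" "x \<in> V" "y \<in> V" by (auto simp: edges_on_def)
      then show ?thesis using edge_wt_doubleton nonneg by simp
    qed
    then have "0 \<le> sum (edge_wt w) E'" by (rule sum_nonneg)
    moreover have "W \<inter> (V - D) = W - D" using W by auto
    ultimately show "(\<Sum>v\<in>W - D. ell v) \<le> sum (edge_wt w) E" using E'(2) by simp
  qed
  then show ?thesis unfolding st_def T_def by blast
qed

end

section \<open>Matching jobs to depots by an auction\<close>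

text \<open>Pigeonhole: \<open>length ps\<close> entries cannot cover the
  \<open>length ps + 1\<close> numbers from 0 to \<open>length ps\<close>.\<close>

lemma mex_props: "mex ps \<le> length ps" "mex ps \<notin> set ps"
proof -
  let ?f = "\<lambda>t _. if t \<in> set ps then t + 1 else t"
  have "foldl ?f 0 ys \<le> length ys \<and> {..<foldl ?f 0 ys} \<subseteq> set ps \<and>
      (foldl ?f 0 ys \<notin> set ps \<or> foldl ?f 0 ys = length ys)" for ys :: "nat list"
    by (induction ys rule: rev_induct) (auto simp: less_Suc_eq)
  from this[of ps] have m: "mex ps \<le> length ps" "{..<mex ps} \<subseteq> set ps" "mex ps \<notin> set ps \<or> mex ps = length ps"
    by (auto simp: mex_def)
  show "mex ps \<le> length ps" by (rule m(1))
  show "mex ps \<notin> set ps"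
  proof
    assume "mex ps \<in> set ps"
    with m(2,3) have "{..mex ps} \<subseteq> set ps" "mex ps = length ps" by (auto simp: less_le)
    then have "card {..length ps} \<le> card (set ps)" by (metis card_mono finite_set)
    then show False using card_length[of ps] by simp
  qed
qed

section \<open>The invariant of the auction\<close>

abbreviation slot_id :: "'j slot \<Rightarrow> nat \<times> nat" where
  "slot_id s \<equiv> (fst s, fst (snd s))"

abbreviation owners :: "'j slot list \<Rightarrow> 'j job list" where
  "owners sl \<equiv> concat (map (\<lambda>s. snd (snd (snd s))) sl)"

text \<open>The multiset equation keeps every job in exactly one place. A slot is held precisely
  when its price is positive, since holders are replaced but never removed. The fifth condition is
  complementary slackness up to 1: no slot acceptable to the holder is cheaper than the held one by
  more than the last raise.\<close>

definition auction_inv :: "'j job list \<Rightarrow> nat list \<Rightarrow> 'j market \<Rightarrow> bool" where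
  "auction_inv jl avail m = (case m of (pend, sl, G) \<Rightarrow>
     mset pend + mset (owners sl) + mset G = mset jl \<and>
     map slot_id sl = map slot_id (slots avail :: 'j slot list) \<and>
     (\<forall>q i p own b. (q, i, p, own) \<in> set sl \<longrightarrow> b \<in> set own \<longrightarrow> q \<in> set (snd b)) \<and>
     (\<forall>q i p own. (q, i, p, own) \<in> set sl \<longrightarrow> length own = (if p = 0 then 0 else 1)) \<and>
     (\<forall>q i p own b q' i' p' own'. (q, i, p, own) \<in> set sl \<longrightarrow> b \<in> set own \<longrightarrow>
        (q', i', p', own') \<in> set sl \<longrightarrow> q' \<in> set (snd b) \<longrightarrow> p \<le> p' + 1) \<and>
     (\<forall>b q i p own. b \<in> set G \<longrightarrow> (q, i, p, own) \<in> set sl \<longrightarrow> q \<in> set (snd b) \<longrightarrow> length sl < p))"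

lemma auction_invD:
  fixes jl :: "'j job list"
  assumes "auction_inv jl avail (pend, sl, G)"
  shows "mset pend + mset (owners sl) + mset G = mset jl"
    "map slot_id sl = map slot_id (slots avail :: 'j slot list)"
    "(q, i, p, own) \<in> set sl \<Longrightarrow> b \<in> set own \<Longrightarrow> q \<in> set (snd b)"
    "(q, i, p, own) \<in> set sl \<Longrightarrow> length own = (if p = 0 then 0 else 1)"
    "(q, i, p, own) \<in> set sl \<Longrightarrow> b \<in> set own \<Longrightarrow> (q', i', p', own') \<in> set sl \<Longrightarrow>
       q' \<in> set (snd b) \<Longrightarrow> p \<le> p' + 1"
    "b \<in> set G \<Longrightarrow> (q, i, p, own) \<in> set sl \<Longrightarrow> q \<in> set (snd b) \<Longrightarrow> length sl < p"
proof -
  note A = assms[unfolded auction_inv_def prod.case]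
  show "mset pend + mset (owners sl) + mset G = mset jl" by (rule A[THEN conjunct1])
  note A = A[THEN conjunct2]
  show "map slot_id sl = map slot_id (slots avail :: 'j slot list)" by (rule A[THEN conjunct1])
  note A = A[THEN conjunct2]
  show "(q, i, p, own) \<in> set sl \<Longrightarrow> b \<in> set own \<Longrightarrow> q \<in> set (snd b)" by (rule A[THEN conjunct1, rule_format])
  note A = A[THEN conjunct2]
  show "(q, i, p, own) \<in> set sl \<Longrightarrow> length own = (if p = 0 then 0 else 1)" by (rule A[THEN conjunct1, rule_format])
  note A = A[THEN conjunct2]
  show "(q, i, p, own) \<in> set sl \<Longrightarrow> b \<in> set own \<Longrightarrow> (q', i', p', own') \<in> set sl \<Longrightarrow>
       q' \<in> set (snd b) \<Longrightarrow> p \<le> p' + 1" by (rule A[THEN conjunct1, rule_format])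
  note A = A[THEN conjunct2]
  show "b \<in> set G \<Longrightarrow> (q, i, p, own) \<in> set sl \<Longrightarrow> q \<in> set (snd b) \<Longrightarrow> length sl < p" by (rule A[rule_format])
qed

lemma distinct_slot_ids: "distinct avail \<Longrightarrow> distinct (map slot_id (slots avail))"
  by (induction avail) (auto simp: slots_def)

lemma auction_inv_init:
  fixes jl :: "'j job list" shows "auction_inv jl avail (jl, slots avail, [])"
proof -
  have 1: "p = 0 \<and> own = []" if "(q, i, p, own) \<in> set (slots avail)" for q i p and own :: "'j job list"
    using that by (auto simp: slots_def)
  have 2: "owners (slots avail :: 'j slot list) = []" by (auto simp: slots_def)
  show ?thesis unfolding auction_inv_def prod.case
  proof (intro conjI allI impI)
    fix q i p own b assume "(q, i, p, own) \<in> set (slots avail)" "b \<in> set (own :: 'j job list)"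
    then show "q \<in> set (snd b)" using 1 by fastforce
  next
    fix q i p own assume "(q, i, p, own) \<in> set (slots avail :: 'j slot list)"
    then show "length own = (if p = 0 then 0 else 1)" using 1 by fastforce
  next
    fix q i p own q' i' p' own' b assume "(q, i, p, own) \<in> set (slots avail)" "b \<in> set (own :: 'j job list)"
    then show "p \<le> p' + 1" using 1 by fastforce
  qed (simp_all add: 2)
qed

lemma auction_inv_step:
  fixes jl :: "'j job list"
  assumes inv: "auction_inv jl avail m" and da: "distinct avail"
  shows "auction_inv jl avail (auction_step m)"
proof (cases "fst m")
  case Nil
  then have "auction_step m = m" by (auto simp: auction_step_def split: prod.splits)
  then show ?thesis using inv by simp
next
  case (Cons a rest)
  then obtain sl G where m: "m = (a # rest, sl, G)" by (cases m) auto
  note I = auction_invD[OF inv[unfolded m]]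
  from m show ?thesis
  proof (cases rule: auction_step_cases)
    case give_up
    show ?thesis unfolding give_up(1) auction_inv_def prod.case
    proof (intro conjI allI impI)
      show "mset rest + mset (owners sl) + mset (a # G) = mset jl" using I(1) by simp
      show "length sl < p" if "b \<in> set (a # G)" "(q, i, p, own) \<in> set sl" "q \<in> set (snd b)" for b q i p own
      proof (cases "b = a")
        case True
        then show ?thesis using give_up(2)[OF that(2)] that(3) by simp
      next
        case False
        then have "b \<in> set G" using that(1) by simp
        from I(6)[OF this that(2,3)] show ?thesis .
      qed
    qed (use I(2-5) in blast)+
  next
    case (assign q i p own)
    obtain A B where sl: "sl = A @ (q, i, p, own) # B" using assign(1) split_list by metis
    \<comment> \<open>Slot identifiers are unique, so the map in \<open>auction_step\<close> changes
      exactly one slot.\<close>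
    have "distinct (map slot_id sl)" unfolding I(2) by (rule distinct_slot_ids[OF da])
    then have other: "slot_id s \<noteq> (q, i)" if "s \<in> set A \<union> set B" for s
      using that unfolding sl by auto
    define sl' where "sl' = A @ (q, i, p + 1, [a]) # B"
    have upd: "map (\<lambda>s. if fst s = q \<and> fst (snd s) = i \<and> fst (snd (snd s)) = p then (q, i, p + 1, [a]) else s) C = C"
      if "set C \<subseteq> set A \<union> set B" for C
    proof (rule map_idI)
      fix s assume "s \<in> set C"
      then have "slot_id s \<noteq> (q, i)" using that other by blast
      then show "(if fst s = q \<and> fst (snd s) = i \<and> fst (snd (snd s)) = p then (q, i, p + 1, [a]) else s) = s"
        by auto
    qed
    let ?pend = "case own of [] \<Rightarrow> rest | b # _ \<Rightarrow> b # rest"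
    have step: "auction_step m = (?pend, sl', G)"
      unfolding assign(5) sl'_def sl using upd[of A] upd[of B] by simp
    have mem: "s \<in> set sl' \<longleftrightarrow> s = (q, i, p + 1, [a]) \<or> s \<in> set A \<union> set B" for s
      by (auto simp: sl'_def)
    have memsl: "s \<in> set A \<union> set B \<Longrightarrow> s \<in> set sl" for s by (auto simp: sl)
    have len: "length sl' = length sl" by (simp add: sl sl'_def)
    have own: "length own \<le> 1" using I(4)[OF assign(1)] by simp
    then have pend: "mset ?pend = mset own + mset rest" by (cases own) auto
    show ?thesis unfolding step auction_inv_def prod.case
    proof (intro conjI allI impI)
      have "mset (owners sl') = mset (owners A) + mset (owners B) + {#a#}" by (simp add: sl'_def)
      moreover have "mset (owners sl) = mset (owners A) + mset (owners B) + mset own" by (simp add: sl)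
      ultimately show "mset ?pend + mset (owners sl') + mset G = mset jl"
        using I(1) pend by (simp add: ac_simps)
      show "map slot_id sl' = map slot_id (slots avail :: 'j slot list)"
        using I(2) unfolding sl sl'_def by simp
    next
      fix q1 i1 p1 own1 b assume s: "(q1, i1, p1, own1) \<in> set sl'" "b \<in> set own1"
      show "q1 \<in> set (snd b)"
        using s(1)[unfolded mem] I(3)[OF memsl s(2)] s(2) assign(2) by auto
    next
      fix q1 i1 p1 own1 assume s: "(q1, i1, p1, own1) \<in> set sl'"
      from s[unfolded mem] show "length own1 = (if p1 = 0 then 0 else 1)"
      proof
        assume "(q1, i1, p1, own1) \<in> set A \<union> set B"
        from I(4)[OF memsl[OF this]] show ?thesis .
      qed simp
    next
      fix q1 i1 p1 own1 b q2 i2 p2 own2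
      assume s1: "(q1, i1, p1, own1) \<in> set sl'" and b: "b \<in> set own1"
        and s2: "(q2, i2, p2, own2) \<in> set sl'" and q2: "q2 \<in> set (snd b)"
      \<comment> \<open>Prices never fall: each slot after the step has an earlier version that was
        no more expensive, and the old bounds are used for that version.\<close>
      from s2[unfolded mem] have "\<exists>p3 own3. (q2, i2, p3, own3) \<in> set sl \<and> p3 \<le> p2"
      proof
        assume "(q2, i2, p2, own2) = (q, i, p + 1, [a])"
        then show ?thesis using assign(1) by (intro exI[of _ p] exI[of _ own]) simp
      next
        assume "(q2, i2, p2, own2) \<in> set A \<union> set B"
        from memsl[OF this] show ?thesis by blast
      qed
      then obtain p3 own3 where s3: "(q2, i2, p3, own3) \<in> set sl" "p3 \<le> p2" by (elim exE conjE) (rule that)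
      from s1[unfolded mem] show "p1 \<le> p2 + 1"
      proof
        assume "(q1, i1, p1, own1) = (q, i, p + 1, [a])"
        then show ?thesis using assign(4)[OF s3(1)] s3(2) b q2 by auto
      next
        assume "(q1, i1, p1, own1) \<in> set A \<union> set B"
        from I(5)[OF memsl[OF this] b s3(1) q2] s3(2) show ?thesis by linarith
      qed
    next
      fix b q1 i1 p1 own1
      assume b: "b \<in> set G" and s1: "(q1, i1, p1, own1) \<in> set sl'" and q1: "q1 \<in> set (snd b)"
      from s1[unfolded mem] show "length sl' < p1" unfolding len
      proof
        assume e: "(q1, i1, p1, own1) = (q, i, p + 1, [a])"
        then have "length sl < p" using I(6)[OF b assign(1)] q1 by simp
        then show "length sl < p1" using e by simp
      next
        assume "(q1, i1, p1, own1) \<in> set A \<union> set B"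
        from I(6)[OF b memsl[OF this] q1] show "length sl < p1" .
      qed
    qed
  qed
qed

lemma length_filter_slots:
  "distinct avail \<Longrightarrow> length (filter (\<lambda>s. fst s \<in> N) (slots avail)) = 2 * card (N \<inter> set avail)"
  by (induction avail) (auto simp: slots_def)

lemma distinct_submset:
  assumes "mset xs \<subseteq># mset ys" "distinct ys" shows "distinct xs"
  unfolding distinct_count_atmost_1
proof
  fix a
  have "count (mset xs) a \<le> count (mset ys) a" using assms(1) by (rule mset_subset_eq_count)
  also have "\<dots> \<le> 1" using assms(2) by (simp add: distinct_count_atmost_1)
  finally show "count (mset xs) a = (if a \<in> set xs then 1 else 0)"
    using count_greater_zero_iff[of "mset xs" a] by (auto simp: not_in_iff simp del: count_greater_zero_iff)
qed

lemma auction_result: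
  fixes jl :: "(nat \<times> int) job list"
  assumes da: "distinct avail" and dj: "distinct (map fst jl)"
  defines "sl \<equiv> fst (snd (auction (jl, slots avail, [])))"
  defines "vio \<equiv> dense sl (snd (snd (auction (jl, slots avail, []))))"
  shows "set vio \<subseteq> set jl"
    and "2 * card {q \<in> set avail. \<exists>b\<in>set vio. q \<in> set (snd b)} \<le> card (fst ` set vio)"
    and "(j, ns) \<in> set jl \<Longrightarrow> j \<notin> fst ` set vio \<Longrightarrow> server sl j r \<in> set ns \<inter> set avail"
    and "card {j \<in> fst ` set jl - fst ` set vio. server sl j (f j) = q} \<le> 2"
proof -
  define m where "m = auction (jl, slots avail, [])"
  obtain n where n: "m = (auction_step ^^ n) (jl, slots avail, [])" "fst m = []"
    unfolding m_def by (rule auction_eq_funpow) blast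
  have "auction_inv jl avail ((auction_step ^^ k) (jl, slots avail, []))" for k
    by (induction k) (simp_all add: auction_inv_init auction_inv_step da)
  then have "auction_inv jl avail m" using n by simp
  moreover obtain G where m: "m = ([], sl, G)" using n(2) unfolding sl_def m_def[symmetric] by (cases m) auto
  ultimately have inv: "auction_inv jl avail ([], sl, G)" by simp
  note I = auction_invD[OF inv]
  have vio: "vio = dense sl G" unfolding vio_def m_def[symmetric] m by simp
  define t where "t = mex (map (\<lambda>s. fst (snd (snd s))) sl)"
  define X where "X = filter (\<lambda>s. t < fst (snd (snd s))) sl"
  have vio': "vio = G @ owners X" unfolding vio dense_def Let_def t_def X_def by simp
  have t: "t \<le> length sl" "\<And>q i p own. (q, i, p, own) \<in> set sl \<Longrightarrow> p \<noteq> t"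
    using mex_props[of "map (\<lambda>s. fst (snd (snd s))) sl"] by (force simp: t_def)+
  have setjl: "set jl = set (owners sl) \<union> set G"
    using arg_cong[OF I(1), of set_mset] by simp
  show sub: "set vio \<subseteq> set jl" unfolding vio' setjl X_def by auto
  have "mset (owners X) \<subseteq># mset (owners sl)"
    unfolding X_def by (induction sl) (auto intro: subset_mset.add_mono subset_mset.order_trans[OF _ mset_subset_eq_add_right])
  then have sm: "mset vio \<subseteq># mset jl" unfolding vio' I(1)[symmetric] by (simp add: add.commute)
  have "distinct (map fst vio)"
    using dj distinct_submset[of "map fst vio" "map fst jl"] image_mset_subseteq_mono[OF sm, of fst] by simp
  then have card_vio: "card (fst ` set vio) = length vio" by (metis distinct_card length_map set_map)
  have high: "t < p" if b: "b \<in> set vio" and s: "(q, i, p, own) \<in> set sl" "q \<in> set (snd b)" for b q i p own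
  proof (cases "b \<in> set G")
    case True
    then show ?thesis using I(6)[OF _ s] t(1) by auto
  next
    case False
    then have "b \<in> set (owners X)" using b by (simp add: vio')
    then obtain q' i' p' own' where s': "(q', i', p', own') \<in> set sl" "t < p'" "b \<in> set own'"
      unfolding X_def by auto
    \<comment> \<open>Slackness loses 1 and gives only \<open>t \<le> p\<close>; strictness comes
      from \<open>t\<close> being nobody's price.\<close>
    have "t \<le> p" using I(5)[OF s'(1,3) s] s'(2) by simp
    then show ?thesis using t(2)[OF s(1)] by simp
  qed
  define N where "N = {q \<in> set avail. \<exists>b\<in>set vio. q \<in> set (snd b)}"
  have fst_sl: "map fst sl = map fst (slots avail :: (nat \<times> int) slot list)"
    using arg_cong[OF I(2), of "map fst"] by (simp add: comp_def)
  have cnt: "length (filter (\<lambda>s. fst s \<in> M) sl) = 2 * card (M \<inter> set avail)" for M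
  proof -
    have "length (filter (\<lambda>s. fst s \<in> M) ys) = length (filter (\<lambda>q. q \<in> M) (map fst ys))"
      for ys :: "(nat \<times> int) slot list" by (induction ys) auto
    then show ?thesis using fst_sl length_filter_slots[OF da, of M] by metis
  qed
  have "2 * card N = length (filter (\<lambda>s. fst s \<in> N) sl)" unfolding cnt by (simp add: N_def Int_def conj_comms)
  also have "\<dots> \<le> length X"
  proof -
    have "filter (\<lambda>s. fst s \<in> N) sl = filter (\<lambda>s. fst s \<in> N) X"
      unfolding X_def filter_filter using high by (intro filter_cong) (auto simp: N_def)
    then show ?thesis by simp
  qed
  also have "length X = length (owners X)"
  proof -
    have "length (snd (snd (snd s))) = 1" if "s \<in> set X" for s
    proof -
      obtain q i p own where s: "s = (q, i, p, own)" by (cases s) blast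
      have "s \<in> set sl" "t < p" using \<open>s \<in> set X\<close> s by (simp_all add: X_def)
      then show ?thesis using I(4)[of q i p own] s by simp
    qed
    then show ?thesis by (induction X) auto
  qed
  also have "\<dots> \<le> card (fst ` set vio)" unfolding card_vio by (simp add: vio')
  finally show "2 * card {q \<in> set avail. \<exists>b\<in>set vio. q \<in> set (snd b)} \<le> card (fst ` set vio)"
    by (simp add: N_def)
  have srv: "\<exists>i p own. (server sl j r, i, p, own) \<in> set sl \<and> b \<in> set own"
    if b: "b \<in> set jl" "b \<notin> set vio" "fst b = j" for b j r
  proof -
    have "b \<in> set (owners sl)" using b setjl by (auto simp: vio')
    then obtain s where s: "s \<in> set sl" "b \<in> set (snd (snd (snd s)))" by auto
    from server_cases[of sl j r]
    have "\<exists>(q, i, p, own)\<in>set sl. \<exists>jb\<in>set own. fst jb = j \<and> server sl j r = q"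
    proof
      assume "server sl j r = r \<and> (\<forall>(q, i, p, own)\<in>set sl. \<forall>jb\<in>set own. fst jb \<noteq> j)"
      then have "case s of (q, i, p, own) \<Rightarrow> \<forall>jb\<in>set own. fst jb \<noteq> j" using s(1) by blast
      then have False using s(2) b(3) by (simp add: case_prod_unfold)
      then show ?thesis ..
    qed
    then obtain s' jb where s': "s' \<in> set sl" "jb \<in> set (snd (snd (snd s')))" "fst jb = j" "server sl j r = fst s'"
      unfolding case_prod_unfold by (elim bexE conjE) (rule that)
    obtain q i p own where q': "s' = (q, i, p, own)" by (cases s') (rule that)
    have q: "(q, i, p, own) \<in> set sl" "jb \<in> set own" "fst jb = j" "server sl j r = q" using s' q' by simp_all
    have "jb \<in> set (owners sl)" using s'(1,2) by auto
    then have "jb \<in> set jl" using setjl by blast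
    moreover have "inj_on fst (set jl)" using dj by (simp add: distinct_map)
    ultimately have "jb = b" using b(1,3) q(3) by (auto dest: inj_onD)
    then have "(server sl j r, i, p, own) \<in> set sl \<and> b \<in> set own" using q by simp
    then show ?thesis by (intro exI)
  qed
  have novio: "b \<notin> set vio" if "fst b \<notin> fst ` set vio" for b using that by auto
  show "server sl j r \<in> set ns \<inter> set avail" if j: "(j, ns) \<in> set jl" "j \<notin> fst ` set vio"
  proof -
    obtain i p own where s: "(server sl j r, i, p, own) \<in> set sl" "(j, ns) \<in> set own"
      using srv[OF j(1) novio, of j r] j(2) by (simp, elim exE conjE) (rule that)
    have "server sl j r \<in> set (map fst (slots avail :: (nat \<times> int) slot list))"
      unfolding fst_sl[symmetric] using s(1) by force
    then have "server sl j r \<in> set avail" by (auto simp: slots_def)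
    then show ?thesis using I(3)[OF s] by simp
  qed
  show "card {j \<in> fst ` set jl - fst ` set vio. server sl j (f j) = q} \<le> 2"
  proof -
    let ?Y = "filter (\<lambda>s. fst s \<in> {q}) sl"
    have "{j \<in> fst ` set jl - fst ` set vio. server sl j (f j) = q} \<subseteq> set (map fst (owners ?Y))"
    proof clarsimp
      fix r a ns assume j: "((r, a), ns) \<in> set jl" "(r, a) \<notin> fst ` set vio" "q = server sl (r, a) (f (r, a))"
      obtain i p own where s: "(server sl (r, a) (f (r, a)), i, p, own) \<in> set sl" "((r, a), ns) \<in> set own"
        using srv[OF j(1) novio, of "(r, a)" "f (r, a)"] j(2) by (simp, elim exE conjE) (rule that)
      then show "(r, a) \<in> fst ` (\<Union>x\<in>{x \<in> set sl. fst x = server sl (r, a) (f (r, a))}. set (snd (snd (snd x))))"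
        by force
    qed
    then have "card {j \<in> fst ` set jl - fst ` set vio. server sl j (f j) = q} \<le> card (set (map fst (owners ?Y)))"
      by (rule card_mono[rotated]) simp
    also have "\<dots> \<le> length (owners ?Y)" using card_length[of "map fst (owners ?Y)"] by simp
    also have "\<dots> \<le> length ?Y"
    proof -
      have "length (snd (snd (snd s))) \<le> 1" if "s \<in> set sl" for s
      proof -
        obtain q i p own where s: "s = (q, i, p, own)" by (cases s) blast
        then show ?thesis using I(4)[of q i p own] \<open>s \<in> set sl\<close> by (simp split: if_splits)
      qed
      then have "length (owners (filter P sl)) \<le> length (filter P sl)" for P
        by (induction sl) fastforce+
      then show ?thesis .
    qed
    also have "\<dots> \<le> 2" unfolding cnt using card_mono[of "{q}" "{q} \<inter> set avail"] by simp
    finally show ?thesis .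
  qed
qed

section \<open>Assigning the points level by level\<close>

lemma card_UN_list: "finite (\<Union>x\<in>set xs. f x) \<Longrightarrow> card (\<Union>x\<in>set xs. f x) \<le> (\<Sum>x\<leftarrow>xs. card (f x))"
proof (induction xs)
  case (Cons x xs)
  have "card (f x \<union> (\<Union>x\<in>set xs. f x)) \<le> card (f x) + card (\<Union>x\<in>set xs. f x)" by (rule card_Un_le)
  with Cons show ?case by fastforce
qed simp

lemma sum_list_sum_swap:
  fixes g :: "'x \<Rightarrow> 'y \<Rightarrow> int"
  shows "(\<Sum>e\<leftarrow>xs. \<Sum>v\<in>A. g e v) = (\<Sum>v\<in>A. \<Sum>e\<leftarrow>xs. g e v)"
  by (induction xs) (simp_all add: sum.distrib)

lemma sum_UN_le:
  fixes f :: "'x \<Rightarrow> int"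
  assumes "finite I" "\<And>i. i \<in> I \<Longrightarrow> finite (A i)" "\<And>i x. i \<in> I \<Longrightarrow> x \<in> A i \<Longrightarrow> 0 \<le> f x"
  shows "sum f (\<Union>i\<in>I. A i) \<le> (\<Sum>i\<in>I. sum f (A i))"
  using assms
proof (induction I rule: finite_induct)
  case (insert i I)
  have "sum f (A i \<union> (\<Union>i\<in>I. A i)) + sum f (A i \<inter> (\<Union>i\<in>I. A i)) = sum f (A i) + sum f (\<Union>i\<in>I. A i)"
    using insert by (intro sum.union_inter) auto
  moreover have "0 \<le> sum f (A i \<inter> (\<Union>i\<in>I. A i))" using insert.prems by (intro sum_nonneg) auto
  moreover have "sum f (\<Union>i\<in>I. A i) \<le> (\<Sum>i\<in>I. sum f (A i))"
    using insert.prems by (intro insert.IH) blast+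
  ultimately show ?case using insert.hyps by simp
qed simp

text \<open>\<open>X q\<close> and \<open>W q\<close> stand for the vertex set and the weight of the tree of depot \<open>q\<close> in an
  arbitrary tree cover.\<close>

locale cover = tours +
  fixes X :: "nat \<Rightarrow> nat set" and W :: "nat \<Rightarrow> int"
  assumes X_sub: "\<And>q. q \<in> D \<Longrightarrow> X q \<subseteq> V"
    and X_cover: "\<And>v. v \<in> V \<Longrightarrow> \<exists>q\<in>D. v \<in> X q"
    and X_near: "\<And>q v. q \<in> D \<Longrightarrow> v \<in> X q \<Longrightarrow> w q v \<le> W q"
    and X_mass: "\<And>q A. q \<in> D \<Longrightarrow> A \<subseteq> X q \<Longrightarrow> (\<Sum>v\<in>A - D. ell v) \<le> W q"
begin

section \<open>Length of intervals against an arbitrary cover\<close>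

lemma W_nonneg: "q \<in> D \<Longrightarrow> 0 \<le> W q"
  using X_mass[of q "{}"] by simp

lemma st_entry:
  assumes "(y, c, l, P, r) \<in> set st" "0 < P"
  shows "l \<noteq> 0" "c \<in> V - D" "l = ell c" "w c y \<le> l" "0 < l"
proof -
  show l: "l \<noteq> 0" using st_start[of y c P r] assms by auto
  show "c \<in> V - D" "l = ell c" "w c y \<le> l" "0 < l"
    using st_tree[OF assms(1) l] st_mem[OF assms(1)] by auto
qed

lemma ell_nonneg:
  assumes "v \<in> V - D" shows "0 \<le> ell v"
proof -
  have "v \<in> fst ` set (filter (\<lambda>(y, c, l, P, r). y = c \<and> l \<noteq> 0) st)" using st_down(2) assms by simp
  then obtain y c l P r where e: "(y, c, l, P, r) \<in> set st" "y = c" "l \<noteq> 0" "v = y" by auto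
  from st_tree[OF e(1,3)] e show ?thesis by auto
qed

text \<open>The points whose greedy edges are traversed inside an interval of \<open>Y\<close>.
  Their edge lengths pay for the intervals.\<close>

definition touched :: "(nat \<times> int \<times> int) set \<Rightarrow> nat set" where
  "touched Y = {c. \<exists>r a K y l P. (r, a, K) \<in> Y \<and> (y, c, l, P, r) \<in> set st \<and> a < P \<and> P - l < a + K}"

text \<open>Intervals of the same tour are disjoint, and each lies entirely within its tour, so
  their lengths may be added up.\<close>

definition spread :: "(nat \<times> int \<times> int) set \<Rightarrow> bool" where
  "spread Y \<longleftrightarrow> finite Y \<and> (\<forall>r a K. (r, a, K) \<in> Y \<longrightarrow> 0 \<le> a \<and> 0 < K \<and> full st K r a) \<and>
     (\<forall>r a K a' K'. (r, a, K) \<in> Y \<longrightarrow> (r, a', K') \<in> Y \<longrightarrow> a = a' \<and> K = K' \<or> a + K \<le> a' \<or> a' + K' \<le> a)"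

lemma touched_sub: assumes "spread Y" shows "touched Y \<subseteq> V - D"
proof
  fix c assume "c \<in> touched Y"
  then obtain r a K y l P where e: "(r, a, K) \<in> Y" "(y, c, l, P, r) \<in> set st" "a < P"
    unfolding touched_def by blast
  have "0 \<le> a" using assms e(1) unfolding spread_def by blast
  then show "c \<in> V - D" using st_entry(2)[OF e(2)] e(3) by simp
qed

text \<open>The unit cells of the intervals are covered by tour steps, and each tree edge is traversed
  only twice.\<close>

lemma spread_mass:
  assumes Y: "spread Y"
  shows "(\<Sum>(r, a, K)\<in>Y. K) \<le> 2 * (\<Sum>v\<in>touched Y. ell v)"
proof -
  let ?A = "touched Y"
  have fA: "finite ?A" using touched_sub[OF Y] finV finite_subset by blast
  define cells where "cells x = (case x of (r, a, K) \<Rightarrow> {r::nat} \<times> {a..<a + K::int})" for x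
  define steps where "steps e = (case e of (y::nat, c, l, P, r) \<Rightarrow> if c \<in> ?A then {r::nat} \<times> {P - l..<P::int} else {})" for e
  have finY: "finite Y" using Y by (simp add: spread_def)
  have posK: "0 \<le> a" "0 < K" "full st K r a" if "(r, a, K) \<in> Y" for r a K
    using Y that unfolding spread_def by blast+
  have dis: "a = a' \<and> K = K' \<or> a + K \<le> a' \<or> a' + K' \<le> a" if "(r, a, K) \<in> Y" "(r, a', K') \<in> Y" for r a K a' K'
    using Y that unfolding spread_def by blast
  have "int (card (\<Union>x\<in>Y. cells x)) = (\<Sum>x\<in>Y. int (card (cells x)))"
  proof -
    have "card (\<Union>x\<in>Y. cells x) = (\<Sum>x\<in>Y. card (cells x))"
    proof (rule card_UN_disjoint)
      show "\<forall>x\<in>Y. finite (cells x)" by (auto simp: cells_def)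
      show "\<forall>x\<in>Y. \<forall>y\<in>Y. x \<noteq> y \<longrightarrow> cells x \<inter> cells y = {}"
      proof (intro ballI impI)
        fix x y assume xy: "x \<in> Y" "y \<in> Y" "x \<noteq> y"
        obtain r a K r' a' K' where e: "x = (r, a, K)" "y = (r', a', K')" by (cases x; cases y) blast
        show "cells x \<inter> cells y = {}"
        proof (cases "r = r'")
          case True
          then show ?thesis using dis[of r a K a' K'] xy e by (auto simp: cells_def)
        qed (auto simp: cells_def e)
      qed
    qed (rule finY)
    then show ?thesis by simp
  qed
  also have "\<dots> = (\<Sum>(r, a, K)\<in>Y. K)"
    using posK(2) by (intro sum.cong) (auto simp: cells_def less_imp_le)
  finally have 1: "(\<Sum>(r, a, K)\<in>Y. K) = int (card (\<Union>x\<in>Y. cells x))" by simp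
  have fin: "finite (\<Union>e\<in>set st. steps e)" by (auto simp: steps_def split: prod.splits)
  have "(\<Union>x\<in>Y. cells x) \<subseteq> (\<Union>e\<in>set st. steps e)"
  proof
    fix z assume "z \<in> (\<Union>x\<in>Y. cells x)"
    then obtain r a K t where z: "(r, a, K) \<in> Y" "z = (r, t)" "a \<le> t" "t < a + K" by (auto simp: cells_def)
    obtain y c l P where e: "(y, c, l, P, r) \<in> set st" "a + K \<le> P"
      using posK(3)[OF z(1)] by (auto simp: full_def list_ex_iff)
    have "\<exists>y' c' l' P'. (y', c', l', P', r) \<in> set st \<and> P' - l' \<le> t \<and> t < P'"
      by (rule st_cell[OF e(1)]) (use z posK(1)[OF z(1)] e(2) in auto)
    then obtain y' c' l' P' where e': "(y', c', l', P', r) \<in> set st" "P' - l' \<le> t" "t < P'" by blast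
    have "c' \<in> ?A" unfolding touched_def using z e' by fastforce
    then show "z \<in> (\<Union>e\<in>set st. steps e)" using e' z(2)
      by (intro UN_I[of "(y', c', l', P', r)"]) (auto simp: steps_def)
  qed
  then have "card (\<Union>x\<in>Y. cells x) \<le> (\<Sum>e\<leftarrow>st. card (steps e))"
    using card_UN_list[OF fin] card_mono[OF fin] order_trans by blast
  then have "int (card (\<Union>x\<in>Y. cells x)) \<le> int (\<Sum>e\<leftarrow>st. card (steps e))" by simp
  also have "\<dots> = (\<Sum>e\<leftarrow>st. int (card (steps e)))" by (induction st) auto
  \<comment> \<open>A step of length \<open>l\<close> covers \<open>l\<close> cells and is charged
    to its child \<open>c\<close>; after the sums are swapped, each \<open>v\<close> collects the
    lengths of the traversals of its edge.\<close>
  also have "\<dots> = (\<Sum>e\<leftarrow>st. \<Sum>v\<in>?A. case e of (y, c, l, P, r) \<Rightarrow> if c = v then l else 0)"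
  proof (intro arg_cong[of _ _ sum_list] map_cong refl)
    fix e assume e: "e \<in> set st"
    obtain y c l P r where ee: "e = (y, c, l, P, r)" by (cases e) blast
    have "0 \<le> l" using st_tree[of y c l P r] e ee by (cases "l = 0") auto
    then show "int (card (steps e)) = (\<Sum>v\<in>?A. case e of (y, c, l, P, r) \<Rightarrow> if c = v then l else 0)"
      using fA by (simp add: ee steps_def)
  qed
  also have "\<dots> = (\<Sum>v\<in>?A. \<Sum>(y, c, l, P, r)\<leftarrow>st. if c = v then l else 0)"
    by (rule sum_list_sum_swap)
  also have "\<dots> \<le> (\<Sum>v\<in>?A. 2 * ell v)"
    using st_mass touched_sub[OF Y] by (intro sum_mono) blast
  finally show ?thesis using 1 by (simp add: sum_distrib_left)
qed

text \<open>Every point lies in some tree of the cover, and a tree weighs at least as much as the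
  greedy edges of its points.\<close>

lemma touched_weight:
  assumes A: "A \<subseteq> V - D"
  shows "(\<Sum>v\<in>A. ell v) \<le> (\<Sum>q | q \<in> D \<and> A \<inter> X q \<noteq> {}. W q)"
proof -
  have fA: "finite A" using A finV finite_subset by blast
  let ?D = "{q. q \<in> D \<and> A \<inter> X q \<noteq> {}}"
  have fD: "finite ?D" using finD by simp
  have "A = (\<Union>q\<in>?D. A \<inter> X q)"
  proof (intro equalityI subsetI)
    fix v assume v: "v \<in> A"
    then have "v \<in> V" using A by blast
    from X_cover[OF this] obtain q where "q \<in> D" "v \<in> X q" by (elim bexE) (rule that)
    then show "v \<in> (\<Union>q\<in>?D. A \<inter> X q)" using v by (intro UN_I[of q]) auto
  qed simp
  then have "(\<Sum>v\<in>A. ell v) = (\<Sum>v\<in>(\<Union>q\<in>?D. A \<inter> X q). ell v)" by simp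
  also have "\<dots> \<le> (\<Sum>q\<in>?D. \<Sum>v\<in>A \<inter> X q. ell v)"
    using fD fA ell_nonneg A by (intro sum_UN_le) auto
  also have "\<dots> \<le> (\<Sum>q\<in>?D. W q)"
  proof (rule sum_mono)
    fix q assume "q \<in> ?D"
    moreover have "A \<inter> X q - D = A \<inter> X q" using A by blast
    ultimately show "(\<Sum>v\<in>A \<inter> X q. ell v) \<le> W q" using X_mass[of q "A \<inter> X q"] by simp
  qed
  finally show ?thesis .
qed

lemma spread_total:
  assumes Y: "spread Y" shows "(\<Sum>(r, a, K)\<in>Y. K) \<le> 2 * (\<Sum>q\<in>D. W q)"
proof -
  have "(\<Sum>q | q \<in> D \<and> touched Y \<inter> X q \<noteq> {}. W q) \<le> (\<Sum>q\<in>D. W q)"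
    using finD W_nonneg by (intro sum_mono2) auto
  then show ?thesis using spread_mass[OF Y] touched_weight[OF touched_sub[OF Y]] by linarith
qed

text \<open>A light tree that meets the intervals belongs to a nearby depot, hence to one of the few
  depots in \<open>B\<close>; so about half of the mass of the intervals is on heavy trees.\<close>

lemma spread_heavy:
  assumes Y: "spread Y" and B: "finite B" "2 * L * int (card B) \<le> (\<Sum>(r, a, K)\<in>Y. K)"
    and near: "\<And>c q. c \<in> touched Y \<Longrightarrow> q \<in> D \<Longrightarrow> w q c \<le> L \<Longrightarrow> q \<in> B"
  shows "(\<Sum>(r, a, K)\<in>Y. K) \<le> 4 * (\<Sum>q | q \<in> D \<and> L < 2 * W q. W q)"
proof -
  let ?D = "{q. q \<in> D \<and> touched Y \<inter> X q \<noteq> {}}" and ?H = "{q. q \<in> D \<and> L < 2 * W q}"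
  have fin: "finite ?D" "finite ?H" using finD by simp_all
  have "?D - ?H \<subseteq> B"
  proof
    fix q assume q: "q \<in> ?D - ?H"
    then obtain c where c: "c \<in> touched Y" "c \<in> X q" "q \<in> D" by blast
    have "w q c \<le> W q" "0 \<le> W q" using X_near[OF c(3,2)] W_nonneg[OF c(3)] by auto
    then have "w q c \<le> L" using q by auto
    then show "q \<in> B" using near c by blast
  qed
  then have card: "card (?D - ?H) \<le> card B" using B(1) card_mono by blast
  have "(\<Sum>q\<in>?D. W q) = (\<Sum>q\<in>?D - ?H. W q) + (\<Sum>q\<in>?D \<inter> ?H. W q)"
    using fin sum.Int_Diff[of ?D W ?H] by simp
  also have "(\<Sum>q\<in>?D \<inter> ?H. W q) \<le> (\<Sum>q\<in>?H. W q)"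
    using fin W_nonneg by (intro sum_mono2) auto
  finally have 1: "(\<Sum>q\<in>?D. W q) \<le> (\<Sum>q\<in>?D - ?H. W q) + (\<Sum>q\<in>?H. W q)" by simp
  have "2 * (\<Sum>q\<in>?D - ?H. W q) = (\<Sum>q\<in>?D - ?H. 2 * W q)" by (simp add: sum_distrib_left)
  also have "\<dots> \<le> (\<Sum>q\<in>?D - ?H. L)" by (intro sum_mono) auto
  also have "\<dots> = L * int (card (?D - ?H))" by simp
  finally have 2: "2 * (\<Sum>q\<in>?D - ?H. W q) \<le> L * int (card (?D - ?H))" .
  have nonneg: "0 \<le> (\<Sum>(r, a, K)\<in>Y. K)"
    using Y unfolding spread_def by (intro sum_nonneg) fastforce
  \<comment> \<open>At most \<open>card B\<close> light trees of weight at most \<open>L / 2\<close>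
    each, against a total length of at least \<open>2 * L * card B\<close>: they weigh at most a
    quarter of it.\<close>
  have "4 * (\<Sum>q\<in>?D - ?H. W q) \<le> (\<Sum>(r, a, K)\<in>Y. K)"
  proof (cases "0 \<le> L")
    case True
    then have "L * int (card (?D - ?H)) \<le> L * int (card B)"
      using card by (intro mult_left_mono) auto
    then show ?thesis using 2 B(2) by linarith
  next
    case False
    have "?D - ?H = {}"
    proof (rule equals0I)
      fix q assume "q \<in> ?D - ?H"
      then have "q \<in> D" "\<not> L < 2 * W q" by auto
      then show False using W_nonneg[of q] False by linarith
    qed
    then show ?thesis using nonneg by (simp only: sum.empty mult_zero_right)
  qed
  \<comment> \<open>The total length is at most \<open>2 * (light + heavy)\<close>, hence at most
    half of itself plus \<open>2 * heavy\<close>.\<close>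
  then show ?thesis
    using 1 spread_mass[OF Y] touched_weight[OF touched_sub[OF Y]] by linarith
qed

end

section \<open>The state kept between levels\<close>

lemma in_set_mapI: "y \<in> set xs \<Longrightarrow> x = f y \<Longrightarrow> x \<in> set (map f xs)"
  by simp

lemma fullI: "(y, c, l, P, r) \<in> set st \<Longrightarrow> a + L \<le> P \<Longrightarrow> full st L r a"
  unfolding full_def list_ex_iff by (rule bexI[of _ "(y, c, l, P, r)"]) simp_all

text \<open>A depot serves 2 intervals won in the auction and the unfinished end of its own tour,
  hence 3. An interval frozen with length \<open>K\<close> was assigned at level \<open>2 K\<close>,
  where the distance bound is \<open>4 * (2 K)\<close> and where each of the 3 intervals had two
  halves, hence \<open>8 * K\<close> and 6. The conditions on \<open>bl\<close> refer to all
  intervals frozen so far, and \<open>heavy\<close> records the comparison with the cover for every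
  threshold already passed.\<close>

locale level_state = cover +
  fixes ds :: "nat list" and L :: int and rs :: "rec list" and bl :: "nat list"
  assumes ds: "set ds = D" "distinct ds"
    and L_pow: "\<exists>j. L = 2 ^ j"
    and points: "map (\<lambda>(v, P, r, a, K, q, act). (v, P, r)) rs =
      map (\<lambda>(y, c, l, P, r). (y, P, r)) (filter (\<lambda>(y, c, l, P, r). y = c \<and> l \<noteq> 0) st)"
    and rec: "\<And>v P r a K q act. (v, P, r, a, K, q, act) \<in> set rs \<Longrightarrow>
      0 \<le> a \<and> a < P \<and> P \<le> a + K \<and> K dvd a \<and> q \<in> D \<and> w q v \<le> 8 * K \<and> (\<exists>i. K = 2 ^ i) \<and> L \<le> K"
    and active: "\<And>v P r a K q. (v, P, r, a, K, q, True) \<in> set rs \<Longrightarrow> K = L \<and> w q v \<le> 4 * L"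
    and frozen: "\<And>v P r a K q. (v, P, r, a, K, q, False) \<in> set rs \<Longrightarrow> full st K r a"
    and labels: "\<And>v P r a K q act v' P' a' K' q' act'. (v, P, r, a, K, q, act) \<in> set rs \<Longrightarrow>
      (v', P', r, a', K', q', act') \<in> set rs \<Longrightarrow>
      a = a' \<and> K = K' \<and> q = q' \<and> act = act' \<or> a + K \<le> a' \<or> a' + K' \<le> a"
    and count_active: "\<And>q. card {(r, a). \<exists>v P K. (v, P, r, a, K, q, True) \<in> set rs} \<le> 3"
    and count_frozen: "\<And>q K. card {(r, a). \<exists>v P. (v, P, r, a, K, q, False) \<in> set rs} \<le> 6"
    and bl: "distinct bl" "set bl \<subseteq> D"
    and bl_card: "2 * L * int (card (set bl)) \<le>
      (\<Sum>(r, a, K)\<in>{(r, a, K). \<exists>v P q. (v, P, r, a, K, q, False) \<in> set rs}. K)"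
    and bl_near: "\<And>v P r a K q q' y c l P'. (v, P, r, a, K, q, False) \<in> set rs \<Longrightarrow>
      (y, c, l, P', r) \<in> set st \<Longrightarrow> a < P' \<Longrightarrow> P' - l < a + K \<Longrightarrow> q' \<in> D \<Longrightarrow> w q' c \<le> L \<Longrightarrow> q' \<in> set bl"
    and heavy: "\<And>i. L \<le> 2 ^ i \<Longrightarrow>
      (\<Sum>(r, a, K)\<in>{(r, a, K). 2 ^ i \<le> K \<and> (\<exists>v P q. (v, P, r, a, K, q, False) \<in> set rs)}. K)
        \<le> 4 * (\<Sum>q | q \<in> D \<and> 2 ^ i < 2 * W q. W q)"
begin

lemma rec_entry:
  assumes "(v, P, r, a, K, q, act) \<in> set rs"
  shows "\<exists>l. (v, v, l, P, r) \<in> set st"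
proof -
  have "(v, P, r) \<in> set (map (\<lambda>(v, P, r, a, K, q, act). (v, P, r)) rs)"
    by (rule in_set_mapI[OF assms]) simp
  then show ?thesis unfolding points by auto
qed

end

section \<open>One refinement step preserves the state\<close>

locale level_refinement = level_state +
  fixes M :: int
  assumes L2: "L = 2 * M"
begin

definition "refined = refine M rs"
definition "free_depots = filter (\<lambda>q. q \<notin> set bl) ds"
definition "offers = map (\<lambda>j. (j, nbs w st M free_depots j)) (jobs st M refined)"
definition "market = auction (offers, slots free_depots, [])"
definition "matched_slots = fst (snd market)"
definition "violators = dense matched_slots (snd (snd market))"
definition "violating_jobs = fst ` set violators"
definition "next_recs = reassign st M matched_slots (map fst violators) refined"
definition "crowded = {q \<in> set free_depots. \<exists>b\<in>set violators. q \<in> set (snd b)}"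
definition "next_blocked = bl @ filter (\<lambda>q. list_ex (\<lambda>jb. q \<in> set (snd jb)) violators) free_depots"

lemma level_step_eq: "level_step w ds st (rs, bl) M = (next_recs, next_blocked)"
  by (simp add: level_step_def Let_def next_recs_def next_blocked_def refined_def free_depots_def offers_def market_def matched_slots_def violators_def)

lemma M_pow: "\<exists>j. M = 2 ^ j"
proof -
  obtain j where j: "L = 2 ^ j" using L_pow by blast
  then obtain i where "j = Suc i" using L2 by (cases j) (auto, presburger)
  then show ?thesis using j L2 by auto
qed

lemma M_pos: "0 < M"
  using M_pow by auto

lemma refined_mem:
  "(v, P, r, a, K, q, True) \<in> set refined \<longleftrightarrow>
    (\<exists>a0. (v, P, r, a0, L, q, True) \<in> set rs \<and> a = (if a0 + M < P then a0 + M else a0) \<and> K = M)"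
  "(v, P, r, a, K, q, False) \<in> set refined \<longleftrightarrow> (v, P, r, a, K, q, False) \<in> set rs"
proof -
  show "(v, P, r, a, K, q, False) \<in> set refined \<longleftrightarrow> (v, P, r, a, K, q, False) \<in> set rs"
    unfolding refined_def refine_def by (force split: if_splits)
  show "(v, P, r, a, K, q, True) \<in> set refined \<longleftrightarrow>
    (\<exists>a0. (v, P, r, a0, L, q, True) \<in> set rs \<and> a = (if a0 + M < P then a0 + M else a0) \<and> K = M)"
  proof
    assume "(v, P, r, a, K, q, True) \<in> set refined"
    then obtain a0 K0 where e: "(v, P, r, a0, K0, q, True) \<in> set rs" "a = (if a0 + M < P then a0 + M else a0)" "K = M"
      unfolding refined_def refine_def by (force split: if_splits)
    then show "\<exists>a0. (v, P, r, a0, L, q, True) \<in> set rs \<and> a = (if a0 + M < P then a0 + M else a0) \<and> K = M"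
      using active[OF e(1)] by blast
  next
    assume "\<exists>a0. (v, P, r, a0, L, q, True) \<in> set rs \<and> a = (if a0 + M < P then a0 + M else a0) \<and> K = M"
    then obtain a0 where "(v, P, r, a0, L, q, True) \<in> set rs" "a = (if a0 + M < P then a0 + M else a0)" "K = M" by blast
    then show "(v, P, r, a, K, q, True) \<in> set refined"
      unfolding refined_def refine_def by force
  qed
qed

lemma refined_active:
  assumes "(v, P, r, a, K, q, True) \<in> set refined"
  shows "K = M" "0 \<le> a" "a < P" "P \<le> a + M" "M dvd a" "q \<in> D" "w q v \<le> 4 * L"
    "\<exists>a0. (v, P, r, a0, L, q, True) \<in> set rs \<and> (a = a0 \<or> a = a0 + M)"
proof -
  obtain a0 where e: "(v, P, r, a0, L, q, True) \<in> set rs" "a = (if a0 + M < P then a0 + M else a0)" "K = M"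
    using assms refined_mem(1) by blast
  note R = rec[OF e(1)]
  show "K = M" by (rule e)
  show "0 \<le> a" "a < P" "P \<le> a + M" using R e(2) L2 M_pos by (auto split: if_splits)
  have "M dvd a0" using R L2 by (metis dvd_mult_right)
  then show "M dvd a" using e(2) by simp
  show "q \<in> D" "w q v \<le> 4 * L" using R active[OF e(1)] by auto
  show "\<exists>a0. (v, P, r, a0, L, q, True) \<in> set rs \<and> (a = a0 \<or> a = a0 + M)"
    using e by (auto split: if_splits)
qed

lemma jobs_mem: "(r, a) \<in> set (jobs st M refined) \<longleftrightarrow>
    full st M r a \<and> (\<exists>v P K q. (v, P, r, a, K, q, True) \<in> set refined)"
  unfolding jobs_def by (force simp: image_iff)

lemma distinct_jobs: "distinct (jobs st M refined)"
  by (simp add: jobs_def)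

lemma map_fst_offers: "map fst offers = jobs st M refined"
  by (simp add: offers_def comp_def)

lemma violating_jobs_sub: "violating_jobs \<subseteq> set (jobs st M refined)"
proof -
  have "set violators \<subseteq> set offers"
    unfolding violators_def matched_slots_def market_def
    by (rule auction_result(1)) (use ds map_fst_offers distinct_jobs in \<open>auto simp: free_depots_def\<close>)
  then have "violating_jobs \<subseteq> fst ` set offers" unfolding violating_jobs_def by blast
  also have "fst ` set offers = set (jobs st M refined)" using map_fst_offers by (metis set_map)
  finally show ?thesis .
qed

lemma card_crowded: "2 * card crowded \<le> card violating_jobs"
  unfolding crowded_def violating_jobs_def violators_def matched_slots_def market_def
  by (rule auction_result(2)) (use ds map_fst_offers distinct_jobs in \<open>auto simp: free_depots_def\<close>)

lemma server_nbs:
  assumes "j \<in> set (jobs st M refined)" "j \<notin> violating_jobs"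
  shows "server matched_slots j r \<in> set (nbs w st M free_depots j)" "server matched_slots j r \<in> set free_depots"
proof -
  have "(j, nbs w st M free_depots j) \<in> set offers" using assms(1) by (simp add: offers_def)
  then have "server matched_slots j r \<in> set (nbs w st M free_depots j) \<inter> set free_depots"
    using assms(2) unfolding violating_jobs_def violators_def matched_slots_def market_def
    by (intro auction_result(3)) (use ds map_fst_offers distinct_jobs in \<open>auto simp: free_depots_def\<close>)
  then show "server matched_slots j r \<in> set (nbs w st M free_depots j)" "server matched_slots j r \<in> set free_depots" by auto
qed

lemma server_count: "card {j \<in> set (jobs st M refined) - violating_jobs. server matched_slots j (fst j) = q} \<le> 2"
proof -
  have "set (jobs st M refined) = fst ` set offers" using map_fst_offers by (metis set_map)
  then show ?thesis
    unfolding violating_jobs_def violators_def matched_slots_def market_def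
    using auction_result(4)[of free_depots offers fst q] ds map_fst_offers distinct_jobs by (simp add: free_depots_def)
qed

lemma violators_nbs: "b \<in> set violators \<Longrightarrow> snd b = nbs w st M free_depots (fst b)"
proof -
  have "set violators \<subseteq> set offers"
    unfolding violators_def matched_slots_def market_def
    by (rule auction_result(1)) (use ds map_fst_offers distinct_jobs in \<open>auto simp: free_depots_def\<close>)
  then show "b \<in> set violators \<Longrightarrow> snd b = nbs w st M free_depots (fst b)" by (auto simp: offers_def)
qed

lemma next_recs_cases:
  assumes "(v, P, r, a, K, q, act) \<in> set next_recs"
  obtains (old) "\<not> act" "(v, P, r, a, K, q, False) \<in> set rs"
  | (partial) q0 where "act" "(v, P, r, a, M, q0, True) \<in> set refined" "\<not> full st M r a" "q = r" "K = M"
  | (freeze) "\<not> act" "(v, P, r, a, M, q, True) \<in> set refined" "full st M r a" "(r, a) \<in> violating_jobs" "K = M"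
  | (serve) q0 where "act" "(v, P, r, a, M, q0, True) \<in> set refined" "full st M r a" "(r, a) \<notin> violating_jobs"
      "q = server matched_slots (r, a) r" "K = M" "(r, a) \<in> set (jobs st M refined)"
proof -
  obtain v0 P0 r0 a0 K0 q0 act0 where e0: "(v0, P0, r0, a0, K0, q0, act0) \<in> set refined"
    "(v, P, r, a, K, q, act) = (if \<not> act0 then (v0, P0, r0, a0, K0, q0, act0)
     else if \<not> full st M r0 a0 then (v0, P0, r0, a0, K0, r0, True)
     else if (r0, a0) \<in> violating_jobs then (v0, P0, r0, a0, K0, q0, False)
     else (v0, P0, r0, a0, K0, server matched_slots (r0, a0) r0, True))"
    using assms unfolding next_recs_def reassign_def violating_jobs_def by auto
  show thesis
  proof (cases act0)
    case False
    then show thesis using e0 refined_mem(2) old by simp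
  next
    case True
    with e0(1) have e1': "(v0, P0, r0, a0, K0, q0, True) \<in> set refined" by simp
    have K0: "K0 = M" by (rule refined_active(1)[OF e1'])
    have e1: "(v0, P0, r0, a0, M, q0, True) \<in> set refined" "K0 = M" using e1' K0 by simp_all
    show thesis
    proof (cases "full st M r0 a0")
      case False
      then show thesis using e0(2) e1 True partial by simp
    next
      case full: True
      then have "(r0, a0) \<in> set (jobs st M refined)" using e1 jobs_mem by blast
      then show thesis using e0(2) e1 True full freeze serve by (cases "(r0, a0) \<in> violating_jobs") simp_all
    qed
  qed
qed

lemma next_recs_frozen: "(v, P, r, a, K, q, False) \<in> set next_recs \<longleftrightarrow>
    (v, P, r, a, K, q, False) \<in> set rs \<or> (r, a) \<in> violating_jobs \<and> K = M \<and> (v, P, r, a, M, q, True) \<in> set refined"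
proof
  assume "(v, P, r, a, K, q, False) \<in> set next_recs"
  then show "(v, P, r, a, K, q, False) \<in> set rs \<or> (r, a) \<in> violating_jobs \<and> K = M \<and> (v, P, r, a, M, q, True) \<in> set refined"
    by (cases rule: next_recs_cases) auto
next
  assume "(v, P, r, a, K, q, False) \<in> set rs \<or> (r, a) \<in> violating_jobs \<and> K = M \<and> (v, P, r, a, M, q, True) \<in> set refined"
  then show "(v, P, r, a, K, q, False) \<in> set next_recs"
  proof
    assume "(v, P, r, a, K, q, False) \<in> set rs"
    then have "(v, P, r, a, K, q, False) \<in> set refined" unfolding refined_mem(2) .
    then show ?thesis unfolding next_recs_def reassign_def by (rule in_set_mapI) simp
  next
    assume "(r, a) \<in> violating_jobs \<and> K = M \<and> (v, P, r, a, M, q, True) \<in> set refined"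
    then have e: "(r, a) \<in> violating_jobs" "K = M" "(v, P, r, a, M, q, True) \<in> set refined" by simp_all
    have "(r, a) \<in> set (jobs st M refined)" using e(1) violating_jobs_sub by blast
    then have "full st M r a" unfolding jobs_mem by simp
    then show ?thesis unfolding next_recs_def reassign_def using e(1,2)
      by (intro in_set_mapI[OF e(3)]) (simp add: violating_jobs_def)
  qed
qed

text \<open>Follow \<open>q\<close>, \<open>c\<close>, \<open>y\<close>, \<open>v\<close>: the first
  leg is at most \<open>M\<close> by choice of neighbours, the second is at most the edge length
  \<open>l\<close> and so again at most \<open>M\<close>, and the last joins two positions of the
  tour that are at most \<open>2 * M\<close> apart.\<close>

lemma server_dist:
  assumes e: "(v, P, r, a, M, q0, True) \<in> set refined" and q: "q \<in> set (nbs w st M free_depots (r, a))"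
  shows "w q v \<le> 4 * M" "q \<in> D"
proof -
  obtain y c l P' where n: "(y, c, l, P', r) \<in> set st" "a < P'" "P' - l < a + M" "w q c \<le> M" "q \<in> set free_depots"
    using q by (auto simp: nbs_def list_ex_iff)
  show qD: "q \<in> D" using n(5) ds by (simp add: free_depots_def)
  note A = refined_active[OF e]
  obtain a0 where "(v, P, r, a0, L, q0, True) \<in> set rs" using A(8) by (elim exE conjE) (rule that)
  from rec_entry[OF this] obtain l0 where v: "(v, v, l0, P, r) \<in> set st" by (elim exE) (rule that)
  note S = st_entry[OF n(1)]
  have P': "0 < P'" using A(2) n(2) by simp
  have V: "q \<in> V" "c \<in> V" "y \<in> V" "v \<in> V"
    using qD DV S(2)[OF P'] st_mem[OF n(1)] st_mem[OF v] by auto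
  \<comment> \<open>The greedy edge of \<open>c\<close> is no longer than the distance from
    \<open>c\<close> to any depot, here \<open>q\<close>.\<close>
  have l: "l \<le> M" using ell_le[OF S(2)[OF P'] qD] S(3)[OF P'] n(4) by simp
  have "w y v \<le> \<bar>P' - P\<bar>" by (rule st_dist[OF n(1) v])
  also have "\<dots> \<le> 2 * M" using n(2,3) l A(3,4) by linarith
  finally have "w q v \<le> M + M + 2 * M"
    using tri[OF V(1,2,4)] tri[OF V(2,3,4)] n(4) S(4)[OF P'] l by linarith
  then show "w q v \<le> 4 * M" by simp
qed

text \<open>The tour ends before the interval does, and from \<open>v\<close> it leads back to
  \<open>r\<close>, so less than \<open>M\<close> remains to be walked.\<close>

lemma partial_dist:
  assumes e: "(v, P, r, a, M, q0, True) \<in> set refined" and nf: "\<not> full st M r a"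
  shows "w r v \<le> 4 * M" "r \<in> D"
proof -
  note A = refined_active[OF e]
  obtain a0 where "(v, P, r, a0, L, q0, True) \<in> set rs" using A(8) by (elim exE conjE) (rule that)
  from rec_entry[OF this] obtain l0 where v: "(v, v, l0, P, r) \<in> set st" by (elim exE) (rule that)
  show "r \<in> D" using st_mem[OF v] by simp
  from st_return[OF v] obtain y c l E where E: "(y, c, l, E, r) \<in> set st" "w r v \<le> E - P"
    by (elim exE conjE) (rule that)
  have "E < a + M"
  proof (rule ccontr)
    assume "\<not> E < a + M"
    then have "full st M r a" by (intro fullI[OF E(1)]) simp
    then show False using nf by simp
  qed
  then show "w r v \<le> 4 * M" using E(2) A(3) M_pos by linarith
qed

text \<open>Left ends are multiples of \<open>M\<close>, so two of them are equal or at least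
  \<open>M\<close> apart.\<close>

lemma refined_labels:
  assumes e: "(v, P, r, a, M, q, True) \<in> set refined" "(v', P', r, a', M, q', True) \<in> set refined"
  shows "a = a' \<and> q = q' \<or> a + M \<le> a' \<or> a' + M \<le> a"
proof -
  note A = refined_active[OF e(1)] and A' = refined_active[OF e(2)]
  obtain k k' where k: "a = M * k" "a' = M * k'" using A(5) A'(5) by (elim dvdE) (rule that)
  have "k = k' \<or> k + 1 \<le> k' \<or> k' + 1 \<le> k" by linarith
  then have "a = a' \<or> a + M \<le> a' \<or> a' + M \<le> a"
  proof (elim disjE)
    assume "k + 1 \<le> k'"
    then have "M * (k + 1) \<le> M * k'" using M_pos by (intro mult_left_mono) auto
    then show ?thesis using k by (simp add: algebra_simps)
  next
    assume "k' + 1 \<le> k"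
    then have "M * (k' + 1) \<le> M * k" using M_pos by (intro mult_left_mono) auto
    then show ?thesis using k by (simp add: algebra_simps)
  qed (use k in simp)
  moreover have "q = q'" if "a = a'"
  proof -
    obtain a0 where a0: "(v, P, r, a0, L, q, True) \<in> set rs" "a = a0 \<or> a = a0 + M"
      using A(8) by (elim exE conjE) (rule that)
    obtain a0' where a0': "(v', P', r, a0', L, q', True) \<in> set rs" "a' = a0' \<or> a' = a0' + M"
      using A'(8) by (elim exE conjE) (rule that)
    \<comment> \<open>Two coarse intervals that share the half starting at \<open>a\<close> overlap,
      hence coincide and have the same depot.\<close>
    show ?thesis using labels[OF a0(1) a0'(1)] a0(2) a0'(2) that L2 M_pos by linarith
  qed
  ultimately show ?thesis by blast
qed

lemma refined_frozen_disjoint: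
  assumes e: "(v, P, r, a, M, q, True) \<in> set refined" "(v', P', r, a', K', q', False) \<in> set rs"
  shows "a + M \<le> a' \<or> a' + K' \<le> a"
proof -
  obtain a0 where a0: "(v, P, r, a0, L, q, True) \<in> set rs" "a = a0 \<or> a = a0 + M"
    using refined_active(8)[OF e(1)] by (elim exE conjE) (rule that)
  have "a0 + L \<le> a' \<or> a' + K' \<le> a0" using labels[OF a0(1) e(2)] by simp
  then show ?thesis using a0(2) L2 M_pos by linarith
qed

lemma next_recs_labels:
  assumes e: "(v, P, r, a, K, q, act) \<in> set next_recs" "(v', P', r, a', K', q', act') \<in> set next_recs"
  shows "a = a' \<and> K = K' \<and> q = q' \<and> act = act' \<or> a + K \<le> a' \<or> a' + K' \<le> a"
proof -
  have cases: "(\<not> act \<and> (v, P, r, a, K, q, False) \<in> set rs) \<or> (\<exists>q0. K = M \<and> (v, P, r, a, M, q0, True) \<in> set refined \<and>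
     act = (\<not> (full st M r a \<and> (r, a) \<in> violating_jobs)) \<and>
     q = (if \<not> full st M r a then r else if (r, a) \<in> violating_jobs then q0 else server matched_slots (r, a) r))"
    if "(v, P, r, a, K, q, act) \<in> set next_recs" for v P a K q act
    using that by (cases rule: next_recs_cases) auto
  from cases[OF e(1)] cases[OF e(2)] show ?thesis
  proof (elim disjE exE conjE)
    assume "\<not> act" "(v, P, r, a, K, q, False) \<in> set rs" "\<not> act'" "(v', P', r, a', K', q', False) \<in> set rs"
    then show ?thesis using labels[of v P r a K q False v' P' a' K' q' False] by simp
  next
    fix q0 assume "\<not> act" "(v, P, r, a, K, q, False) \<in> set rs" "K' = M" "(v', P', r, a', M, q0, True) \<in> set refined"
    then show ?thesis using refined_frozen_disjoint[of v' P' r a' q0 v P a K q] by auto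
  next
    fix q0 assume "\<not> act'" "(v', P', r, a', K', q', False) \<in> set rs" "K = M" "(v, P, r, a, M, q0, True) \<in> set refined"
    then show ?thesis using refined_frozen_disjoint[of v P r a q0 v' P' a' K' q'] by auto
  next
    fix q0 q0'
    assume "K = M" "K' = M" and e': "(v, P, r, a, M, q0, True) \<in> set refined" "(v', P', r, a', M, q0', True) \<in> set refined"
      and "act = (\<not> (full st M r a \<and> (r, a) \<in> violating_jobs))" "act' = (\<not> (full st M r a' \<and> (r, a') \<in> violating_jobs))"
      "q = (if \<not> full st M r a then r else if (r, a) \<in> violating_jobs then q0 else server matched_slots (r, a) r)"
      "q' = (if \<not> full st M r a' then r else if (r, a') \<in> violating_jobs then q0' else server matched_slots (r, a') r)"
    then show ?thesis using refined_labels[OF e'] by auto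
  qed
qed

lemma refined_points:
  "map (\<lambda>(v, P, r, a, K, q, act). (v, P, r)) next_recs = map (\<lambda>(v, P, r, a, K, q, act). (v, P, r)) rs"
  unfolding next_recs_def refined_def reassign_def refine_def by (auto simp: case_prod_unfold)

lemma finite_rec_labels:
  "finite {(r, a). \<exists>v P K. (v, P, r, a, K, q, act) \<in> set xs}"
  "finite {(r, a). \<exists>v P. (v, P, r, a, K, q, act) \<in> set (xs :: rec list)}"
proof -
  have "{(r, a). \<exists>v P K. (v, P, r, a, K, q, act) \<in> set xs} \<subseteq> (\<lambda>(v, P, r, a, K, q, act). (r, a)) ` set xs"
    by force
  then show "finite {(r, a). \<exists>v P K. (v, P, r, a, K, q, act) \<in> set xs}" by (rule finite_subset) simp
  have "{(r, a). \<exists>v P. (v, P, r, a, K, q, act) \<in> set xs} \<subseteq> (\<lambda>(v, P, r, a, K, q, act). (r, a)) ` set xs"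
    by force
  then show "finite {(r, a). \<exists>v P. (v, P, r, a, K, q, act) \<in> set xs}" by (rule finite_subset) simp
qed

text \<open>The auction contributes at most 2. Other active intervals stay with their own depot, and
  a tour has only one unfinished piece.\<close>

lemma refined_count_active: "card {(r, a). \<exists>v P K. (v, P, r, a, K, q, True) \<in> set next_recs} \<le> 3"
proof -
  define Par where "Par = {(r, a). r = q \<and> \<not> full st M r a \<and> (\<exists>v P q0. (v, P, r, a, M, q0, True) \<in> set refined)}"
  define Srv where "Srv = {j \<in> set (jobs st M refined) - violating_jobs. server matched_slots j (fst j) = q}"
  have sub: "{(r, a). \<exists>v P K. (v, P, r, a, K, q, True) \<in> set next_recs} \<subseteq> Par \<union> Srv"
  proof
    fix x assume "x \<in> {(r, a). \<exists>v P K. (v, P, r, a, K, q, True) \<in> set next_recs}"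
    then obtain r a v P K where x: "x = (r, a)" "(v, P, r, a, K, q, True) \<in> set next_recs" by blast
    from x(2) show "x \<in> Par \<union> Srv"
    proof (cases rule: next_recs_cases)
      case (partial q0)
      then show ?thesis unfolding x(1) Par_def by blast
    next
      case (serve q0)
      then show ?thesis unfolding x(1) Srv_def by simp
    qed simp_all
  qed
  \<comment> \<open>Neither piece is full, so each one's point lies before the end of the other; the
    two pieces overlap and are equal.\<close>
  have one: "x = y" if xy: "x \<in> Par" "y \<in> Par" for x y
  proof -
    obtain a v P q0 where x: "x = (q, a)" "\<not> full st M q a" "(v, P, q, a, M, q0, True) \<in> set refined"
      using xy(1) unfolding Par_def by blast
    obtain b v' P' q0' where y: "y = (q, b)" "\<not> full st M q b" "(v', P', q, b, M, q0', True) \<in> set refined"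
      using xy(2) unfolding Par_def by blast
    obtain a0 where "(v, P, q, a0, L, q0, True) \<in> set rs" using refined_active(8)[OF x(3)] by (elim exE conjE) (rule that)
    from rec_entry[OF this] obtain l0 where v: "(v, v, l0, P, q) \<in> set st" by (elim exE) (rule that)
    obtain b0 where "(v', P', q, b0, L, q0', True) \<in> set rs" using refined_active(8)[OF y(3)] by (elim exE conjE) (rule that)
    from rec_entry[OF this] obtain l0' where v': "(v', v', l0', P', q) \<in> set st" by (elim exE) (rule that)
    have "P < b + M" using fullI[OF v, of b M] y(2) by linarith
    moreover have "P' < a + M" using fullI[OF v', of a M] x(2) by linarith
    ultimately have "a = b" using refined_labels[OF x(3) y(3)] refined_active(3)[OF x(3)] refined_active(3)[OF y(3)] by linarith
    then show ?thesis using x y by simp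
  qed
  have "card Par \<le> 1"
  proof (cases "Par = {}")
    case False
    then obtain x where "x \<in> Par" by blast
    then have "Par \<subseteq> {x}" using one by blast
    then show ?thesis using card_mono[of "{x}" Par] by simp
  qed simp
  moreover have "card Srv \<le> 2" unfolding Srv_def by (rule server_count)
  moreover have "finite Par" using one by (metis (full_types) finite.emptyI finite_insert finite_subset insertCI subsetI)
  moreover have "finite Srv" unfolding Srv_def by simp
  ultimately have "card (Par \<union> Srv) \<le> 3" "finite (Par \<union> Srv)" using card_Un_le[of Par Srv] by auto
  then show ?thesis using card_mono[OF _ sub] by linarith
qed

text \<open>Intervals frozen earlier are longer than \<open>M\<close>. Those of length
  \<open>M\<close> are frozen now and are halves of the at most 3 intervals that the depot had at
  level \<open>L\<close>.\<close>

lemma refined_count_frozen: "card {(r, a). \<exists>v P. (v, P, r, a, K, q, False) \<in> set next_recs} \<le> 6"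
proof (cases "K = M")
  case False
  then have "{(r, a). \<exists>v P. (v, P, r, a, K, q, False) \<in> set next_recs} = {(r, a). \<exists>v P. (v, P, r, a, K, q, False) \<in> set rs}"
    by (simp add: next_recs_frozen)
  then show ?thesis using count_frozen[where q = q and K = K] by simp
next
  case True
  let ?A = "{(r, a). \<exists>v P K. (v, P, r, a, K, q, True) \<in> set rs}"
  have fA: "finite ?A" by (rule finite_rec_labels)
  have "{(r, a). \<exists>v P. (v, P, r, a, K, q, False) \<in> set next_recs} \<subseteq> ?A \<union> (\<lambda>(r, a). (r, a + M)) ` ?A"
  proof
    fix x assume "x \<in> {(r, a). \<exists>v P. (v, P, r, a, K, q, False) \<in> set next_recs}"
    then obtain r a v P where x: "x = (r, a)" "(v, P, r, a, M, q, False) \<in> set next_recs" using True by blast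
    have "(v, P, r, a, M, q, False) \<notin> set rs" using rec[of v P r a M q False] L2 M_pos by force
    then have "(v, P, r, a, M, q, True) \<in> set refined" using x(2) unfolding next_recs_frozen by simp
    from refined_active(8)[OF this] obtain a0 where a0: "(v, P, r, a0, L, q, True) \<in> set rs" "a = a0 \<or> a = a0 + M"
      by (elim exE conjE) (rule that)
    have "(r, a0) \<in> ?A" using a0(1) by blast
    then show "x \<in> ?A \<union> (\<lambda>(r, a). (r, a + M)) ` ?A" using a0(2) x(1) by force
  qed
  then have "card {(r, a). \<exists>v P. (v, P, r, a, K, q, False) \<in> set next_recs} \<le> card (?A \<union> (\<lambda>(r, a). (r, a + M)) ` ?A)"
    using fA by (intro card_mono) auto
  also have "\<dots> \<le> card ?A + card ((\<lambda>(r, a). (r, a + M)) ` ?A)" by (rule card_Un_le)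
  also have "\<dots> \<le> 6" using card_image_le[OF fA, of "\<lambda>(r, a). (r, a + M)"] count_active[of q] by linarith
  finally show ?thesis .
qed

abbreviation "frozen_labels xs \<equiv> {(r, a, K). \<exists>v P q. (v, P, r, a, K, q, False) \<in> set xs}"

lemma finite_frozen_labels: "finite (frozen_labels xs)"
proof -
  have "frozen_labels xs \<subseteq> (\<lambda>(v, P, r, a, K, q, act). (r, a, K)) ` set xs" by force
  then show ?thesis by (rule finite_subset) simp
qed

lemma refined_frozen_labels: "frozen_labels next_recs = frozen_labels rs \<union> (\<lambda>(r, a). (r, a, M)) ` violating_jobs"
proof (intro equalityI subsetI)
  fix x assume "x \<in> frozen_labels next_recs"
  then obtain r a K v P q where x: "x = (r, a, K)" "(v, P, r, a, K, q, False) \<in> set next_recs" by blast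
  from x(2)[unfolded next_recs_frozen] show "x \<in> frozen_labels rs \<union> (\<lambda>(r, a). (r, a, M)) ` violating_jobs"
    unfolding x(1) by force
next
  fix x assume "x \<in> frozen_labels rs \<union> (\<lambda>(r, a). (r, a, M)) ` violating_jobs"
  then show "x \<in> frozen_labels next_recs"
  proof
    assume "x \<in> frozen_labels rs"
    then obtain r a K v P q where x: "x = (r, a, K)" "(v, P, r, a, K, q, False) \<in> set rs" by blast
    then have "(v, P, r, a, K, q, False) \<in> set next_recs" unfolding next_recs_frozen by simp
    then show ?thesis unfolding x(1) by blast
  next
    assume "x \<in> (\<lambda>(r, a). (r, a, M)) ` violating_jobs"
    then obtain r a where x: "x = (r, a, M)" "(r, a) \<in> violating_jobs" by auto
    then have "(r, a) \<in> set (jobs st M refined)" using violating_jobs_sub by blast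
    then obtain v P K q where e: "(v, P, r, a, K, q, True) \<in> set refined" unfolding jobs_mem by blast
    have "K = M" by (rule refined_active(1)[OF e])
    then have "(v, P, r, a, M, q, False) \<in> set next_recs" using e x(2) unfolding next_recs_frozen by simp
    then show ?thesis unfolding x(1) by blast
  qed
qed

lemma finite_violating_jobs: "finite violating_jobs" using violating_jobs_sub finite_subset by blast

lemma refined_frozen_sum:
  "(\<Sum>(r, a, K)\<in>frozen_labels next_recs. K) = (\<Sum>(r, a, K)\<in>frozen_labels rs. K) + M * int (card violating_jobs)"
proof -
  have "frozen_labels rs \<inter> (\<lambda>(r, a). (r, a, M)) ` violating_jobs = {}"
  proof (rule equals0I)
    fix x assume "x \<in> frozen_labels rs \<inter> (\<lambda>(r, a). (r, a, M)) ` violating_jobs"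
    then obtain r a v P q where e: "(v, P, r, a, M, q, False) \<in> set rs" by auto
    show False using rec[OF e] L2 M_pos by simp
  qed
  moreover have "(\<Sum>(r, a, K)\<in>(\<lambda>(r, a). (r, a, M)) ` violating_jobs. K) = M * int (card violating_jobs)"
    by (subst sum.reindex) (auto simp: inj_on_def case_prod_unfold)
  ultimately show ?thesis
    unfolding refined_frozen_labels
    by (subst sum.union_disjoint) (auto simp: finite_frozen_labels finite_violating_jobs)
qed

lemma set_next_blocked: "set next_blocked = set bl \<union> crowded"
  unfolding next_blocked_def crowded_def by (auto simp: list_ex_iff)

lemma blocked_disjoint_crowded: "set bl \<inter> crowded = {}"
  unfolding crowded_def free_depots_def by auto

lemma refined_bl: "distinct next_blocked" "set next_blocked \<subseteq> D"
  using bl ds unfolding next_blocked_def free_depots_def by auto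

text \<open>For the old blocked depots the bound at level \<open>L\<close> is twice what level
  \<open>M\<close> requires. The newly crowded ones were still free, hence are disjoint from the
  old, and are paid for by the violating jobs, at least twice their number.\<close>

lemma refined_bl_card: "2 * M * int (card (set next_blocked)) \<le> (\<Sum>(r, a, K)\<in>frozen_labels next_recs. K)"
proof -
  have "finite crowded" unfolding crowded_def by simp
  then have "card (set next_blocked) = card (set bl) + card crowded"
    unfolding set_next_blocked using blocked_disjoint_crowded by (intro card_Un_disjoint) auto
  then have "2 * M * int (card (set next_blocked)) = L * int (card (set bl)) + M * int (2 * card crowded)"
    by (simp add: L2 algebra_simps)
  moreover have "M * int (2 * card crowded) \<le> M * int (card violating_jobs)"
    using card_crowded M_pos by (intro mult_left_mono) auto
  moreover have "0 \<le> L * int (card (set bl))" using L2 M_pos by simp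
  then have "L * int (card (set bl)) \<le> 2 * L * int (card (set bl))" by simp
  ultimately show ?thesis using bl_card refined_frozen_sum by linarith
qed

text \<open>For an older interval, all depots within \<open>L\<close> are blocked already. For one
  frozen now, a free depot within \<open>M\<close> is among its neighbours and therefore
  crowded.\<close>

lemma refined_bl_near:
  assumes e: "(v, P, r, a, K, q, False) \<in> set next_recs" and n: "(y, c, l, P', r) \<in> set st" "a < P'" "P' - l < a + K"
    and q': "q' \<in> D" "w q' c \<le> M"
  shows "q' \<in> set next_blocked"
proof -
  from e[unfolded next_recs_frozen] show ?thesis
  proof
    assume "(v, P, r, a, K, q, False) \<in> set rs"
    from bl_near[OF this n q'(1)] q'(2) L2 M_pos show ?thesis by (simp add: set_next_blocked)
  next
    assume "(r, a) \<in> violating_jobs \<and> K = M \<and> (v, P, r, a, M, q, True) \<in> set refined"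
    then have violating_jobs: "(r, a) \<in> violating_jobs" "K = M" by simp_all
    show ?thesis
    proof (cases "q' \<in> set bl")
      case False
      then have av: "q' \<in> set free_depots" using q' ds by (simp add: free_depots_def)
      obtain b where b: "b \<in> set violators" "fst b = (r, a)" using violating_jobs(1) unfolding violating_jobs_def by auto
      have "\<exists>e\<in>set st. case e of (y, c, l, P, r') \<Rightarrow> r' = r \<and> a < P \<and> P - l < a + M \<and> w q' c \<le> M"
        using n violating_jobs(2) q'(2) by (intro bexI[OF _ n(1)]) simp
      then have "q' \<in> set (nbs w st M free_depots (r, a))"
        using av unfolding nbs_def by (simp add: list_ex_iff)
      then have "q' \<in> set (snd b)" using violators_nbs[OF b(1)] b(2) by simp
      then show ?thesis using av b(1) unfolding set_next_blocked crowded_def by blast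
    qed (simp add: set_next_blocked)
  qed
qed

lemma spread_frozen:
  assumes "\<And>v P r a K q. (v, P, r, a, K, q, False) \<in> set xs \<Longrightarrow> 0 \<le> a \<and> 0 < K \<and> full st K r a"
    and "\<And>v P r a K q v' P' a' K' q'. (v, P, r, a, K, q, False) \<in> set xs \<Longrightarrow>
      (v', P', r, a', K', q', False) \<in> set xs \<Longrightarrow> a = a' \<and> K = K' \<or> a + K \<le> a' \<or> a' + K' \<le> a"
  shows "spread (frozen_labels xs)"
  unfolding spread_def
proof (intro conjI allI impI)
  show "finite (frozen_labels xs)" by (rule finite_frozen_labels)
next
  fix r a K assume "(r, a, K) \<in> frozen_labels xs"
  then obtain v P q where e: "(v, P, r, a, K, q, False) \<in> set xs" by blast
  from assms(1)[OF e] show "0 \<le> a" "0 < K" "full st K r a" by simp_all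
next
  fix r a K a' K' assume "(r, a, K) \<in> frozen_labels xs" "(r, a', K') \<in> frozen_labels xs"
  then obtain v P q v' P' q' where e: "(v, P, r, a, K, q, False) \<in> set xs" "(v', P', r, a', K', q', False) \<in> set xs"
    by blast
  from assms(2)[OF e] show "a = a' \<and> K = K' \<or> a + K \<le> a' \<or> a' + K' \<le> a" .
qed

end

context level_refinement begin

lemma refined_rec:
  assumes e: "(v, P, r, a, K, q, act) \<in> set next_recs"
  shows "0 \<le> a \<and> a < P \<and> P \<le> a + K \<and> K dvd a \<and> q \<in> D \<and> w q v \<le> 8 * K \<and> (\<exists>i. K = 2 ^ i) \<and> M \<le> K"
    "act \<Longrightarrow> K = M \<and> w q v \<le> 4 * M" "\<not> act \<Longrightarrow> full st K r a"
proof -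
  have "0 \<le> a \<and> a < P \<and> P \<le> a + K \<and> K dvd a \<and> q \<in> D \<and> w q v \<le> 8 * K \<and> (\<exists>i. K = 2 ^ i) \<and> M \<le> K \<and>
    (act \<longrightarrow> K = M \<and> w q v \<le> 4 * M) \<and> (\<not> act \<longrightarrow> full st K r a)"
    using e
  proof (cases rule: next_recs_cases)
    case old
    then show ?thesis using rec[OF old(2)] frozen[OF old(2)] L2 M_pos by simp
  next
    case (partial q0)
    note A = refined_active[OF partial(2)] and d = partial_dist[OF partial(2,3)]
    show ?thesis using A(2-5) d M_pow M_pos partial(1,4,5) by simp
  next
    case freeze
    note A = refined_active[OF freeze(2)]
    show ?thesis using A(2-7) M_pow M_pos freeze(1,3,5) L2 by simp
  next
    case (serve q0)
    note A = refined_active[OF serve(2)]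
    have "w q v \<le> 4 * M" "q \<in> D"
      using server_dist[OF serve(2) server_nbs(1)[OF serve(7,4), of r]] serve(5) by simp_all
    then show ?thesis using A(2-5) M_pow M_pos serve(1,6) by simp
  qed
  then show "0 \<le> a \<and> a < P \<and> P \<le> a + K \<and> K dvd a \<and> q \<in> D \<and> w q v \<le> 8 * K \<and> (\<exists>i. K = 2 ^ i) \<and> M \<le> K"
    "act \<Longrightarrow> K = M \<and> w q v \<le> 4 * M" "\<not> act \<Longrightarrow> full st K r a" by simp_all
qed

text \<open>Thresholds from \<open>L\<close> upwards concern older intervals only. The one new
  threshold is \<open>M\<close>; there all frozen intervals count, and the blocked depots serve as
  the set of depots near them.\<close>

lemma refined_heavy:
  assumes i: "M \<le> 2 ^ i"
  shows "(\<Sum>(r, a, K)\<in>{(r, a, K). 2 ^ i \<le> K \<and> (\<exists>v P q. (v, P, r, a, K, q, False) \<in> set next_recs)}. K)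
        \<le> 4 * (\<Sum>q | q \<in> D \<and> 2 ^ i < 2 * W q. W q)"
proof (cases "L \<le> 2 ^ i")
  case True
  then have "M < 2 ^ i" using L2 M_pos by simp
  then have "{(r, a, K). 2 ^ i \<le> K \<and> (\<exists>v P q. (v, P, r, a, K, q, False) \<in> set next_recs)} =
    {(r, a, K). 2 ^ i \<le> K \<and> (\<exists>v P q. (v, P, r, a, K, q, False) \<in> set rs)}"
    unfolding next_recs_frozen by auto
  then show ?thesis using heavy[OF True] by simp
next
  case False
  obtain j where j: "M = 2 ^ j" using M_pow by blast
  have "(2::int) ^ i < 2 ^ Suc j" using False j L2 by simp
  then have "i < Suc j" by (rule power_less_imp_less_exp[rotated]) simp
  moreover have "j \<le> i" using i j by simp
  ultimately have Mi: "2 ^ i = M" using j by (simp add: le_less_Suc_eq)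
  have "{(r, a, K). 2 ^ i \<le> K \<and> (\<exists>v P q. (v, P, r, a, K, q, False) \<in> set next_recs)} = frozen_labels next_recs"
  proof (intro equalityI subsetI)
    fix x assume "x \<in> frozen_labels next_recs"
    then obtain r a K v P q where x: "x = (r, a, K)" "(v, P, r, a, K, q, False) \<in> set next_recs" by blast
    have "2 ^ i \<le> K" using refined_rec(1)[OF x(2)] Mi by simp
    then show "x \<in> {(r, a, K). 2 ^ i \<le> K \<and> (\<exists>v P q. (v, P, r, a, K, q, False) \<in> set next_recs)}"
      using x by blast
  qed blast
  moreover have "(\<Sum>(r, a, K)\<in>frozen_labels next_recs. K) \<le> 4 * (\<Sum>q | q \<in> D \<and> M < 2 * W q. W q)"
  proof (rule spread_heavy)
    show "spread (frozen_labels next_recs)"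
    proof (rule spread_frozen)
      fix v P r a K q assume e: "(v, P, r, a, K, q, False) \<in> set next_recs"
      show "0 \<le> a \<and> 0 < K \<and> full st K r a"
        using refined_rec(1)[OF e] refined_rec(3)[OF e] M_pos by simp
    next
      fix v P r a K q v' P' a' K' q'
      assume "(v, P, r, a, K, q, False) \<in> set next_recs" "(v', P', r, a', K', q', False) \<in> set next_recs"
      from next_recs_labels[OF this] show "a = a' \<and> K = K' \<or> a + K \<le> a' \<or> a' + K' \<le> a" by blast
    qed
    show "2 * M * int (card (set next_blocked)) \<le> (\<Sum>(r, a, K)\<in>frozen_labels next_recs. K)" by (rule refined_bl_card)
    fix c q' assume "c \<in> touched (frozen_labels next_recs)" "q' \<in> D" "w q' c \<le> M"
    then show "q' \<in> set next_blocked" unfolding touched_def using refined_bl_near by blast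
  qed simp
  ultimately show ?thesis using Mi by simp
qed

lemma refined_state: "level_state V D w ell st X W ds M next_recs next_blocked"
proof (unfold_locales)
  show "set ds = D" "distinct ds" by (rule ds)+
  show "\<exists>j. M = 2 ^ j" by (rule M_pow)
  show "map (\<lambda>(v, P, r, a, K, q, act). (v, P, r)) next_recs =
      map (\<lambda>(y, c, l, P, r). (y, P, r)) (filter (\<lambda>(y, c, l, P, r). y = c \<and> l \<noteq> 0) st)"
    unfolding refined_points by (rule points)
  show "0 \<le> a \<and> a < P \<and> P \<le> a + K \<and> K dvd a \<and> q \<in> D \<and> w q v \<le> 8 * K \<and> (\<exists>i. K = 2 ^ i) \<and> M \<le> K"
    if "(v, P, r, a, K, q, act) \<in> set next_recs" for v P r a K q act
    by (rule refined_rec(1)[OF that])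
  show "K = M \<and> w q v \<le> 4 * M" if "(v, P, r, a, K, q, True) \<in> set next_recs" for v P r a K q
    by (rule refined_rec(2)[OF that TrueI])
  show "full st K r a" if "(v, P, r, a, K, q, False) \<in> set next_recs" for v P r a K q
    using refined_rec(3)[OF that] by simp
  show "a = a' \<and> K = K' \<and> q = q' \<and> act = act' \<or> a + K \<le> a' \<or> a' + K' \<le> a"
    if "(v, P, r, a, K, q, act) \<in> set next_recs" "(v', P', r, a', K', q', act') \<in> set next_recs"
    for v P r a K q act v' P' a' K' q' act'
    by (rule next_recs_labels[OF that])
  show "card {(r, a). \<exists>v P K. (v, P, r, a, K, q, True) \<in> set next_recs} \<le> 3" for q by (rule refined_count_active)
  show "card {(r, a). \<exists>v P. (v, P, r, a, K, q, False) \<in> set next_recs} \<le> 6" for q K by (rule refined_count_frozen)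
  show "distinct next_blocked" "set next_blocked \<subseteq> D" by (rule refined_bl)+
  show "2 * M * int (card (set next_blocked)) \<le> (\<Sum>(r, a, K)\<in>frozen_labels next_recs. K)" by (rule refined_bl_card)
  show "q' \<in> set next_blocked" if "(v, P, r, a, K, q, False) \<in> set next_recs" "(y, c, l, P', r) \<in> set st" "a < P'"
      "P' - l < a + K" "q' \<in> D" "w q' c \<le> M" for v P r a K q q' y c l P'
    by (rule refined_bl_near[OF that])
  show "(\<Sum>(r, a, K)\<in>{(r, a, K). 2 ^ i \<le> K \<and> (\<exists>v P q. (v, P, r, a, K, q, False) \<in> set next_recs)}. K)
        \<le> 4 * (\<Sum>q | q \<in> D \<and> 2 ^ i < 2 * W q. W q)" if "M \<le> 2 ^ i" for i
    by (rule refined_heavy[OF that])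
qed

end

section \<open>The first and the last level\<close>

lemma max_pos_ge:
  assumes "(y, c, l, P, r) \<in> set st" shows "P \<le> max_pos st"
proof -
  let ?g = "\<lambda>m (y, c, l, P, r). if m < P then P else (m::int)"
  have mono: "m \<le> foldl ?g m xs" for m and xs :: "pstep list"
  proof (induction xs arbitrary: m)
    case (Cons x xs)
    have "m \<le> ?g m x" by (simp add: case_prod_unfold)
    also have "\<dots> \<le> foldl ?g (?g m x) xs" by (rule Cons)
    finally show ?case by simp
  qed simp
  obtain A B where st: "st = A @ (y, c, l, P, r) # B" using split_list[OF assms] by blast
  have "P \<le> ?g (foldl ?g 0 A) (y, c, l, P, r)" by simp
  also have "\<dots> \<le> foldl ?g (?g (foldl ?g 0 A) (y, c, l, P, r)) B" by (rule mono)
  finally show ?thesis unfolding max_pos_def st by simp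
qed

context cover begin

text \<open>The starting length exceeds every position, so each tour is one interval at its own
  depot and nothing is frozen.\<close>

lemma init_state:
  assumes ds: "set ds = D" "distinct ds" and n: "max_pos st \<le> 2 ^ n"
  shows "level_state V D w ell st X W ds (2 ^ n) (init_recs st (2 ^ n)) []"
proof -
  have mem: "\<exists>l. (v, v, l, P, r) \<in> set st \<and> l \<noteq> 0 \<and> a = 0 \<and> K = 2 ^ n \<and> q = r \<and> act"
    if "(v, P, r, a, K, q, act) \<in> set (init_recs st (2 ^ n))" for v P r a K q act
    using that unfolding init_recs_def by auto
  have nofrozen: "(v, P, r, a, K, q, False) \<notin> set (init_recs st (2 ^ n))" for v P r a K q
    using mem[of v P r a K q False] by blast
  have noset: "{(r, a, K). \<exists>v P q. (v, P, r, a, K, q, False) \<in> set (init_recs st (2 ^ n))} = {}"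
    "{(r, a, K). 2 ^ i \<le> K \<and> (\<exists>v P q. (v, P, r, a, K, q, False) \<in> set (init_recs st (2 ^ n)))} = {}" for i
    using nofrozen by auto
  show ?thesis
  proof (unfold_locales)
    show "\<exists>j. (2::int) ^ n = 2 ^ j" by blast
    show "map (\<lambda>(v, P, r, a, K, q, act). (v, P, r)) (init_recs st (2 ^ n)) =
      map (\<lambda>(y, c, l, P, r). (y, P, r)) (filter (\<lambda>(y, c, l, P, r). y = c \<and> l \<noteq> 0) st)"
      by (simp add: init_recs_def case_prod_unfold comp_def)
    fix v P r a K q act assume e: "(v, P, r, a, K, q, act) \<in> set (init_recs st (2 ^ n))"
    obtain l where l: "(v, v, l, P, r) \<in> set st" "l \<noteq> 0" "a = 0" "K = 2 ^ n" "q = r" "act"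
      using mem[OF e] by blast
    have v: "v \<in> V" "r \<in> D" "v \<notin> D" using st_mem[OF l(1)] st_tree[OF l(1,2)] by auto
    have "0 < w r v" using pos[of r v] v DV by auto
    then have "0 < P" "w r v \<le> P" using st_root[OF l(1)] by auto
    moreover have "P \<le> 2 ^ n" using max_pos_ge[OF l(1)] n by simp
    ultimately show "0 \<le> a \<and> a < P \<and> P \<le> a + K \<and> K dvd a \<and> q \<in> D \<and> w q v \<le> 8 * K \<and> (\<exists>i. K = 2 ^ i) \<and> 2 ^ n \<le> K"
      using l v by auto
  next
    fix v P r a K q assume e: "(v, P, r, a, K, q, True) \<in> set (init_recs st (2 ^ n))"
    obtain l where l: "(v, v, l, P, r) \<in> set st" "l \<noteq> 0" "a = 0" "K = 2 ^ n" "q = r"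
      using mem[OF e] by blast
    have "w q v \<le> 2 ^ n" using l st_root[OF l(1)] max_pos_ge[OF l(1)] n by simp
    moreover have "(0::int) \<le> 2 ^ n" by simp
    ultimately have "w q v \<le> 4 * 2 ^ n" by linarith
    then show "K = 2 ^ n \<and> w q v \<le> 4 * 2 ^ n" using l(4) by simp
  next
    fix v P r a K q act v' P' a' K' q' act'
    assume "(v, P, r, a, K, q, act) \<in> set (init_recs st (2 ^ n))" "(v', P', r, a', K', q', act') \<in> set (init_recs st (2 ^ n))"
    from mem[OF this(1)] mem[OF this(2)]
    show "a = a' \<and> K = K' \<and> q = q' \<and> act = act' \<or> a + K \<le> a' \<or> a' + K' \<le> a" by auto
  next
    fix q
    have "{(r, a). \<exists>v P K. (v, P, r, a, K, q, True) \<in> set (init_recs st (2 ^ n))} \<subseteq> {(q, 0)}"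
      using mem by fastforce
    then have "card {(r, a). \<exists>v P K. (v, P, r, a, K, q, True) \<in> set (init_recs st (2 ^ n))} \<le> card {(q, 0::int)}"
      by (intro card_mono) auto
    then show "card {(r, a). \<exists>v P K. (v, P, r, a, K, q, True) \<in> set (init_recs st (2 ^ n))} \<le> 3" by simp
  next
    fix i :: nat
    have "0 \<le> (\<Sum>q | q \<in> D \<and> 2 ^ i < 2 * W q. W q)" using W_nonneg by (intro sum_nonneg) auto
    then show "(\<Sum>(r, a, K)\<in>{(r, a, K). 2 ^ i \<le> K \<and> (\<exists>v P q. (v, P, r, a, K, q, False) \<in> set (init_recs st (2 ^ n)))}. K)
        \<le> 4 * (\<Sum>q | q \<in> D \<and> 2 ^ i < 2 * W q. W q)" unfolding noset by simp
  next
    show "2 * 2 ^ n * int (card (set [])) \<le>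
      (\<Sum>(r, a, K)\<in>{(r, a, K). \<exists>v P q. (v, P, r, a, K, q, False) \<in> set (init_recs st (2 ^ n))}. K)"
      unfolding noset by simp
  qed (use ds nofrozen in simp_all)
qed

lemma final_state:
  assumes ds: "set ds = D" "distinct ds"
  shows "\<exists>bl. level_state V D w ell st X W ds 1 (final_recs w ds st) bl"
proof -
  define n where "n = (LEAST k. max_pos st \<le> 2 ^ k)"
  have "max_pos st \<le> 2 ^ nat \<bar>max_pos st\<bar>"
    using of_nat_less_two_power[of "nat \<bar>max_pos st\<bar>", where 'a = int] by linarith
  then have n: "max_pos st \<le> 2 ^ n" unfolding n_def by (rule LeastI)
  have pw: "pows (max_pos st) = (max_pos st, 2 ^ n, rev (map (\<lambda>i. 2 ^ i) [0..<n]))"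
    by (simp add: pows_def n_def[symmetric] pow_step_funpow)
  have step: "level_state V D w ell st X W ds 1 (fst S') (snd S')"
    if "S' = foldl (level_step w ds st) S (rev (map (\<lambda>i. 2 ^ i) [0..<k]))"
      "level_state V D w ell st X W ds (2 ^ k) (fst S) (snd S)" for S S' k
    using that
  proof (induction k arbitrary: S)
    case (Suc k)
    interpret level_state V D w ell st X W ds "2 ^ Suc k" "fst S" "snd S" by (rule Suc.prems)
    interpret R: level_refinement V D w ell st X W ds "2 ^ Suc k" "fst S" "snd S" "2 ^ k"
      by unfold_locales simp
    have "level_step w ds st S (2 ^ k) = (R.next_recs, R.next_blocked)" using R.level_step_eq by simp
    then have "level_state V D w ell st X W ds (2 ^ k) (fst (level_step w ds st S (2 ^ k))) (snd (level_step w ds st S (2 ^ k)))"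
      using R.refined_state by simp
    then show ?case using Suc.prems(1) by (intro Suc.IH) auto
  qed simp
  have "level_state V D w ell st X W ds (2 ^ n) (fst (init_recs st (2 ^ n), [])) (snd (init_recs st (2 ^ n), []))"
    using init_state[OF ds n] by simp
  from step[OF refl this] show ?thesis
    unfolding final_recs_def Let_def pw by auto
qed

end

section \<open>The cost of the final assignment\<close>

fun path_len :: "(nat \<Rightarrow> nat \<Rightarrow> int) \<Rightarrow> nat \<Rightarrow> nat list \<Rightarrow> int" where
  "path_len w u [] = 0"
| "path_len w u (v # vs) = w u v + path_len w v vs"

definition label :: "rec \<Rightarrow> nat \<times> int \<times> int" where
  "label = (\<lambda>(v, P, r, a, K, q, act). (r, a, K))"

definition rec_le :: "rec \<Rightarrow> rec \<Rightarrow> bool" where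
  "rec_le = (\<lambda>(v, P, r, _) (v', P', r', _). r < r' \<or> r = r' \<and> P \<le> P')"

abbreviation label_size :: "(nat \<times> int \<times> int) set \<Rightarrow> int" where
  "label_size Y \<equiv> (\<Sum>(r, a, K)\<in>Y. K)"

context level_state begin

lemma rs_sorted: "sorted_wrt rec_le rs"
proof -
  let ?f = "\<lambda>(v :: nat, P :: int, r :: nat) (v' :: nat, P', r'). r < r' \<or> r = r' \<and> P \<le> P'"
  have "sorted_wrt (\<lambda>(y1, c1, l1, P1, r1) (y2, c2, l2, P2, r2). r1 < r2 \<or> r1 = r2 \<and> P1 \<le> P2)
     (filter (\<lambda>(y, c, l, P, r). y = c \<and> l \<noteq> 0) st)"
    by (rule sorted_wrt_filter[OF st_sorted])
  then have "sorted_wrt ?f (map (\<lambda>(y, c, l, P, r). (y, P, r)) (filter (\<lambda>(y, c, l, P, r). y = c \<and> l \<noteq> 0) st))"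
    unfolding sorted_wrt_map by (rule sorted_wrt_mono_rel[rotated]) auto
  then have "sorted_wrt ?f (map (\<lambda>(v, P, r, a, K, q, act). (v, P, r)) rs)" using points by metis
  then show ?thesis unfolding sorted_wrt_map
    by (rule sorted_wrt_mono_rel[rotated]) (auto simp: rec_le_def)
qed

text \<open>The points of one interval are consecutive in the tour order.\<close>

lemma label_contiguous:
  assumes mem: "e \<in> set rs" "e' \<in> set rs" "e'' \<in> set rs"
    and le: "rec_le e e'" "rec_le e' e''" and eq: "label e = label e''"
  shows "label e' = label e"
proof -
  obtain v P r a K q act where e: "e = (v, P, r, a, K, q, act)" by (cases e) blast
  obtain v' P' r' a' K' q' act' where e': "e' = (v', P', r', a', K', q', act')" by (cases e') blast
  obtain v'' P'' r'' a'' K'' q'' act'' where e'': "e'' = (v'', P'', r'', a'', K'', q'', act'')" by (cases e'') blast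
  have l: "r'' = r" "a'' = a" "K'' = K" using eq e e'' by (simp_all add: label_def)
  have r: "r' = r" "P \<le> P'" "P' \<le> P''" using le e e' e'' l by (auto simp: rec_le_def)
  have "a < P" "P'' \<le> a + K" "a' < P'" "P' \<le> a' + K'"
    using rec[OF mem(1)[unfolded e]] rec[OF mem(2)[unfolded e']] rec[OF mem(3)[unfolded e'']] l by auto
  then have "\<not> (a + K \<le> a' \<or> a' + K' \<le> a)" using r by linarith
  moreover have "a = a' \<and> K = K' \<and> q = q' \<and> act = act' \<or> a + K \<le> a' \<or> a' + K' \<le> a"
    by (rule labels) (use mem e e' r in auto)
  ultimately show ?thesis using e e' r by (auto simp: label_def)
qed

text \<open>An amortized count. The term \<open>8 * K\<close> reserves the hop from \<open>q\<close>
  into the interval of the first point, and \<open>P - a\<close> the part of that interval already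
  passed. Per interval this is one hop in, one hop out and one traversal:
  \<open>8 + 8 + 1 = 17\<close>.\<close>

lemma path_len_block:
  assumes "set (e # es) \<subseteq> set rs" "sorted_wrt rec_le (e # es)" "e = (v, P, r, a, K, q, act)"
    "\<And>v P r a K q' act. (v, P, r, a, K, q', act) \<in> set (e # es) \<Longrightarrow> q' = q"
  shows "path_len w v (map fst es) + 8 * K + (P - a) \<le> 17 * label_size (label ` set (e # es))"
  using assms
proof (induction es arbitrary: e v P r a K act)
  case Nil
  have "P \<le> a + K" "a < P" using rec[of v P r a K q act] Nil.prems(1,3) by simp_all
  then show ?case using Nil.prems(3) by (simp add: label_def)
next
  case (Cons e' es)
  obtain v' P' r' a' K' q' act' where e1: "e' = (v', P', r', a', K', q', act')" by (cases e') blast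
  have "q' = q" by (rule Cons.prems(4)[of v' P' r' a' K' q' act']) (simp add: e1)
  then have e': "e' = (v', P', r', a', K', q, act')" using e1 by simp
  have IH: "path_len w v' (map fst es) + 8 * K' + (P' - a') \<le> 17 * label_size (label ` set (e' # es))"
  proof (rule Cons.IH[OF _ _ e'])
    show "set (e' # es) \<subseteq> set rs" "sorted_wrt rec_le (e' # es)" using Cons.prems(1,2) by auto
    show "q' = q" if "(v, P, r, a, K, q', act) \<in> set (e' # es)" for v P r a K q' act
      by (rule Cons.prems(4)[of v P r a K q' act]) (use that in simp)
  qed
  have mem: "(v, P, r, a, K, q, act) \<in> set rs" "(v', P', r', a', K', q, act') \<in> set rs"
    using Cons.prems(1,3) e' by auto
  have le: "rec_le e e'" using Cons.prems(2) by simp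
  note R = rec[OF mem(1)] and R' = rec[OF mem(2)]
  show ?case
  proof (cases "label e = label e'")
    case True
    then have l: "r' = r" "a' = a" "K' = K" using Cons.prems(3) e' by (auto simp: label_def)
    have "P \<le> P'" using le l Cons.prems(3) e' by (auto simp: rec_le_def)
    moreover have "w v v' \<le> \<bar>P - P'\<bar>"
      using rec_entry[OF mem(1)] rec_entry[OF mem(2)] st_dist l(1) by blast
    moreover have "label ` set (e # e' # es) = label ` set (e' # es)" using True by auto
    ultimately show ?thesis using IH l e' by simp
  next
    case False
    \<comment> \<open>By contiguity an interval that has been left does not return, so its length
      enters the sum only once.\<close>
    have new: "label e \<notin> label ` set (e' # es)"
    proof
      assume "label e \<in> label ` set (e' # es)"
      then obtain e'' where e'': "e'' \<in> set (e' # es)" "label e = label e''" by blast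
      then have "e'' \<in> set es" using False by auto
      then have "rec_le e' e''" using Cons.prems(2) by simp
      then have "label e' = label e"
        using label_contiguous[of e e' e''] Cons.prems(1) e'' le by auto
      then show False using False by simp
    qed
    have "label_size (label ` set (e # e' # es)) = K + label_size (label ` set (e' # es))"
    proof -
      have "label ` set (e # e' # es) = insert (label e) (label ` set (e' # es))" by simp
      also have "label_size \<dots> = (case label e of (r, a, K) \<Rightarrow> K) + label_size (label ` set (e' # es))"
        by (rule sum.insert[OF _ new]) simp
      finally show ?thesis using Cons.prems(3) by (simp add: label_def)
    qed
    moreover have "w v v' \<le> w v q + w q v'" "w v q = w q v"
      using tri[of v q v'] sym[of v q] R R' DV rec_entry[OF mem(1)] rec_entry[OF mem(2)] st_mem by blast+
    moreover have "P - a \<le> K" "0 \<le> P' - a'" "w q v \<le> 8 * K" "w q v' \<le> 8 * K'"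
      using R R' by auto
    ultimately show ?thesis using IH e' by simp
  qed
qed

definition depot_labels :: "nat \<Rightarrow> (nat \<times> int \<times> int) set" where
  "depot_labels q = label ` {e \<in> set rs. fst (snd (snd (snd (snd (snd e))))) = q}"

lemma depot_labels_iff: "(r, a, K) \<in> depot_labels q \<longleftrightarrow> (\<exists>v P act. (v, P, r, a, K, q, act) \<in> set rs)"
  unfolding depot_labels_def label_def by force

lemma finite_depot_labels: "finite (depot_labels q)"
  by (simp add: depot_labels_def)

lemma path_len_served: "path_len w q (served rs q) \<le> 17 * label_size (depot_labels q)"
proof -
  define es where "es = filter (\<lambda>(v, P, r, a, K, q', act). q' = q) rs"
  have srv: "served rs q = map fst es" by (simp add: served_def es_def)
  have lab: "depot_labels q = label ` set es"
    unfolding depot_labels_def es_def by (auto simp: case_prod_unfold)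
  have srt: "sorted_wrt rec_le es" unfolding es_def by (rule sorted_wrt_filter[OF rs_sorted])
  show ?thesis
  proof (cases es)
    case Nil
    then show ?thesis unfolding srv lab by simp
  next
    case (Cons e es')
    have q: "q' = q" if "(v, P, r, a, K, q', act) \<in> set (e # es')" for v P r a K q' act
      using that unfolding Cons[symmetric] es_def by simp
    obtain v P r a K q' act where e1: "e = (v, P, r, a, K, q', act)" by (cases e) blast
    have "q' = q" by (rule q[of v P r a K q' act]) (simp add: e1)
    then have e: "e = (v, P, r, a, K, q, act)" using e1 by simp
    have sub: "set (e # es') \<subseteq> set rs" unfolding Cons[symmetric] es_def by auto
    have "path_len w v (map fst es') + 8 * K + (P - a) \<le> 17 * label_size (label ` set (e # es'))"
      by (rule path_len_block[OF sub _ e q]) (use srt Cons in simp_all)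
    moreover have "w q v \<le> 8 * K" "a < P" using rec[of v P r a K q act] sub e by auto
    ultimately show ?thesis unfolding srv lab Cons using e by simp
  qed
qed

lemma depot_labels_disjoint: "q \<noteq> q' \<Longrightarrow> depot_labels q \<inter> depot_labels q' = {}"
proof (rule equals0I)
  fix x assume "q \<noteq> q'" "x \<in> depot_labels q \<inter> depot_labels q'"
  then obtain r a K v P act v' P' act' where e: "(v, P, r, a, K, q, act) \<in> set rs" "(v', P', r, a, K, q', act') \<in> set rs"
    by (cases x) (auto simp: depot_labels_iff)
  have "0 < K" using rec[OF e(1)] by auto
  then show False using labels[OF e] \<open>q \<noteq> q'\<close> by auto
qed

section \<open>All intervals, their number and their tail sums\<close>

definition all_labels :: "(nat \<times> int \<times> int) set" where
  "all_labels = label ` set rs"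

lemma all_labels_iff: "(r, a, K) \<in> all_labels \<longleftrightarrow> (\<exists>v P q act. (v, P, r, a, K, q, act) \<in> set rs)"
  unfolding all_labels_def label_def by force

lemma finite_all_labels: "finite all_labels"
  by (simp add: all_labels_def)

lemma all_labels_power: "(r, a, K) \<in> all_labels \<Longrightarrow> \<exists>i. K = 2 ^ i"
  unfolding all_labels_iff using rec by blast

lemma all_labels_eq: "all_labels = (\<Union>q\<in>D. depot_labels q)"
proof (intro equalityI subsetI)
  fix x assume "x \<in> all_labels"
  then obtain r a K v P q act where x: "x = (r, a, K)" "(v, P, r, a, K, q, act) \<in> set rs"
    by (cases x) (auto simp: all_labels_iff)
  then have "x \<in> depot_labels q" "q \<in> D" using rec[OF x(2)] unfolding x(1) depot_labels_iff by blast+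
  then show "x \<in> (\<Union>q\<in>D. depot_labels q)" by blast
qed (auto simp: all_labels_def depot_labels_def)

text \<open>At most 3 active and 6 frozen intervals of a given length.\<close>

lemma count_labels: "card {(r, a). (r, a, K) \<in> depot_labels q} \<le> 9"
proof -
  let ?A = "{(r, a). \<exists>v P K. (v, P, r, a, K, q, True) \<in> set rs}"
  let ?F = "{(r, a). \<exists>v P. (v, P, r, a, K, q, False) \<in> set rs}"
  have "?A \<subseteq> (\<lambda>(v, P, r, a, K, q, act). (r, a)) ` set rs" "?F \<subseteq> (\<lambda>(v, P, r, a, K, q, act). (r, a)) ` set rs"
    by force+
  then have fin: "finite ?A" "finite ?F" by (simp_all add: finite_subset)
  have "{(r, a). (r, a, K) \<in> depot_labels q} \<subseteq> ?A \<union> ?F"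
  proof
    fix x assume "x \<in> {(r, a). (r, a, K) \<in> depot_labels q}"
    then obtain r a v P act where x: "x = (r, a)" "(v, P, r, a, K, q, act) \<in> set rs"
      by (auto simp: depot_labels_iff)
    show "x \<in> ?A \<union> ?F"
    proof (cases act)
      case True
      then have "(v, P, r, a, K, q, True) \<in> set rs" using x(2) by simp
      then show ?thesis unfolding x(1) by blast
    next
      case False
      then have "(v, P, r, a, K, q, False) \<in> set rs" using x(2) by simp
      then show ?thesis unfolding x(1) by blast
    qed
  qed
  then have "card {(r, a). (r, a, K) \<in> depot_labels q} \<le> card (?A \<union> ?F)"
    using fin by (intro card_mono) auto
  also have "\<dots> \<le> card ?A + card ?F" by (rule card_Un_le)
  finally show ?thesis using count_active[of q] count_frozen[of K q] by linarith
qed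

text \<open>The sizes of the intervals of a depot form a geometric series.\<close>

lemma path_len_max:
  "path_len w q (served rs q) \<le> 0 \<or>
   (\<exists>r a m. (r, a, 2 ^ m) \<in> depot_labels q \<and> path_len w q (served rs q) \<le> 306 * 2 ^ m)"
proof (cases "depot_labels q = {}")
  case True
  then show ?thesis using path_len_served[of q] by simp
next
  case False
  define Ks where "Ks = (\<lambda>(r, a, K). K) ` depot_labels q"
  have fK: "finite Ks" "Ks \<noteq> {}" using False finite_depot_labels by (simp_all add: Ks_def)
  have pw: "\<exists>i. K = 2 ^ i" if "(r, a, K) \<in> depot_labels q" for r a K
    using that rec unfolding depot_labels_iff by blast
  have "Max Ks \<in> Ks" using fK by (rule Max_in)
  then obtain r a where ra: "(r, a, Max Ks) \<in> depot_labels q" unfolding Ks_def by auto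
  obtain m where m: "Max Ks = 2 ^ m" using pw[OF ra] by blast
  define Y where "Y i = {(r, a, K) \<in> depot_labels q. K = 2 ^ i}" for i :: nat
  have fY: "finite (Y i)" for i
    unfolding Y_def by (rule finite_subset[OF _ finite_depot_labels[of q]]) auto
  have cY: "card (Y i) \<le> 9" for i
  proof -
    have "Y i = (\<lambda>(r, a). (r, a, 2 ^ i)) ` {(r, a). (r, a, 2 ^ i) \<in> depot_labels q}"
      unfolding Y_def by force
    moreover have "finite {(r, a). (r, a, 2 ^ i) \<in> depot_labels q}"
      by (rule finite_subset[of _ "(\<lambda>(r, a, K). (r, a)) ` depot_labels q"]) (use finite_depot_labels in force)+
    ultimately have "card (Y i) \<le> card {(r, a). (r, a, 2 ^ i) \<in> depot_labels q}"
      using card_image_le by metis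
    then show ?thesis using count_labels[of "2 ^ i" q] by linarith
  qed
  have "depot_labels q = (\<Union>i\<in>{..m}. Y i)"
  proof (intro equalityI subsetI)
    fix x assume x: "x \<in> depot_labels q"
    obtain r a K where e: "x = (r, a, K)" by (cases x) blast
    obtain i where i: "K = 2 ^ i" using pw x e by blast
    have "K \<in> Ks" using x e unfolding Ks_def by force
    then have "(2::int) ^ i \<le> 2 ^ m" using Max_ge[OF fK(1)] i m by metis
    then have "i \<le> m" by simp
    then show "x \<in> (\<Union>i\<in>{..m}. Y i)" using x e i unfolding Y_def by blast
  qed (auto simp: Y_def)
  then have "label_size (depot_labels q) \<le> (\<Sum>i\<le>m. label_size (Y i))"
    using sum_UN_le[of "{..m}" Y "\<lambda>(r, a, K). K"] fY by (auto simp: Y_def)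
  also have "\<dots> \<le> (\<Sum>i\<le>m. 9 * 2 ^ i)"
  proof (rule sum_mono)
    fix i
    have "label_size (Y i) = (\<Sum>x\<in>Y i. 2 ^ i)" by (rule sum.cong) (auto simp: Y_def)
    also have "\<dots> = int (card (Y i)) * 2 ^ i" by simp
    also have "\<dots> \<le> 9 * 2 ^ i" using cY[of i] by (intro mult_right_mono) auto
    finally show "label_size (Y i) \<le> 9 * 2 ^ i" .
  qed
  also have "\<dots> \<le> 18 * 2 ^ m"
    by (induction m) auto
  \<comment> \<open>\<open>306 = 17 * 18\<close>, and 18 is twice the 9 intervals per
    length.\<close>
  finally have "path_len w q (served rs q) \<le> 306 * 2 ^ m" using path_len_served[of q] by simp
  then show ?thesis using ra m by metis
qed

lemma all_labels_tail:
  assumes L1: "L = 1"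
  shows "label_size {(r, a, K) \<in> all_labels. 2 ^ i \<le> K} \<le> 4 * (\<Sum>q | q \<in> D \<and> 2 ^ i < 2 * W q. W q)"
proof (cases i)
  case 0
  have "spread all_labels" unfolding spread_def
  proof (intro conjI allI impI)
    show "finite all_labels" by (rule finite_all_labels)
  next
    fix r a K assume "(r, a, K) \<in> all_labels"
    then obtain v P q act where e: "(v, P, r, a, K, q, act) \<in> set rs" by (auto simp: all_labels_iff)
    show "0 \<le> a" "0 < K" using rec[OF e] by auto
    show "full st K r a"
    proof (cases act)
      case True
      then have e': "(v, P, r, a, K, q, True) \<in> set rs" using e by simp
      have "K = 1" using active[OF e'] L1 by simp
      obtain l where l: "(v, v, l, P, r) \<in> set st" using rec_entry[OF e] by blast
      \<comment> \<open>A unit interval that contains a point is full, because positions are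
        integers: \<open>a < P\<close> gives \<open>a + 1 \<le> P\<close>.\<close>
      show ?thesis by (rule fullI[OF l]) (use rec[OF e] \<open>K = 1\<close> in linarith)
    next
      case False
      then have "(v, P, r, a, K, q, False) \<in> set rs" using e by simp
      then show ?thesis by (rule frozen)
    qed
  next
    fix r a K a' K' assume "(r, a, K) \<in> all_labels" "(r, a', K') \<in> all_labels"
    then obtain v P q act v' P' q' act'
      where e: "(v, P, r, a, K, q, act) \<in> set rs" "(v', P', r, a', K', q', act') \<in> set rs"
      unfolding all_labels_iff by blast
    from labels[OF e] show "a = a' \<and> K = K' \<or> a + K \<le> a' \<or> a' + K' \<le> a" by blast
  qed
  then have "label_size all_labels \<le> 2 * (\<Sum>q\<in>D. W q)" by (rule spread_total)
  \<comment> \<open>Weights are integers, so \<open>1 < 2 * W q\<close> fails only for weight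
    0.\<close>
  also have "(\<Sum>q\<in>D. W q) = (\<Sum>q | q \<in> D \<and> 2 ^ i < 2 * W q. W q)"
    using W_nonneg finD 0 by (intro sum.mono_neutral_right) force+
  finally have "label_size all_labels \<le> 2 * (\<Sum>q | q \<in> D \<and> 2 ^ i < 2 * W q. W q)" .
  moreover have "{(r, a, K) \<in> all_labels. 2 ^ i \<le> K} = all_labels"
    using all_labels_power 0 by force
  moreover have "0 \<le> (\<Sum>q | q \<in> D \<and> 2 ^ i < 2 * W q. W q)" using W_nonneg by (intro sum_nonneg) auto
  ultimately show ?thesis by simp
next
  case (Suc j)
  have "{(r, a, K) \<in> all_labels. 2 ^ i \<le> K} = {(r, a, K). 2 ^ i \<le> K \<and> (\<exists>v P q. (v, P, r, a, K, q, False) \<in> set rs)}"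
  proof (intro equalityI subsetI)
    fix x assume "x \<in> {(r, a, K) \<in> all_labels. 2 ^ i \<le> K}"
    then obtain r a K v P q act where x: "x = (r, a, K)" "2 ^ i \<le> K" "(v, P, r, a, K, q, act) \<in> set rs"
      by (auto simp: all_labels_iff)
    have "\<not> act"
    proof
      assume act
      then have "(v, P, r, a, K, q, True) \<in> set rs" using x(3) by simp
      then have "K = 1" using active L1 by blast
      moreover have "(2::int) \<le> 2 ^ i" unfolding Suc by simp
      ultimately show False using x(2) by linarith
    qed
    then have "(v, P, r, a, K, q, False) \<in> set rs" using x(3) by simp
    then show "x \<in> {(r, a, K). 2 ^ i \<le> K \<and> (\<exists>v P q. (v, P, r, a, K, q, False) \<in> set rs)}"
      using x(1,2) by blast
  next
    fix x assume "x \<in> {(r, a, K). 2 ^ i \<le> K \<and> (\<exists>v P q. (v, P, r, a, K, q, False) \<in> set rs)}"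
    then obtain r a K v P q where x: "x = (r, a, K)" "2 ^ i \<le> K" "(v, P, r, a, K, q, False) \<in> set rs" by blast
    then have "(r, a, K) \<in> all_labels" unfolding all_labels_iff by blast
    then show "x \<in> {(r, a, K) \<in> all_labels. 2 ^ i \<le> K}" using x(1,2) by simp
  qed
  then show ?thesis using heavy[of i] L1 by simp
qed

end

section \<open>From interval sizes to norms\<close>

text \<open>Summation by parts: the increments \<open>\<Delta> i\<close> of
  \<open>t powr (p - 1)\<close> along the powers of two sum to \<open>(2 ^ e) powr (p - 1)\<close>,
  so each term becomes a sum over the levels up to \<open>e x\<close>. After the tail bound and a
  swap of sums, each \<open>q\<close> collects the increments with \<open>2 ^ i < 2 * W q\<close>,
  at most \<open>(2 * W q) powr (p - 1)\<close>.\<close>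

lemma layer_cake:
  fixes e :: "'x \<Rightarrow> nat" and W :: "'q \<Rightarrow> real"
  assumes A: "finite A" and D: "finite D" and W: "\<And>q. q \<in> D \<Longrightarrow> 0 \<le> W q" and p: "1 \<le> p"
    and tail: "\<And>i. (\<Sum>x | x \<in> A \<and> i \<le> e x. 2 ^ e x) \<le> 4 * (\<Sum>q | q \<in> D \<and> 2 ^ i < 2 * W q. W q)"
  shows "(\<Sum>x\<in>A. (2 ^ e x) powr p) \<le> 4 * 2 powr (p - 1) * (\<Sum>q\<in>D. W q powr p)"
proof -
  define f where "f i = ((2::real) ^ i) powr (p - 1)" for i
  define \<Delta> where "\<Delta> i = (case i of 0 \<Rightarrow> f 0 | Suc j \<Rightarrow> f (Suc j) - f j)" for i
  have \<Delta>_nonneg: "0 \<le> \<Delta> i" for i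
    using p by (cases i) (auto simp: \<Delta>_def f_def intro!: powr_mono2)
  have sum_\<Delta>: "(\<Sum>i\<le>k. \<Delta> i) = f k" for k
    by (induction k) (simp_all add: \<Delta>_def)
  obtain N where N: "\<And>x. x \<in> A \<Longrightarrow> e x \<le> N"
    using A by (metis Max_ge finite_imageI imageI)
  \<comment> \<open>The indices with \<open>2 ^ i < c\<close> form an initial segment, on which the
    increments telescope.\<close>
  have inner: "(\<Sum>i\<le>n. if 2 ^ i < c then \<Delta> i else 0) \<le> c powr (p - 1)" for n and c :: real
  proof (induction n)
    case 0
    have "1 \<le> c powr (p - 1)" if "1 < c" using that p by (intro ge_one_powr_ge_zero) auto
    moreover have "\<Delta> 0 = 1" by (simp add: \<Delta>_def f_def)
    moreover have "(\<Sum>i\<le>(0::nat). if 2 ^ i < c then \<Delta> i else 0) = (if 1 < c then \<Delta> 0 else 0)" by simp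
    ultimately show ?case by simp
  next
    case (Suc n)
    show ?case
    proof (cases "2 ^ Suc n < c")
      case True
      have "(\<Sum>i\<le>Suc n. if 2 ^ i < c then \<Delta> i else 0) = (\<Sum>i\<le>Suc n. \<Delta> i)"
      proof (rule sum.cong)
        fix i assume "i \<in> {..Suc n}"
        then have "(2::real) ^ i \<le> 2 ^ Suc n" by (intro power_increasing) auto
        then show "(if 2 ^ i < c then \<Delta> i else 0) = \<Delta> i" using True by simp
      qed simp
      also have "\<dots> = f (Suc n)" by (rule sum_\<Delta>)
      also have "\<dots> \<le> c powr (p - 1)" unfolding f_def using True p by (intro powr_mono2) auto
      finally show ?thesis .
    next
      case False
      then show ?thesis using Suc by simp
    qed
  qed
  have "(\<Sum>x\<in>A. (2 ^ e x) powr p) = (\<Sum>x\<in>A. \<Sum>i\<le>N. if i \<le> e x then \<Delta> i * 2 ^ e x else 0)"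
  proof (rule sum.cong)
    fix x assume x: "x \<in> A"
    have "(\<Sum>i\<le>N. if i \<le> e x then \<Delta> i * 2 ^ e x else 0) = (\<Sum>i\<in>{..N} \<inter> {i. i \<le> e x}. \<Delta> i * 2 ^ e x)"
      by (simp add: sum.inter_restrict)
    also have "{..N} \<inter> {i. i \<le> e x} = {..e x}" using N[OF x] by auto
    also have "(\<Sum>i\<le>e x. \<Delta> i * 2 ^ e x) = f (e x) * 2 ^ e x"
      by (simp add: sum_\<Delta> flip: sum_distrib_right)
    also have "\<dots> = (2 ^ e x) powr p" by (simp add: f_def powr_diff)
    finally show "(2 ^ e x) powr p = (\<Sum>i\<le>N. if i \<le> e x then \<Delta> i * 2 ^ e x else 0)" by simp
  qed simp
  also have "\<dots> = (\<Sum>i\<le>N. \<Sum>x\<in>A. if i \<le> e x then \<Delta> i * 2 ^ e x else 0)" by (rule sum.swap)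
  also have "\<dots> = (\<Sum>i\<le>N. \<Delta> i * (\<Sum>x | x \<in> A \<and> i \<le> e x. 2 ^ e x))"
    using A by (simp add: sum_distrib_left sum.If_cases Int_def)
  also have "\<dots> \<le> (\<Sum>i\<le>N. \<Delta> i * (4 * (\<Sum>q | q \<in> D \<and> 2 ^ i < 2 * W q. W q)))"
    by (intro sum_mono mult_left_mono tail \<Delta>_nonneg)
  also have "\<dots> = 4 * (\<Sum>i\<le>N. \<Sum>q\<in>D. if 2 ^ i < 2 * W q then \<Delta> i * W q else 0)"
    using D by (simp add: sum_distrib_left sum.If_cases Int_def mult_ac)
  also have "\<dots> = 4 * (\<Sum>q\<in>D. \<Sum>i\<le>N. if 2 ^ i < 2 * W q then \<Delta> i * W q else 0)"
    by (subst sum.swap) simp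
  also have "\<dots> = 4 * (\<Sum>q\<in>D. W q * (\<Sum>i\<le>N. if 2 ^ i < 2 * W q then \<Delta> i else 0))"
    by (simp add: sum_distrib_left if_distrib mult_ac cong: if_cong)
  also have "\<dots> \<le> 4 * (\<Sum>q\<in>D. W q * (2 * W q) powr (p - 1))"
    by (intro mult_left_mono sum_mono inner W) auto
  also have "\<dots> = 4 * (\<Sum>q\<in>D. 2 powr (p - 1) * W q powr p)"
  proof (intro arg_cong[of _ _ "\<lambda>s. 4 * s"] sum.cong refl)
    fix q assume "q \<in> D"
    then show "W q * (2 * W q) powr (p - 1) = 2 powr (p - 1) * W q powr p"
      using W[of q] by (cases "W q = 0") (auto simp: powr_mult powr_diff)
  qed
  also have "\<dots> = 4 * 2 powr (p - 1) * (\<Sum>q\<in>D. W q powr p)"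
    by (simp only: sum_distrib_left[symmetric] mult.assoc)
  finally show ?thesis .
qed

context level_state begin

text \<open>Each path is at most 306 times a single interval length of its depot, whose
  \<open>p\<close>-th power is one summand of the sum over all intervals. Different depots have
  different intervals, so the layer cake bounds everything at once, and
  \<open>4 * 2 powr (p - 1) \<le> 4 powr p\<close> turns the factor into
  \<open>1224 powr p\<close>.\<close>

lemma served_norm:
  assumes L1: "L = 1" and p: "1 \<le> (p::real)"
    and len: "\<And>q. q \<in> D \<Longrightarrow> 0 \<le> len q \<and> len q \<le> real_of_int (path_len w q (served rs q))"
  shows "(\<Sum>q\<in>D. len q powr p) \<le> 1224 powr p * (\<Sum>q\<in>D. real_of_int (W q) powr p)"
proof -
  define ex where "ex x = (case x of (r :: nat, a :: int, K) \<Rightarrow> THE i. K = (2::int) ^ i)" for x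
  have ex: "K = 2 ^ ex (r, a, K)" if "(r, a, K) \<in> all_labels" for r a K
    using all_labels_power[OF that] by (auto simp: ex_def)
  have "(\<Sum>x | x \<in> all_labels \<and> i \<le> ex x. 2 ^ ex x) \<le> 4 * (\<Sum>q | q \<in> D \<and> 2 ^ i < 2 * real_of_int (W q). real_of_int (W q))"
    for i
  proof -
    have "{x. x \<in> all_labels \<and> i \<le> ex x} = {(r, a, K) \<in> all_labels. 2 ^ i \<le> K}"
    proof (intro equalityI subsetI)
      fix x assume x: "x \<in> {x. x \<in> all_labels \<and> i \<le> ex x}"
      obtain r a K where e: "x = (r, a, K)" by (cases x) blast
      have "K = 2 ^ ex x" using ex x e by simp
      then have "2 ^ i \<le> K" using x by simp
      then show "x \<in> {(r, a, K) \<in> all_labels. 2 ^ i \<le> K}" using x e by simp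
    next
      fix x assume x: "x \<in> {(r, a, K) \<in> all_labels. 2 ^ i \<le> K}"
      obtain r a K where e: "x = (r, a, K)" by (cases x) blast
      have "K = 2 ^ ex x" using ex x e by simp
      moreover have "2 ^ i \<le> K" using x e by simp
      ultimately have "(2::int) ^ i \<le> 2 ^ ex x" by simp
      then show "x \<in> {x. x \<in> all_labels \<and> i \<le> ex x}" using x e by simp
    qed
    moreover have "(\<Sum>x\<in>{(r, a, K) \<in> all_labels. 2 ^ i \<le> K}. 2 ^ ex x) =
        real_of_int (label_size {(r, a, K) \<in> all_labels. 2 ^ i \<le> K})"
      unfolding of_int_sum
    proof (rule sum.cong)
      fix x assume x: "x \<in> {(r, a, K) \<in> all_labels. 2 ^ i \<le> K}"
      obtain r a K where e: "x = (r, a, K)" by (cases x) blast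
      have "K = 2 ^ ex x" using ex x e by simp
      then have "real_of_int K = 2 ^ ex x" by simp
      then show "2 ^ ex x = real_of_int (case x of (r, a, K) \<Rightarrow> K)" using e by simp
    qed simp
    moreover have "real_of_int (4 * (\<Sum>q | q \<in> D \<and> 2 ^ i < 2 * W q. W q)) =
        4 * (\<Sum>q | q \<in> D \<and> 2 ^ i < 2 * real_of_int (W q). real_of_int (W q))"
    proof -
      have "(2 ^ i < 2 * W q) = (2 ^ i < 2 * real_of_int (W q))" for q
        using of_int_less_iff[where 'a = real, of "2 ^ i" "2 * W q"] by simp
      then show ?thesis by simp
    qed
    ultimately show ?thesis
      using of_int_le_iff[where 'a = real, THEN iffD2, OF all_labels_tail[OF L1, of i]] by simp
  qed
  then have cake: "(\<Sum>x\<in>all_labels. (2 ^ ex x) powr p) \<le> 4 * 2 powr (p - 1) * (\<Sum>q\<in>D. real_of_int (W q) powr p)"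
    using finite_all_labels finD W_nonneg p by (intro layer_cake) auto
  have one: "len q powr p \<le> 306 powr p * (\<Sum>x\<in>depot_labels q. (2 ^ ex x) powr p)" if q: "q \<in> D" for q
    using path_len_max[of q]
  proof
    assume "path_len w q (served rs q) \<le> 0"
    then have "len q = 0" using len[OF q] by linarith
    then show ?thesis by (simp add: sum_nonneg)
  next
    assume "\<exists>r a m. (r, a, 2 ^ m) \<in> depot_labels q \<and> path_len w q (served rs q) \<le> 306 * 2 ^ m"
    then obtain r a m where m: "(r, a, 2 ^ m) \<in> depot_labels q" "path_len w q (served rs q) \<le> 306 * 2 ^ m"
      by blast
    have "(r, a, 2 ^ m) \<in> all_labels" using m(1) q unfolding all_labels_eq by blast
    then have "(2::int) ^ m = 2 ^ ex (r, a, 2 ^ m)" by (rule ex)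
    then have exm: "ex (r, a, 2 ^ m) = m" by simp
    have "real_of_int (path_len w q (served rs q)) \<le> real_of_int (306 * 2 ^ m)"
      using m(2) by (simp only: of_int_le_iff)
    then have "len q \<le> 306 * 2 ^ m" using len[OF q] by simp
    then have "len q powr p \<le> (306 * 2 ^ m) powr p" using len[OF q] p by (intro powr_mono2) auto
    also have "\<dots> = 306 powr p * (2 ^ m) powr p" by (rule powr_mult)
    also have "\<dots> = 306 powr p * (2 ^ ex (r, a, 2 ^ m)) powr p" unfolding exm ..
    also have "\<dots> \<le> 306 powr p * (\<Sum>x\<in>depot_labels q. (2 ^ ex x) powr p)"
      using m(1) finite_depot_labels
      by (intro mult_left_mono member_le_sum[of "(r, a, 2 ^ m)" _ "\<lambda>x. (2 ^ ex x) powr p"]) auto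
    finally show ?thesis .
  qed
  have "(\<Sum>q\<in>D. len q powr p) \<le> (\<Sum>q\<in>D. 306 powr p * (\<Sum>x\<in>depot_labels q. (2 ^ ex x) powr p))"
    by (rule sum_mono) (rule one)
  also have "\<dots> = 306 powr p * (\<Sum>q\<in>D. \<Sum>x\<in>depot_labels q. (2 ^ ex x) powr p)"
    by (simp add: sum_distrib_left)
  also have "(\<Sum>q\<in>D. \<Sum>x\<in>depot_labels q. (2 ^ ex x) powr p) = (\<Sum>x\<in>all_labels. (2 ^ ex x) powr p)"
    unfolding all_labels_eq
    by (rule sum.UNION_disjoint[symmetric]) (use finD finite_depot_labels depot_labels_disjoint in auto)
  also have "306 powr p * \<dots> \<le> 306 powr p * (4 * 2 powr (p - 1) * (\<Sum>q\<in>D. real_of_int (W q) powr p))"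
    using cake by (rule mult_left_mono) simp
  also have "\<dots> = (306 powr p * (4 * 2 powr (p - 1))) * (\<Sum>q\<in>D. real_of_int (W q) powr p)"
    by (simp add: mult_ac)
  also have "\<dots> \<le> 1224 powr p * (\<Sum>q\<in>D. real_of_int (W q) powr p)"
  proof (rule mult_right_mono)
    have "4 * 2 powr (p - 1) = 2 * (2::real) powr p" by (simp add: powr_diff)
    also have "\<dots> \<le> 2 powr p * 2 powr p"
      using powr_mono[of 1 p "2::real"] p by (intro mult_right_mono) auto
    also have "\<dots> = 4 powr p" by (simp flip: powr_mult)
    finally have "306 powr p * (4 * 2 powr (p - 1)) \<le> 306 powr p * 4 powr p" by (intro mult_left_mono) auto
    also have "\<dots> = 1224 powr p" by (simp flip: powr_mult)
    finally show "306 powr p * (4 * 2 powr (p - 1)) \<le> 1224 powr p" .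
  qed (simp add: sum_nonneg)
  finally show ?thesis .
qed

end

section \<open>Paths as trees, and scaling to integers\<close>

lemma path_edges_zip: "path_edges q vs = zip (q # vs) vs"
proof -
  have "snd (foldl (\<lambda>(u, out) v. (v, out @ [(u, v)])) (q, out) vs) = out @ zip (q # vs) vs" for out
    by (induction vs arbitrary: q out) auto
  from this[of "[]"] show ?thesis by (simp add: path_edges_def)
qed

abbreviation path_graph :: "nat \<Rightarrow> nat list \<Rightarrow> nat ugraph" where
  "path_graph q vs \<equiv> (set (q # vs), (\<lambda>(u, v). {u, v}) ` set (zip (q # vs) vs))"

lemma path_edge_iff:
  "e \<in> snd (path_graph q vs) \<longleftrightarrow> (\<exists>i<length vs. e = {(q # vs) ! i, (q # vs) ! Suc i})"
  by (auto simp: set_zip image_iff)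

text \<open>On a cycle, both neighbours of a highest vertex are exactly one lower, hence equal by
  injectivity; but a cycle has at least 3 distinct vertices.\<close>

lemma acyclic_by_heights:
  fixes f :: "'a \<Rightarrow> nat"
  assumes inj: "inj_on f (\<Union>E)" and E: "\<And>x y. {x, y} \<in> E \<Longrightarrow> f y = Suc (f x) \<or> f x = Suc (f y)"
  shows "\<not> is_cycle E xs"
proof
  assume "is_cycle E xs"
  then have len: "3 \<le> length xs" and dist: "distinct xs"
    and e: "\<And>i. i < length xs \<Longrightarrow> {xs ! i, xs ! (Suc i mod length xs)} \<in> E"
    by (auto simp: is_cycle_def)
  let ?n = "length xs"
  have "Max (f ` set xs) \<in> f ` set xs" using len by (intro Max_in) auto
  then obtain x where x: "x \<in> set xs" "f x = Max (f ` set xs)" by auto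
  then obtain i where i: "i < ?n" "xs ! i = x" by (auto simp: in_set_conv_nth)
  have max: "f (xs ! j) \<le> f x" if "j < ?n" for j using that x(2) by simp
  \<comment> \<open>Cyclic predecessor and successor of \<open>i\<close>; adding the length first
    avoids truncated subtraction at \<open>i = 0\<close>.\<close>
  let ?j = "(i + ?n - 1) mod ?n" and ?k = "Suc i mod ?n"
  have j: "?j < ?n" "?k < ?n" using len by (auto intro: mod_less_divisor)
  have eq: "Suc (i + ?n - 1) = i + ?n" using len by linarith
  have "Suc ?j mod ?n = Suc (i + ?n - 1) mod ?n" by (rule mod_Suc_eq)
  then have sj: "Suc ?j mod ?n = i" unfolding eq using i(1) by simp
  have 1: "f (xs ! ?k) = f x - 1 \<and> 0 < f x"
    using E[OF e[OF i(1)]] max[OF j(2)] i(2) by auto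
  have 2: "f (xs ! ?j) = f x - 1"
    using E[OF e[OF j(1)]] max[OF j(1)] i(2) sj by auto
  have "xs ! ?k \<in> \<Union>E" "xs ! ?j \<in> \<Union>E" using e[OF i(1)] e[OF j(1)] by auto
  moreover have "f (xs ! ?k) = f (xs ! ?j)" using 1 2 by (simp only:)
  ultimately have "xs ! ?k = xs ! ?j" by (intro inj_onD[OF inj])
  then have kj: "?k = ?j" using dist j by (simp add: nth_eq_iff_index_eq)
  show False
  proof (cases "i = 0")
    case True
    have "?k = 1" "?j = ?n - 1" unfolding True using len by simp_all
    then show False using kj len by linarith
  next
    case False
    then have pred: "i + ?n - 1 = (i - 1) + ?n" by linarith
    have "?j = (i - 1) mod ?n" unfolding pred by (rule mod_add_self2)
    also have "\<dots> = i - 1" by (rule mod_less) (use i(1) in linarith)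
    finally have j: "?j = i - 1" .
    show False
    proof (cases "Suc i = ?n")
      case True
      then have "?k = 0" by simp
      then show False using kj j True len by linarith
    next
      case False
      then have "?k = Suc i" using i(1) by simp
      then show False using kj j by linarith
    qed
  qed
qed

lemma path_graph_is_tree:
  assumes "distinct (q # vs)" "set (q # vs) \<subseteq> V"
  shows "is_tree_in V (path_graph q vs)"
proof -
  define p where "p = q # vs"
  define E where "E = snd (path_graph q vs)"
  have p: "distinct p" "set p \<subseteq> V" "length p = Suc (length vs)" "p ! 0 = q" using assms by (simp_all add: p_def)
  have E_iff: "e \<in> E \<longleftrightarrow> (\<exists>i<length vs. e = {p ! i, p ! Suc i})" for e
    unfolding E_def p_def by (rule path_edge_iff)
  have nth: "p ! i \<in> set p" if "i \<le> length vs" for i using that p(3) by (intro nth_mem) simp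
  have idx: "\<exists>i\<le>length vs. x = p ! i" if "x \<in> set p" for x
    using that unfolding in_set_conv_nth p(3) less_Suc_eq_le by auto
  have edge: "{p ! i, p ! Suc i} \<in> E" if "i < length vs" for i
    unfolding E_iff using that by blast
  let ?R = "{(x, y). {x, y} \<in> E}"
  have sym: "sym (?R\<^sup>*)" by (rule sym_rtrancl) (simp add: sym_def insert_commute)
  have to: "(q, p ! i) \<in> ?R\<^sup>*" if "i \<le> length vs" for i
    using that
  proof (induction i)
    case (Suc i)
    have "(p ! i, p ! Suc i) \<in> ?R" using edge[of i] Suc.prems by simp
    with Suc.IH[OF Suc_leD[OF Suc.prems]] show ?case by (rule rtrancl_into_rtrancl)
  qed (simp add: p(4))
  have conn: "(u, v) \<in> ?R\<^sup>*" if uv: "u \<in> set p" "v \<in> set p" for u v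
  proof -
    obtain i j where ij: "i \<le> length vs" "u = p ! i" "j \<le> length vs" "v = p ! j"
      using idx[OF uv(1)] idx[OF uv(2)] by blast
    have "(u, q) \<in> ?R\<^sup>*" using symD[OF sym to[OF ij(1)]] ij(2) by simp
    moreover have "(q, v) \<in> ?R\<^sup>*" using to[OF ij(3)] ij(4) by simp
    ultimately show ?thesis by (rule rtrancl_trans)
  qed
  have sub: "E \<subseteq> {{u, v} |u v. u \<in> set p \<and> v \<in> set p \<and> u \<noteq> v}"
  proof
    fix e assume "e \<in> E"
    then obtain i where i: "i < length vs" "e = {p ! i, p ! Suc i}" unfolding E_iff by blast
    have "p ! i \<noteq> p ! Suc i" using p i(1) nth_eq_iff_index_eq[of p i "Suc i"] by simp
    moreover have "p ! i \<in> set p" "p ! Suc i \<in> set p" using i(1) by (auto intro: nth)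
    ultimately show "e \<in> {{u, v} |u v. u \<in> set p \<and> v \<in> set p \<and> u \<noteq> v}" unfolding i(2) by blast
  qed
  \<comment> \<open>The height of a vertex is its index on the path.\<close>
  define f where "f x = (THE i. i \<le> length vs \<and> p ! i = x)" for x
  have f: "f (p ! i) = i" if "i \<le> length vs" for i
    unfolding f_def
  proof (rule the_equality)
    fix j assume "j \<le> length vs \<and> p ! j = p ! i"
    then show "j = i" using p that nth_eq_iff_index_eq[of p j i] by simp
  qed (use that in simp)
  have acyc: "\<not> is_cycle E xs" for xs
  proof (rule acyclic_by_heights[where f = f])
    have "\<Union>E \<subseteq> set p" using sub by blast
    moreover have "inj_on f (set p)"
    proof (rule inj_onI)
      fix x y assume xy: "x \<in> set p" "y \<in> set p" "f x = f y"
      obtain i j where "i \<le> length vs" "x = p ! i" "j \<le> length vs" "y = p ! j"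
        using idx[OF xy(1)] idx[OF xy(2)] by blast
      then show "x = y" using f[of i] f[of j] xy(3) by simp
    qed
    ultimately show "inj_on f (\<Union>E)" by (rule inj_on_subset[rotated])
    fix x y assume "{x, y} \<in> E"
    then obtain i where i: "i < length vs" "{x, y} = {p ! i, p ! Suc i}" unfolding E_iff by blast
    then have "f (p ! i) = i" "f (p ! Suc i) = Suc i" using f by auto
    then show "f y = Suc (f x) \<or> f x = Suc (f y)" using i(2) by (auto simp: doubleton_eq_iff)
  qed
  have "path_graph q vs = (set p, E)" unfolding E_def p_def by simp
  moreover have "set p \<noteq> {}" using p(3) by auto
  ultimately show ?thesis
    unfolding is_tree_in_def using p(2) sub conn acyc by simp
qed

section \<open>Weights of paths and of connected edge sets\<close>

lemma weight_eq_sum_edges: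
  assumes V: "finite V" and E: "E \<subseteq> edges_on V"
  shows "weight d (S, E) = (\<Sum>e\<in>E. d (Min e) (Max e))"
proof -
  have E': "\<exists>x y. e = {x, y} \<and> x < y" if "e \<in> E" for e
  proof -
    have "e \<in> edges_on V" using that E by blast
    then obtain x y where xy: "e = {x, y}" "x \<noteq> y" unfolding edges_on_def by blast
    show ?thesis
    proof (cases "x < y")
      case False
      then have "y < x" using xy(2) by simp
      then show ?thesis using xy(1) by (metis insert_commute)
    qed (use xy(1) in blast)
  qed
  have "(\<Sum>(u, v) | u < v \<and> {u, v} \<in> E. d u v) = (\<Sum>e\<in>E. d (Min e) (Max e))"
  proof (rule sum.reindex_bij_witness[of _ "\<lambda>e. (Min e, Max e)" "\<lambda>(u, v). {u, v}"])
    fix e assume e: "e \<in> E"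
    then obtain x y where xy: "e = {x, y}" "x < y" using E' by blast
    then have m: "Min e = x" "Max e = y" by auto
    show "(case (Min e, Max e) of (u, v) \<Rightarrow> {u, v}) = e" using xy m by simp
    show "(Min e, Max e) \<in> {(u, v). u < v \<and> {u, v} \<in> E}" using xy m e by simp
  qed auto
  then show ?thesis by (simp add: weight_def case_prod_unfold)
qed

context int_metric begin

text \<open>Only an inequality, since an edge that is walked repeatedly counts once in the edge
  set.\<close>

lemma edge_sum_path_graph:
  assumes "set (q # vs) \<subseteq> V"
  shows "(\<Sum>e\<in>snd (path_graph q vs). edge_wt w e) \<le> path_len w q vs"
  using assms
proof (induction vs arbitrary: q)
  case (Cons v vs)
  let ?E = "snd (path_graph v vs)"
  have E: "snd (path_graph q (v # vs)) = insert {q, v} ?E" by simp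
  have "(\<Sum>e\<in>insert {q, v} ?E. edge_wt w e) \<le> edge_wt w {q, v} + (\<Sum>e\<in>?E. edge_wt w e)"
    using edge_wt_doubleton[of q v] nonneg[of q v] Cons.prems
    by (cases "{q, v} \<in> ?E") (simp_all add: insert_absorb)
  also have "\<dots> \<le> w q v + path_len w v vs"
    using edge_wt_doubleton[of q v] Cons by (intro add_mono) auto
  finally show ?case unfolding E by simp
qed simp

text \<open>The edges on the way from \<open>q\<close> to \<open>v\<close> sweep all distances from \<open>q\<close> below \<open>w q v\<close>.\<close>

lemma connected_weight:
  assumes E: "E \<subseteq> edges_on V" and q: "q \<in> V" and v: "(q, v) \<in> {(x, y). {x, y} \<in> E}\<^sup>*"
  shows "w q v \<le> (\<Sum>e\<in>E. edge_wt w e)"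
proof -
  have fE: "finite E" by (rule finite_edges_on[OF E])
  define cells where "cells e = {Min (w q ` e)..<Max (w q ` e)}" for e
  have "{0..<w q v} \<subseteq> (\<Union>e\<in>E. cells e)"
  proof
    fix t assume t: "t \<in> {0..<w q v}"
    show "t \<in> (\<Union>e\<in>E. cells e)"
    proof (rule ccontr)
      assume no: "t \<notin> (\<Union>e\<in>E. cells e)"
      have "w q z \<le> t" if "(q, z) \<in> {(x, y). {x, y} \<in> E}\<^sup>*" for z
        using that
      proof (induction rule: rtrancl_induct)
        case base
        then show ?case using t w_refl[OF q] by simp
      next
        case (step x y)
        then have "t \<notin> cells {x, y}" using no by blast
        then show ?case using step.IH by (auto simp: cells_def not_le)
      qed
      from this[OF v] t show False by simp
    qed
  qed
  then have "card {0..<w q v} \<le> card (\<Union>e\<in>E. cells e)"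
    using fE by (intro card_mono) (auto simp: cells_def)
  also have "\<dots> \<le> (\<Sum>e\<in>E. card (cells e))" by (rule card_UN_le[OF fE])
  finally have "card {0..<w q v} \<le> (\<Sum>e\<in>E. card (cells e))" .
  then have "int (card {0..<w q v}) \<le> (\<Sum>e\<in>E. int (card (cells e)))"
    unfolding of_nat_sum[symmetric] by (rule of_nat_mono)
  also have "\<dots> \<le> (\<Sum>e\<in>E. edge_wt w e)"
  proof (rule sum_mono)
    fix e assume "e \<in> E"
    then have "e \<in> edges_on V" using E by blast
    then obtain x y where xy: "e = {x, y}" "x \<in> V" "y \<in> V" unfolding edges_on_def by blast
    have "w q x \<le> w q y + w y x" "w q y \<le> w q x + w x y" by (rule tri; use q xy in simp)+
    moreover have "w y x = w x y" using sym xy by simp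
    ultimately show "int (card (cells e)) \<le> edge_wt w e"
      using edge_wt_doubleton[OF xy(2,3)] nonneg[OF xy(2,3)] by (auto simp: cells_def xy(1) max_def min_def)
  qed
  finally show ?thesis by (simp split: if_splits)
qed

end

context tours begin

lemma tree_cover_cover:
  assumes T: "tree_cover V D T"
  shows "cover V D w ell st (\<lambda>q. fst (T q)) (\<lambda>q. \<Sum>e\<in>snd (T q). edge_wt w e)"
proof (unfold_locales)
  have tree: "is_tree_in V (T q)" "q \<in> fst (T q)" if "q \<in> D" for q
    using T that by (auto simp: tree_cover_def)
  have edges: "snd (T q) \<subseteq> edges_on V" if "q \<in> D" for q
    using tree(1)[OF that] unfolding is_tree_in_def edges_on_def by blast
  have conn: "(u, v) \<in> {(x, y). {x, y} \<in> snd (T q)}\<^sup>*" if "q \<in> D" "u \<in> fst (T q)" "v \<in> fst (T q)" for q u v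
    using tree(1)[OF that(1)] that(2,3) unfolding is_tree_in_def by blast
  show sub: "fst (T q) \<subseteq> V" if "q \<in> D" for q
    using tree(1)[OF that] unfolding is_tree_in_def by blast
  show "\<exists>q\<in>D. v \<in> fst (T q)" if "v \<in> V" for v
    using T that unfolding tree_cover_def by blast
  show "w q v \<le> (\<Sum>e\<in>snd (T q). edge_wt w e)" if q: "q \<in> D" "v \<in> fst (T q)" for q v
    by (rule connected_weight[OF edges[OF q(1)] _ conn[OF q(1) tree(2)[OF q(1)] q(2)]]) (use q DV in blast)
  show "(\<Sum>v\<in>A - D. ell v) \<le> (\<Sum>e\<in>snd (T q). edge_wt w e)" if A: "q \<in> D" "A \<subseteq> fst (T q)" for q A
  proof (rule lower[OF edges[OF A(1)]])
    show "A \<subseteq> V" using A sub by blast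
    show "A \<subseteq> reach (snd (T q)) D"
      unfolding reach_def using A conn[OF A(1) _ tree(2)[OF A(1)]] by blast
  qed
qed

end

context level_state begin

lemma map_fst_rs: "map fst rs = map fst (filter (\<lambda>(y, c, l, P, r). y = c \<and> l \<noteq> 0) st)"
  using arg_cong[OF points, of "map fst"] by (simp add: comp_def case_prod_unfold)

lemma served_cover: "tree_cover V D (\<lambda>q. path_graph q (served rs q))"
proof -
  have d: "distinct (map fst rs)" "set (map fst rs) = V - D"
    using st_down unfolding map_fst_rs by simp_all
  have sub: "set (served rs q) \<subseteq> V - D" for q
    using d(2) unfolding served_def by auto
  have dis: "distinct (served rs q)" for q
    using d(1) unfolding served_def by (rule distinct_map_filter)
  have tree: "is_tree_in V (path_graph q (served rs q))" if "q \<in> D" for q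
  proof (rule path_graph_is_tree)
    have "q \<notin> set (served rs q)" using sub[of q] that by blast
    then show "distinct (q # served rs q)" using dis[of q] by simp
    show "set (q # served rs q) \<subseteq> V" using sub[of q] that DV by auto
  qed
  have "V \<subseteq> (\<Union>q\<in>D. set (q # served rs q))"
  proof
    fix v assume v: "v \<in> V"
    show "v \<in> (\<Union>q\<in>D. set (q # served rs q))"
    proof (cases "v \<in> D")
      case False
      then have "v \<in> set (map fst rs)" using d(2) v by blast
      then obtain P r a K q act where e: "(v, P, r, a, K, q, act) \<in> set rs" by auto
      have "v \<in> set (served rs q)" unfolding served_def using e by force
      moreover have "q \<in> D" using rec[OF e] by simp
      ultimately show ?thesis by auto
    qed auto
  qed
  moreover have "(\<Union>q\<in>D. set (q # served rs q)) \<subseteq> V" using sub DV by auto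
  ultimately have "(\<Union>q\<in>D. fst (path_graph q (served rs q))) = V" unfolding fst_conv by (rule equalityI[rotated])
  then show ?thesis unfolding tree_cover_def using tree by simp
qed

end

section \<open>From rational instances to integer metrics\<close>

lemma scale_entries_props:
  assumes "\<forall>e\<in>set es. 0 < snd e"
  shows "length (fst (scale_entries es)) = length es \<and> 0 < snd (scale_entries es) \<and>
    (\<forall>k<length es. real_of_int (fst (scale_entries es) ! k) =
       real_of_int (snd (scale_entries es)) * (real_of_int (fst (es ! k)) / real_of_int (snd (es ! k))))"
  using assms
proof (induction es rule: rev_induct)
  case (snoc e es)
  obtain a b where e: "e = (a, b)" by (cases e)
  have b: "0 < b" using snoc.prems e by simp
  obtain zs N where s: "scale_entries es = (zs, N)" by (cases "scale_entries es")
  have IH: "length zs = length es" "0 < N"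
    "\<And>k. k < length es \<Longrightarrow> real_of_int (zs ! k) = real_of_int N * (real_of_int (fst (es ! k)) / real_of_int (snd (es ! k)))"
    using snoc s by auto
  have step: "scale_entries (es @ [e]) = (map (\<lambda>z. z * b) zs @ [a * N], N * b)"
    using s by (simp add: scale_entries_def e)
  show ?case unfolding step
  proof (intro conjI allI impI)
    fix k assume k: "k < length (es @ [e])"
    show "real_of_int (fst (map (\<lambda>z. z * b) zs @ [a * N], N * b) ! k) = real_of_int (snd (map (\<lambda>z. z * b) zs @ [a * N], N * b)) *
        (real_of_int (fst ((es @ [e]) ! k)) / real_of_int (snd ((es @ [e]) ! k)))"
    proof (cases "k < length es")
      case True
      then show ?thesis using IH(1) IH(3)[OF True] by (simp add: nth_append)
    next
      case False
      then have "k = length es" using k by simp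
      then show ?thesis using IH(1) b e by (simp add: nth_append)
    qed
  qed (use IH b in simp_all)
qed (simp add: scale_entries_def)

lemma concat_uniform:
  assumes "\<forall>r\<in>set rws. length r = n" "u < length rws" "v < n"
  shows "concat rws ! (u * n + v) = rws ! u ! v" "u * n + v < length (concat rws)"
proof -
  have "concat rws ! (u * n + v) = rws ! u ! v \<and> u * n + v < length (concat rws)"
    using assms
  proof (induction rws arbitrary: u)
    case (Cons r rws)
    show ?case
    proof (cases u)
      case 0
      then show ?thesis using Cons.prems by (simp add: nth_append)
    next
      case (Suc u')
      have "concat rws ! (u' * n + v) = rws ! u' ! v \<and> u' * n + v < length (concat rws)"
        using Cons.prems Suc by (intro Cons.IH) auto
      then show ?thesis using Cons.prems Suc by (simp add: nth_append)
    qed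
  qed simp
  then show "concat rws ! (u * n + v) = rws ! u ! v" "u * n + v < length (concat rws)" by simp_all
qed

lemma points_props: "distinct (points rws)" "set (points rws) = {..<length rws}"
proof -
  have "length (points rws) = length rws \<and> distinct (points rws) \<and> set (points rws) = {..<length rws}"
    unfolding points_def by (induction rws rule: rev_induct) (auto simp: lessThan_Suc)
  then show "distinct (points rws)" "set (points rws) = {..<length rws}" by simp_all
qed

definition rat_rows :: "nat \<Rightarrow> (nat \<Rightarrow> nat \<Rightarrow> rat) \<Rightarrow> (int \<times> int) list list" where
  "rat_rows n d = map (\<lambda>u. map (\<lambda>v. quotient_of (d u v)) [0..<n]) [0..<n]"

definition instance_input ::
    "nat \<Rightarrow> (nat \<Rightarrow> nat \<Rightarrow> rat) \<Rightarrow> nat set \<Rightarrow> nat \<times> nat list \<times> (int \<times> int) list list" where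
  "instance_input n d D = (n, sorted_list_of_set D, rat_rows n d)"

text \<open>The encoding by type classes agrees with the prescribed one, so the program obtained for
  \<open>solve\<close> runs on the prescribed input.\<close>

lemma encode_instance: "enc_instance n d D = encode (instance_input n d D)"
proof -
  have q: "enc_rat x = encode (quotient_of x)" for x
    by (simp add: enc_rat_def encode_prod_def encode_int_def case_prod_unfold)
  have nat: "enc_nat = encode" by (rule ext) (simp add: enc_nat_def encode_nat_def)
  show ?thesis
    by (simp add: enc_instance_def instance_input_def rat_rows_def encode_list_def nat q comp_def)
qed

lemma encode_solution: "enc_solution ts = encode ts"
proof -
  have nat: "enc_nat = encode" by (rule ext) (simp add: enc_nat_def encode_nat_def)
  have tree: "(case t of (vs, es) \<Rightarrow> Node (enc_list (map enc_nat vs))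
      (enc_list (map (\<lambda>(u, v). Node (enc_nat u) (enc_nat v)) es))) = encode t" for t
    by (cases t) (simp add: encode_list_def nat case_prod_unfold encode_prod_def[abs_def])
  then have "map (\<lambda>(vs, es). Node (enc_list (map enc_nat vs))
      (enc_list (map (\<lambda>(u, v). Node (enc_nat u) (enc_nat v)) es))) ts = map encode ts"
    by (rule map_cong[OF refl])
  then show ?thesis unfolding enc_solution_def encode_list_def by (rule arg_cong)
qed

lemma scaled_distances:
  obtains N :: int where "0 < N"
    "\<And>u v. u < n \<Longrightarrow> v < n \<Longrightarrow>
      real_of_int (wt (n, fst (scale_entries (concat (rat_rows n d)))) u v) = real_of_int N * real_of_rat (d u v)"
proof -
  let ?es = "concat (rat_rows n d)"
  have pos: "\<forall>e\<in>set ?es. 0 < snd e"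
    using quotient_of_denom_pos' by (auto simp: rat_rows_def)
  note sc = scale_entries_props[OF pos]
  show thesis
  proof (rule that[of "snd (scale_entries ?es)"])
    show "0 < snd (scale_entries ?es)" using sc by blast
    fix u v assume uv: "u < n" "v < n"
    have row: "\<forall>r\<in>set (rat_rows n d). length r = n" by (auto simp: rat_rows_def)
    have len: "length (rat_rows n d) = n" by (simp add: rat_rows_def)
    have k: "?es ! (u * n + v) = quotient_of (d u v)" "u * n + v < length ?es"
      using concat_uniform[OF row, of u v] uv len by (simp_all add: rat_rows_def)
    obtain a b where q: "quotient_of (d u v) = (a, b)" by (cases "quotient_of (d u v)")
    have "real_of_rat (d u v) = real_of_int a / real_of_int b"
      using quotient_of_div[OF q] by (simp add: of_rat_divide)
    moreover have "wt (n, fst (scale_entries ?es)) u v = fst (scale_entries ?es) ! (u * n + v)"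
      using sc k(2) by (simp add: wt_def nth_default_def)
    ultimately show "real_of_int (wt (n, fst (scale_entries ?es)) u v) = real_of_int (snd (scale_entries ?es)) * real_of_rat (d u v)"
      using sc k q by simp
  qed
qed

lemma instance_metric:
  assumes inst: "is_instance n d D" and N: "0 < (N::int)"
    and w: "\<And>u v. u < n \<Longrightarrow> v < n \<Longrightarrow> real_of_int (w u v) = real_of_int N * real_of_rat (d u v)"
  shows "int_metric {..<n} D w"
proof -
  interpret Metric_space "{..<n}" "\<lambda>u v. real_of_rat (d u v)" using inst by (simp add: is_instance_def)
  have N': "0 < real_of_int N" using N by simp
  show ?thesis
  proof
    show "D \<subseteq> {..<n}" "D \<noteq> {}" using inst by (simp_all add: is_instance_def)
    fix x y assume xy: "x \<in> {..<n}" "y \<in> {..<n}"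
    have "real_of_int (w x y) = real_of_int (w y x)" using w xy commute[of x y] by simp
    then show "w x y = w y x" by simp
    show "0 < w x y" if "x \<noteq> y"
    proof -
      have "0 < real_of_rat (d x y)" using mdist_pos_less[OF that] xy by simp
      then have "0 < real_of_int (w x y)" using w xy N' by simp
      then show ?thesis by simp
    qed
    fix z assume z: "z \<in> {..<n}"
    have "real_of_rat (d x z) \<le> real_of_rat (d x y) + real_of_rat (d y z)" using triangle xy z by blast
    then have "real_of_int N * real_of_rat (d x z) \<le> real_of_int N * (real_of_rat (d x y) + real_of_rat (d y z))"
      using N' by (intro mult_left_mono) auto
    then have "real_of_int (w x z) \<le> real_of_int (w x y + w y z)" using w xy z by (simp add: distrib_left)
    then show "w x z \<le> w x y + w y z" by (simp only: of_int_le_iff)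
  next
    fix x assume "x \<in> {..<n}"
    then have "real_of_int (w x x) = 0" using w[of x x] zero[of x x] by simp
    then show "w x x = 0" by simp
  qed simp
qed

lemma scaled_weight:
  assumes m: "int_metric {..<n} D w" and w: "\<And>u v. u < n \<Longrightarrow> v < n \<Longrightarrow> real_of_int (w u v) = N * d u v"
    and E: "E \<subseteq> edges_on {..<n}"
  shows "real_of_int (\<Sum>e\<in>E. edge_wt w e) = N * weight d (S, E)"
proof -
  have "real_of_int (edge_wt w e) = N * d (Min e) (Max e)" if "e \<in> E" for e
  proof -
    have "e \<in> edges_on {..<n}" using that E by blast
    then obtain x y where xy: "e = {x, y}" "x < n" "y < n" unfolding edges_on_def by auto
    then have "Min e < n" "Max e < n" by auto
    then show ?thesis using w by (simp add: edge_wt_def)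
  qed
  then have "real_of_int (\<Sum>e\<in>E. edge_wt w e) = (\<Sum>e\<in>E. N * d (Min e) (Max e))" by simp
  also have "\<dots> = N * weight d (S, E)"
    using weight_eq_sum_edges[OF _ E, of d S] by (simp add: sum_distrib_left)
  finally show ?thesis .
qed

lemma tree_edges_on: "is_tree_in V T \<Longrightarrow> snd T \<subseteq> edges_on V"
  unfolding is_tree_in_def edges_on_def by blast

lemma solve_correct:
  assumes inst: "is_instance n d D"
  defines "dr \<equiv> \<lambda>u v. real_of_rat (d u v)"
  obtains T where "represents D (solve (instance_input n d D)) T" "tree_cover {..<n} D T"
    "\<And>p. 1 \<le> p \<Longrightarrow> cover_norm p dr D T \<le> 1224 * opt_norm p dr {..<n} D"
proof -
  define w where "w = wt (n, fst (scale_entries (concat (rat_rows n d))))"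
  define ds where "ds = sorted_list_of_set D"
  define st where "st = annotate (tour w (points (rat_rows n d)) ds)"
  define rs where "rs = final_recs w ds st"
  define T where "T q = path_graph q (served rs q)" for q
  have D: "D \<subseteq> {..<n}" "D \<noteq> {}" "finite D" using inst finite_subset by (auto simp: is_instance_def)
  have ds: "set ds = D" "distinct ds" "sorted_wrt (<) ds" using D by (simp_all add: ds_def)
  obtain N :: int where N: "0 < N" "\<And>u v. u < n \<Longrightarrow> v < n \<Longrightarrow> real_of_int (w u v) = real_of_int N * dr u v"
    unfolding w_def dr_def using scaled_distances[of n d] by blast
  have metric: "int_metric {..<n} D w" by (rule instance_metric[OF inst N(1) N(2)[unfolded dr_def]])
  interpret int_metric "{..<n}" D w by (rule metric)
  have len: "length (rat_rows n d) = n" by (simp add: rat_rows_def)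
  obtain ell where "tours {..<n} D w ell st"
    unfolding st_def
    using tours_exist[of "points (rat_rows n d)" ds] points_props[of "rat_rows n d"] ds(1,3) len by auto
  then interpret tours "{..<n}" D w ell st .
  have solve: "solve (instance_input n d D) = map (\<lambda>q. (q # served rs q, path_edges q (served rs q))) ds"
    by (simp add: solve_def instance_input_def Let_def rs_def st_def w_def ds_def)
  have rep: "represents D (solve (instance_input n d D)) T"
    unfolding represents_def solve by (simp add: T_def path_edges_zip ds_def)
  have fin: "\<exists>bl. level_state {..<n} D w ell st (\<lambda>q. fst (T' q)) (\<lambda>q. \<Sum>e\<in>snd (T' q). edge_wt w e) ds 1 rs bl"
    if "tree_cover {..<n} D T'" for T'
    unfolding rs_def using cover.final_state[OF tree_cover_cover[OF that] ds(1,2)] .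
  \<comment> \<open>The invariant is stated relative to some cover; any one will do for showing that
    the output is itself a cover.\<close>
  obtain T0 where "tree_cover {..<n} D T0" using tree_cover_exists[OF D(1,2)] by blast
  from fin[OF this] obtain bl0
    where "level_state {..<n} D w ell st (\<lambda>q. fst (T0 q)) (\<lambda>q. \<Sum>e\<in>snd (T0 q). edge_wt w e) ds 1 rs bl0" by blast
  then have cover: "tree_cover {..<n} D T" unfolding T_def by (rule level_state.served_cover)
  have edges: "snd (T' q) \<subseteq> edges_on {..<n}" if "tree_cover {..<n} D T'" "q \<in> D" for T' q
    by (rule tree_edges_on) (use that in \<open>simp add: tree_cover_def\<close>)
  have wgt: "real_of_int (\<Sum>e\<in>snd (T' q). edge_wt w e) = real_of_int N * weight dr (T' q)"
    if "tree_cover {..<n} D T'" "q \<in> D" for T' q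
    using scaled_weight[OF metric N(2) edges[OF that], of "fst (T' q)"] by simp
  have wgt_nonneg: "0 \<le> weight dr (T' q)" if T': "tree_cover {..<n} D T'" "q \<in> D" for T' q
  proof -
    have "0 \<le> edge_wt w e" if "e \<in> snd (T' q)" for e
    proof -
      have "e \<in> edges_on {..<n}" using edges[OF T'] that by blast
      then obtain x y where "e = {x, y}" "x \<in> {..<n}" "y \<in> {..<n}" unfolding edges_on_def by blast
      then show ?thesis using edge_wt_doubleton nonneg by metis
    qed
    then have "0 \<le> real_of_int (\<Sum>e\<in>snd (T' q). edge_wt w e)" by (simp add: sum_nonneg)
    then show ?thesis unfolding wgt[OF T'] using N(1) by (simp add: zero_le_mult_iff)
  qed
  have main: "cover_norm p dr D T \<le> 1224 * cover_norm p dr D T'"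
    if p: "1 \<le> p" and T': "tree_cover {..<n} D T'" for p T'
  proof -
    obtain bl where "level_state {..<n} D w ell st (\<lambda>q. fst (T' q)) (\<lambda>q. \<Sum>e\<in>snd (T' q). edge_wt w e) ds 1 rs bl"
      using fin[OF T'] by blast
    then interpret level_state "{..<n}" D w ell st "\<lambda>q. fst (T' q)" "\<lambda>q. \<Sum>e\<in>snd (T' q). edge_wt w e" ds 1 rs bl .
    have "(\<Sum>q\<in>D. (real_of_int N * weight dr (T q)) powr p) \<le>
        1224 powr p * (\<Sum>q\<in>D. real_of_int (\<Sum>e\<in>snd (T' q). edge_wt w e) powr p)"
    proof (rule served_norm[OF refl p])
      fix q assume q: "q \<in> D"
      have "is_tree_in {..<n} (T q)" using cover q by (simp add: tree_cover_def)
      then have "set (q # served rs q) \<subseteq> {..<n}" unfolding is_tree_in_def T_def fst_conv by blast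
      then have "(\<Sum>e\<in>snd (T q). edge_wt w e) \<le> path_len w q (served rs q)"
        unfolding T_def by (rule edge_sum_path_graph)
      then have "real_of_int N * weight dr (T q) \<le> real_of_int (path_len w q (served rs q))"
        unfolding wgt[OF cover q, symmetric] by (simp only: of_int_le_iff)
      moreover have "0 \<le> real_of_int N * weight dr (T q)" using wgt_nonneg[OF cover q] N(1) by simp
      ultimately show "0 \<le> real_of_int N * weight dr (T q) \<and>
          real_of_int N * weight dr (T q) \<le> real_of_int (path_len w q (served rs q))" by simp
    qed
    also have "(\<Sum>q\<in>D. real_of_int (\<Sum>e\<in>snd (T' q). edge_wt w e) powr p) =
        (\<Sum>q\<in>D. (real_of_int N * weight dr (T' q)) powr p)"
      by (intro sum.cong refl) (simp only: wgt[OF T'])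
    also have "\<dots> = real_of_int N powr p * (\<Sum>q\<in>D. weight dr (T' q) powr p)"
      by (simp only: powr_mult sum_distrib_left)
    also have "(\<Sum>q\<in>D. (real_of_int N * weight dr (T q)) powr p) =
        real_of_int N powr p * (\<Sum>q\<in>D. weight dr (T q) powr p)"
      by (simp only: powr_mult sum_distrib_left)
    finally have "real_of_int N powr p * (\<Sum>q\<in>D. weight dr (T q) powr p) \<le>
        real_of_int N powr p * (1224 powr p * (\<Sum>q\<in>D. weight dr (T' q) powr p))"
      by (simp only: mult.left_commute)
    \<comment> \<open>Both sides are homogeneous, so the common denominator cancels.\<close>
    then have le: "(\<Sum>q\<in>D. weight dr (T q) powr p) \<le> 1224 powr p * (\<Sum>q\<in>D. weight dr (T' q) powr p)"
      using N(1) by simp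
    have "cover_norm p dr D T \<le> (1224 powr p * (\<Sum>q\<in>D. weight dr (T' q) powr p)) powr (1 / p)"
      unfolding cover_norm_def using le p by (intro powr_mono2) (auto simp: sum_nonneg)
    also have "\<dots> = (1224 powr p) powr (1 / p) * cover_norm p dr D T'"
      unfolding cover_norm_def by (rule powr_mult)
    also have "(1224 powr p) powr (1 / p) = 1224" using p by (simp add: powr_powr)
    finally show ?thesis .
  qed
  have "cover_norm p dr D T \<le> 1224 * opt_norm p dr {..<n} D" if p: "1 \<le> p" for p
  proof -
    let ?S = "{cover_norm p dr D T |T. tree_cover {..<n} D T}"
    have "finite ?S" by (rule finite_cover_norms[OF finite_lessThan D(1)])
    moreover have "?S \<noteq> {}" using tree_cover_exists[OF D(1,2)] by blast
    ultimately have "Min ?S \<in> ?S" by (rule Min_in)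
    then obtain T' where "tree_cover {..<n} D T'" "opt_norm p dr {..<n} D = cover_norm p dr D T'"
      unfolding opt_norm_def by blast
    then show ?thesis using main[OF p] by simp
  qed
  with rep cover that show thesis by blast
qed

theorem theorem2:
  shows "\<exists>(\<alpha>::real) (c::com).
    \<alpha> \<ge> 1 \<and>
    polynomial_time_on {enc_instance n d D |n d D. is_instance n d D} c \<and>
    (\<forall>(n::nat) (d::nat \<Rightarrow> nat \<Rightarrow> rat) (D::nat set). is_instance n d D \<longrightarrow>
      (\<exists>(ts::solution) (T::nat \<Rightarrow> nat ugraph).
        outputs c (enc_instance n d D) (enc_solution ts) \<and>
        represents D ts T \<and>
        tree_cover {..<n} D T \<and>
        (\<forall>p::real. p \<ge> 1 \<longrightarrow>
          cover_norm p (\<lambda>u v. real_of_rat (d u v)) D T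
            \<le> \<alpha> * opt_norm p (\<lambda>u v. real_of_rat (d u v)) {..<n} D)))"
proof -
  obtain c q where c: "runs c solve q" using PT_solve unfolding PT_def by blast
  have run: "\<exists>t. computes_in (c 0) (enc_instance n d D) t (enc_solution (solve (instance_input n d D))) \<and>
      t \<le> poly q (vsize (enc_instance n d D))" for n d D
  proof -
    obtain t s' where "exec (c 0) ((\<lambda>_. Atom 0)(0 := enc_instance n d D)) t s'"
      "s' 0 = encode (solve (instance_input n d D))"
      "t + sz (solve (instance_input n d D)) \<le> poly q (sz (instance_input n d D))"
      using runsD[OF c, of "(\<lambda>_. Atom 0)(0 := enc_instance n d D)" 0 "instance_input n d D"]
      by (auto simp: encode_instance)
    then show ?thesis unfolding computes_in_def encode_solution
      by (intro exI[of _ t]) (auto simp: encode_instance)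
  qed
  have poly: "polynomial_time_on {enc_instance n d D |n d D. is_instance n d D} (c 0)"
    unfolding polynomial_time_on_def
  proof (intro exI[of _ q] ballI)
    fix x assume "x \<in> {enc_instance n d D |n d D. is_instance n d D}"
    then obtain n d D where "x = enc_instance n d D" by blast
    with run[of n d D] show "\<exists>t y. computes_in (c 0) x t y \<and> t \<le> poly q (vsize x)" by blast
  qed
  have corr: "\<exists>(ts::solution) T. outputs (c 0) (enc_instance n d D) (enc_solution ts) \<and>
        represents D ts T \<and> tree_cover {..<n} D T \<and>
        (\<forall>p::real. p \<ge> 1 \<longrightarrow> cover_norm p (\<lambda>u v. real_of_rat (d u v)) D T
            \<le> 1224 * opt_norm p (\<lambda>u v. real_of_rat (d u v)) {..<n} D)"
    if inst: "is_instance n d D" for n d D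
  proof -
    obtain T where T: "represents D (solve (instance_input n d D)) T" "tree_cover {..<n} D T"
      "\<And>p. 1 \<le> p \<Longrightarrow> cover_norm p (\<lambda>u v. real_of_rat (d u v)) D T
         \<le> 1224 * opt_norm p (\<lambda>u v. real_of_rat (d u v)) {..<n} D"
      using solve_correct[OF inst] by blast
    have "outputs (c 0) (enc_instance n d D) (enc_solution (solve (instance_input n d D)))"
      unfolding outputs_def using run[of n d D] by blast
    then show ?thesis using T by (intro exI[of _ "solve (instance_input n d D)"] exI[of _ T]) simp
  qed
  show ?thesis
    by (intro exI[of _ 1224] exI[of _ "c 0"] conjI allI impI poly corr) simp_all
qed

end
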